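(* If $U_0\in\mathcal{M}^N_{\geqslant}$, then the problem $$\frac{\mathrm{d}U}{\mathrm{d}t}=\mathcal{G}U-U\langle\mathcal{G}U,U\rangle,\qquad U(0)=U_0$$ admits a unique global solution $U\in C^1\big([0,\infty);(H_0^1(\Omega))^N\big)$.
   Context: $\Omega\subset\mathbb{R}^d$ is a bounded domain, and $(\cdot,\cdot)$ denotes the $L^2(\Omega)$ inner product. $\mathcal{V}:\Omega\to\mathbb{R}$ is a potential such that $a(u,v)=\int_\Omega(\nabla u\cdot\nabla v+\mathcal{V}uv)\,dx$ on $H_0^1(\Omega)$ is symmetric, bounded and coercive, with $c_1\|\nabla u\|^2\leqslant a(u,u)\leqslant c_2\|\nabla u\|^2$ for constants $c_1,c_2>0$. The space $H_0^1(\Omega)$ carries the norm $\sqrt{a(u,u)}$. $\mathcal{G}=(-\Delta+\mathcal{V})^{-1}$: for $f\in H^{-1}(\Omega)$, $\mathcal{G}f\in H_0^1(\Omega)$ is the unique element with $a(\mathcal{G}f,v)=\langle f,v\rangle$ for all $v\in H_0^1(\Omega)$. For $N$-tuples $U=(u_1,\dots,u_N)$: - $\mathcal{G}U=(\mathcal{G}u_1,\dots,\mathcal{G}u_N)$; - $UA$ has $j$-th entry $\sum_iu_iA_{ij}$; - $\langle U,V\rangle=((u_i,v_j))_{i,j}$. For symmetric matrices, $A\leqslant B$ means $B-A$ is positive semidefinite. The quasi-Stiefel set is $\mathcal{M}^N_{\geqslant}=\{U\in(H_0^1(\Omega))^N:\langle U,U\rangle\geqslant I_N\}$. *)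

theory Defs
  imports "HOL-Analysis.Analysis"
begin

text \<open>Functions on the domain are represented by functions 'd => real on the ambient
Euclidean space; elements of H_0^1 are identified when they agree in the H-norm.\<close>

definition bdomain :: "'d::euclidean_space set \<Rightarrow> bool" where
  "bdomain \<Omega> \<longleftrightarrow> open \<Omega> \<and> connected \<Omega> \<and> bounded \<Omega> \<and> \<Omega> \<noteq> {}"

definition testfun :: "'d::euclidean_space set \<Rightarrow> ('d \<Rightarrow> real) \<Rightarrow> ('d \<Rightarrow> 'd) \<Rightarrow> bool" where
  "testfun \<Omega> \<phi> g \<longleftrightarrow>
     (\<forall>x. (\<phi> has_derivative (\<lambda>h. g x \<bullet> h)) (at x)) \<and> continuous_on UNIV g \<and>
     compact (closure {x. \<phi> x \<noteq> 0}) \<and> closure {x. \<phi> x \<noteq> 0} \<subseteq> \<Omega>"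

definition H01_pair :: "'d::euclidean_space set \<Rightarrow> ('d \<Rightarrow> real) \<Rightarrow> ('d \<Rightarrow> 'd) \<Rightarrow> bool" where
  "H01_pair \<Omega> u g \<longleftrightarrow>
     u \<in> borel_measurable (lebesgue_on \<Omega>) \<and> g \<in> borel_measurable (lebesgue_on \<Omega>) \<and>
     integrable (lebesgue_on \<Omega>) (\<lambda>x. (u x)^2) \<and>
     integrable (lebesgue_on \<Omega>) (\<lambda>x. (norm (g x))^2) \<and>
     (\<exists>\<phi> \<psi>. (\<forall>k. testfun \<Omega> (\<phi> k) (\<psi> k)) \<and>
        (\<lambda>k. LINT x|lebesgue_on \<Omega>. (\<phi> k x - u x)^2) \<longlonglongrightarrow> 0 \<and>
        (\<lambda>k. LINT x|lebesgue_on \<Omega>. (norm (\<psi> k x - g x))^2) \<longlonglongrightarrow> 0)"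

definition H01 :: "'d::euclidean_space set \<Rightarrow> ('d \<Rightarrow> real) set" where
  "H01 \<Omega> = {u. \<exists>g. H01_pair \<Omega> u g}"

definition wgrad :: "'d::euclidean_space set \<Rightarrow> ('d \<Rightarrow> real) \<Rightarrow> ('d \<Rightarrow> 'd)" where
  "wgrad \<Omega> u = (SOME g. H01_pair \<Omega> u g)"

definition L2inner :: "'d::euclidean_space set \<Rightarrow> ('d \<Rightarrow> real) \<Rightarrow> ('d \<Rightarrow> real) \<Rightarrow> real" where
  "L2inner \<Omega> u v = (LINT x|lebesgue_on \<Omega>. u x * v x)"

definition aform :: "'d::euclidean_space set \<Rightarrow> ('d \<Rightarrow> real) \<Rightarrow> ('d \<Rightarrow> real) \<Rightarrow> ('d \<Rightarrow> real) \<Rightarrow> real" where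
  "aform \<Omega> V u v = (LINT x|lebesgue_on \<Omega>. wgrad \<Omega> u x \<bullet> wgrad \<Omega> v x + V x * u x * v x)"

definition Hnorm :: "'d::euclidean_space set \<Rightarrow> ('d \<Rightarrow> real) \<Rightarrow> ('d \<Rightarrow> real) \<Rightarrow> real" where
  "Hnorm \<Omega> V u = sqrt (aform \<Omega> V u u)"

definition admissible_potential :: "'d::euclidean_space set \<Rightarrow> ('d \<Rightarrow> real) \<Rightarrow> bool" where
  "admissible_potential \<Omega> V \<longleftrightarrow>
     V \<in> borel_measurable (lebesgue_on \<Omega>) \<and>
     (\<forall>u\<in>H01 \<Omega>. \<forall>v\<in>H01 \<Omega>. integrable (lebesgue_on \<Omega>) (\<lambda>x. V x * u x * v x)) \<and>
     (\<exists>c1 c2. c1 > 0 \<and> c2 > 0 \<and> (\<forall>u\<in>H01 \<Omega>.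
        c1 * (LINT x|lebesgue_on \<Omega>. (norm (wgrad \<Omega> u x))^2) \<le> aform \<Omega> V u u \<and>
        aform \<Omega> V u u \<le> c2 * (LINT x|lebesgue_on \<Omega>. (norm (wgrad \<Omega> u x))^2)))"

text \<open>The Green operator G = (-Delta + V)^{-1}: a(G f, v) = (f, v) for all v in H_0^1.\<close>
definition Gop :: "'d::euclidean_space set \<Rightarrow> ('d \<Rightarrow> real) \<Rightarrow> ('d \<Rightarrow> real) \<Rightarrow> ('d \<Rightarrow> real)" where
  "Gop \<Omega> V f = (SOME w. w \<in> H01 \<Omega> \<and> (\<forall>v\<in>H01 \<Omega>. aform \<Omega> V w v = L2inner \<Omega> f v))"

text \<open>N-tuples are indexed by a finite type 'n (N = CARD('n)).\<close>
definition gram :: "'d::euclidean_space set \<Rightarrow> ('n \<Rightarrow> 'd \<Rightarrow> real) \<Rightarrow> ('n \<Rightarrow> 'd \<Rightarrow> real) \<Rightarrow> 'n \<Rightarrow> 'n \<Rightarrow> real" where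
  "gram \<Omega> U W i j = L2inner \<Omega> (U i) (W j)"

definition tmul :: "('n::finite \<Rightarrow> 'd \<Rightarrow> real) \<Rightarrow> ('n \<Rightarrow> 'n \<Rightarrow> real) \<Rightarrow> 'n \<Rightarrow> 'd \<Rightarrow> real" where
  "tmul U A j = (\<lambda>x. \<Sum>i\<in>UNIV. U i x * A i j)"

definition psd :: "('n::finite \<Rightarrow> 'n \<Rightarrow> real) \<Rightarrow> bool" where
  "psd M \<longleftrightarrow> (\<forall>\<xi>. 0 \<le> (\<Sum>i\<in>UNIV. \<Sum>j\<in>UNIV. \<xi> i * M i j * \<xi> j))"

definition quasi_stiefel :: "'d::euclidean_space set \<Rightarrow> ('n::finite \<Rightarrow> 'd \<Rightarrow> real) set" where
  "quasi_stiefel \<Omega> = {U. (\<forall>i. U i \<in> H01 \<Omega>) \<and>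
      psd (\<lambda>i j. gram \<Omega> U U i j - (if i = j then 1 else 0))}"

definition GT :: "'d::euclidean_space set \<Rightarrow> ('d \<Rightarrow> real) \<Rightarrow> ('n \<Rightarrow> 'd \<Rightarrow> real) \<Rightarrow> 'n \<Rightarrow> 'd \<Rightarrow> real" where
  "GT \<Omega> V U = (\<lambda>i. Gop \<Omega> V (U i))"

text \<open>U in C^1([0,inf); (H_0^1)^N) solving dU/dt = G U - U <G U, U>, U(0) = U0,
  all identities in H_0^1 (i.e. up to vanishing H-norm).\<close>
definition is_solution :: "'d::euclidean_space set \<Rightarrow> ('d \<Rightarrow> real) \<Rightarrow> ('n::finite \<Rightarrow> 'd \<Rightarrow> real)
    \<Rightarrow> (real \<Rightarrow> 'n \<Rightarrow> 'd \<Rightarrow> real) \<Rightarrow> bool" where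
  "is_solution \<Omega> V U0 U \<longleftrightarrow>
     (\<forall>t\<ge>0. \<forall>i. U t i \<in> H01 \<Omega>) \<and>
     (\<exists>U'. (\<forall>t\<ge>0. \<forall>i. U' t i \<in> H01 \<Omega>) \<and>
        (\<forall>t\<ge>0. \<forall>i. ((\<lambda>h. Hnorm \<Omega> V (\<lambda>x. (U (t + h) i x - U t i x) / h - U' t i x))
              \<longlongrightarrow> 0) (at 0 within {-t..})) \<and>
        (\<forall>t\<ge>0. \<forall>i. ((\<lambda>s. Hnorm \<Omega> V (\<lambda>x. U' s i x - U' t i x)) \<longlongrightarrow> 0) (at t within {0..})) \<and>
        (\<forall>t\<ge>0. \<forall>i. Hnorm \<Omega> V (\<lambda>x. U' t i x -
              (GT \<Omega> V (U t) i x - tmul (U t) (gram \<Omega> (GT \<Omega> V (U t)) (U t)) i x)) = 0)) \<and>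
     (\<forall>i. Hnorm \<Omega> V (\<lambda>x. U 0 i x - U0 i x) = 0)"

end

theory Submission
  imports Defs
begin

text \<open>
  Realise \<open>H\<^sub>0\<^sup>1(\<Omega>)\<close> as the closure \<open>S\<close> of the pairs \<open>(\<phi>, \<nabla>\<phi>)\<close>, \<open>\<phi>\<close> a test function, in the Hilbert space
  \<open>L\<^sup>2(\<real>\<^sup>d) \<times> L\<^sup>2(\<real>\<^sup>d)\<^sup>d\<close>. The gradient is closable, so a pair in \<open>S\<close> is determined by its first
  component, and by the Poincare inequality the energy norm is equivalent to the norm of \<open>S\<close>. The
  Green operator thus becomes a bounded operator \<open>G\<close>, and the flow becomes the equation
  \<open>u\<^sub>i' = G u\<^sub>i - \<Sum>\<^sub>j (G u\<^sub>j, u\<^sub>i) u\<^sub>j\<close> with a locally Lipschitz right-hand side. Solutions do not blow up: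
  the derivative of \<open>\<Sum>\<^sub>i \<parallel>u\<^sub>i\<parallel>\<^sup>2\<close> is \<open>2 \<Sum>\<^sub>i (G u\<^sub>i, u\<^sub>i)\<^sub>S\<close> minus twice the trace of the product of two
  positive semidefinite matrices, the Gram matrix of \<open>u\<close> and \<open>((G u\<^sub>i, u\<^sub>j))\<^sub>i\<^sub>j\<close>. That trace is
  nonnegative, so \<open>\<parallel>u\<parallel>\<close> grows at most exponentially by Gronwall's inequality.
\<close>

section \<open>The Hilbert space of square-integrable functions\<close>

text \<open>The equation is posed for individual functions, with weak gradient and Green operator
  picked by a choice operator, whereas calculus needs a Banach space. Storing function and gradient
  as one pair makes the space complete by construction, and extension by zero puts all integrals on
  the whole space, where translation invariance is available. Two obstacles shape the rest. A chosen
  gradient is additive only if it is unique up to null sets; integration by parts against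
  polynomials leaves no room for a second one. And the cubic term is only locally Lipschitz, while
  the Picard iteration wants a Lipschitz constant on each bounded time interval. The cubic term is
  therefore precomposed with a retraction onto a ball growing in time. By homogeneity this
  multiplies it along a solution by a nonnegative number, so the trace argument also bounds the
  truncated solution, which thus never feels the truncation. The norm estimated belongs to
  \<open>S\<close>, the coefficients of the cubic term to \<open>L^2\<close>; two different inner
  products meet, hence a trace of a product of two matrices.\<close>

definition square_integrable :: "('d::euclidean_space \<Rightarrow> 'b::euclidean_space) \<Rightarrow> bool" where
  "square_integrable f \<longleftrightarrow>
     f \<in> borel_measurable lebesgue \<and> integrable lebesgue (\<lambda>x. (norm (f x))\<^sup>2)"

lemma square_integrable_measurable:
  "square_integrable f \<Longrightarrow> f \<in> borel_measurable lebesgue"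
  by (simp add: square_integrable_def)

lemma square_integrable_zero: "square_integrable (\<lambda>x. 0)"
  by (simp add: square_integrable_def)

lemma square_integrable_inner:
  assumes f: "square_integrable f" and g: "square_integrable g"
  shows "integrable lebesgue (\<lambda>x. f x \<bullet> g x)"
proof (rule Bochner_Integration.integrable_bound)
  show "integrable lebesgue (\<lambda>x. (norm (f x))\<^sup>2 + (norm (g x))\<^sup>2)"
    using f g by (auto simp: square_integrable_def)
  show "(\<lambda>x. f x \<bullet> g x) \<in> borel_measurable lebesgue"
    using f g by (auto simp: square_integrable_def)
  have "\<bar>f x \<bullet> g x\<bar> \<le> (norm (f x))\<^sup>2 + (norm (g x))\<^sup>2" for x
  proof -
    have "\<bar>f x \<bullet> g x\<bar> \<le> norm (f x) * norm (g x)"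
      by (rule Cauchy_Schwarz_ineq2)
    also have "\<dots> \<le> (norm (f x))\<^sup>2 + (norm (g x))\<^sup>2"
    proof -
      have "0 \<le> norm (f x) * norm (g x)" by simp
      then show ?thesis
        using sum_squares_bound[of "norm (f x)" "norm (g x)"] by linarith
    qed
    finally show ?thesis .
  qed
  then show "AE x in lebesgue. norm (f x \<bullet> g x) \<le> norm ((norm (f x))\<^sup>2 + (norm (g x))\<^sup>2)"
    by simp
qed

lemma square_integrable_scaleR:
  "square_integrable f \<Longrightarrow> square_integrable (\<lambda>x. c *\<^sub>R f x)"
  unfolding square_integrable_def by (elim conjE) (simp add: power_mult_distrib, measurable)

lemma square_integrable_add:
  assumes f: "square_integrable f" and g: "square_integrable g"
  shows "square_integrable (\<lambda>x. f x + g x)"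
proof -
  have *: "(norm (f x + g x))\<^sup>2 = f x \<bullet> f x + 2 * (f x \<bullet> g x) + g x \<bullet> g x" for x
    by (simp add: power2_norm_eq_inner inner_simps inner_commute)
  have [measurable]: "f \<in> borel_measurable lebesgue" "g \<in> borel_measurable lebesgue"
    using f g by (auto simp: square_integrable_def)
  have "(\<lambda>x. f x + g x) \<in> borel_measurable lebesgue" by measurable
  then show ?thesis
    using square_integrable_inner[OF f f] square_integrable_inner[OF f g]
      square_integrable_inner[OF g g]
    unfolding square_integrable_def * by simp
qed

lemma square_integrable_minus:
  "square_integrable f \<Longrightarrow> square_integrable (\<lambda>x. - f x)"
  using square_integrable_scaleR[of f "-1"] by simp

lemma square_integrable_diff:
  "square_integrable f \<Longrightarrow> square_integrable g \<Longrightarrow> square_integrable (\<lambda>x. f x - g x)"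
  using square_integrable_add[of f "\<lambda>x. - g x"] square_integrable_minus[of g] by simp

\<comment> \<open>Limits, derivatives and integrals of vector-valued curves are governed by type
  classes, so the classes modulo null sets have to form a type. The relation is partial because it
  is reflexive only on the square-integrable functions.\<close>
quotient_type (overloaded) ('d, 'b) L2 =
  "'d::euclidean_space \<Rightarrow> 'b::euclidean_space" / partial:
  "\<lambda>f g. square_integrable f \<and> square_integrable g \<and> (AE x in lebesgue. f x = g x)"
proof (rule part_equivpI)
  show "\<exists>f::'d \<Rightarrow> 'b. square_integrable f \<and> square_integrable f \<and> (AE x in lebesgue. f x = f x)"
    using square_integrable_zero by auto
  show "symp (\<lambda>f g::'d \<Rightarrow> 'b. square_integrable f \<and> square_integrable g \<and> (AE x in lebesgue. f x = g x))"
    by (auto simp: symp_def)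
  show "transp (\<lambda>f g::'d \<Rightarrow> 'b. square_integrable f \<and> square_integrable g \<and> (AE x in lebesgue. f x = g x))"
    by (auto simp: transp_def)
qed

instantiation L2 :: (euclidean_space, euclidean_space) real_vector
begin

lift_definition zero_L2 :: "('a, 'b) L2" is "\<lambda>x. 0"
  by (simp add: square_integrable_zero)

lift_definition plus_L2 :: "('a, 'b) L2 \<Rightarrow> ('a, 'b) L2 \<Rightarrow> ('a, 'b) L2" is "\<lambda>f g x. f x + g x"
  by (auto intro: square_integrable_add)

lift_definition minus_L2 :: "('a, 'b) L2 \<Rightarrow> ('a, 'b) L2 \<Rightarrow> ('a, 'b) L2" is "\<lambda>f g x. f x - g x"
  by (auto intro: square_integrable_diff)

lift_definition uminus_L2 :: "('a, 'b) L2 \<Rightarrow> ('a, 'b) L2" is "\<lambda>f x. - f x"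
  by (auto intro: square_integrable_minus)

lift_definition scaleR_L2 :: "real \<Rightarrow> ('a, 'b) L2 \<Rightarrow> ('a, 'b) L2" is "\<lambda>c f x. c *\<^sub>R f x"
  by (auto intro: square_integrable_scaleR)

instance
proof
  fix f g h :: "('a, 'b) L2" and r s :: real
  note intros = square_integrable_add square_integrable_diff square_integrable_minus
    square_integrable_scaleR square_integrable_zero
  show "f + g + h = f + (g + h)" by transfer (simp add: intros add.assoc)
  show "f + g = g + f" by transfer (simp add: intros add.commute)
  show "0 + f = f" by transfer simp
  show "- f + f = 0" by transfer (simp add: intros)
  show "f - g = f + - g" by transfer (simp add: intros)
  show "r *\<^sub>R (f + g) = r *\<^sub>R f + r *\<^sub>R g" by transfer (simp add: intros scaleR_add_right)
  show "(r + s) *\<^sub>R f = r *\<^sub>R f + s *\<^sub>R f" by transfer (simp add: intros scaleR_add_left)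
  show "r *\<^sub>R s *\<^sub>R f = (r * s) *\<^sub>R f" by transfer (simp add: intros)
  show "1 *\<^sub>R f = f" by transfer simp
qed

end

instantiation L2 :: (euclidean_space, euclidean_space) real_inner
begin

lift_definition inner_L2 :: "('a, 'b) L2 \<Rightarrow> ('a, 'b) L2 \<Rightarrow> real"
  is "\<lambda>f g. LINT x|lebesgue. f x \<bullet> g x"
  by (rule integral_cong_AE) (auto simp: square_integrable_def)

definition norm_L2 :: "('a, 'b) L2 \<Rightarrow> real" where "norm_L2 f = sqrt (f \<bullet> f)"
definition dist_L2 :: "('a, 'b) L2 \<Rightarrow> ('a, 'b) L2 \<Rightarrow> real" where "dist_L2 f g = norm (f - g)"
definition sgn_L2 :: "('a, 'b) L2 \<Rightarrow> ('a, 'b) L2" where "sgn_L2 f = f /\<^sub>R norm f"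
definition uniformity_L2 :: "(('a, 'b) L2 \<times> ('a, 'b) L2) filter" where
  "uniformity_L2 = (INF e\<in>{0 <..}. principal {(x, y). dist x y < e})"
definition open_L2 :: "('a, 'b) L2 set \<Rightarrow> bool" where
  "open_L2 U = (\<forall>x\<in>U. \<forall>\<^sub>F (x', y) in uniformity. x' = x \<longrightarrow> y \<in> U)"

instance
proof
  fix f g h :: "('a, 'b) L2" and r s :: real
  show "dist f g = norm (f - g)" by (rule dist_L2_def)
  show "sgn f = f /\<^sub>R norm f" by (rule sgn_L2_def)
  show "uniformity = (INF e\<in>{0 <..}. principal {(x::('a, 'b) L2, y). dist x y < e})"
    by (rule uniformity_L2_def)
  show "open U = (\<forall>x\<in>U. \<forall>\<^sub>F (x', y) in uniformity. x' = x \<longrightarrow> y \<in> U)" for U :: "('a, 'b) L2 set"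
    by (rule open_L2_def)
  show "f \<bullet> g = g \<bullet> f"
    by transfer (simp add: inner_commute)
  show "(f + g) \<bullet> h = f \<bullet> h + g \<bullet> h"
    by transfer (simp add: inner_add_left square_integrable_inner)
  show "(r *\<^sub>R f) \<bullet> g = r * (f \<bullet> g)"
    by transfer simp
  show "0 \<le> f \<bullet> f"
    by transfer simp
  show "f \<bullet> f = 0 \<longleftrightarrow> f = 0"
  proof (transfer, goal_cases)
    case (1 f)
    then have "(LINT x|lebesgue. f x \<bullet> f x) = 0 \<longleftrightarrow> (AE x in lebesgue. f x \<bullet> f x = 0)"
      by (intro integral_nonneg_eq_0_iff_AE square_integrable_inner) auto
    with 1 show ?case
      by (simp add: square_integrable_zero)
  qed
  show "norm f = sqrt (f \<bullet> f)" by (rule norm_L2_def)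
qed

end

text \<open>Made total by the value 0 on functions that are not square-integrable; every rule about
  it therefore carries \<open>square_integrable\<close> as a premise.\<close>

lift_definition toL2 :: "('d::euclidean_space \<Rightarrow> 'b::euclidean_space) \<Rightarrow> ('d, 'b) L2"
  is "\<lambda>f. if square_integrable f then f else (\<lambda>x. 0)"
  by (simp add: square_integrable_zero)

lemma toL2_eq_iff:
  "square_integrable f \<Longrightarrow> square_integrable g \<Longrightarrow> toL2 f = toL2 g \<longleftrightarrow> (AE x in lebesgue. f x = g x)"
  by transfer simp

lemma toL2_cases:
  obtains f where "square_integrable f" "y = toL2 f"
proof -
  have "\<exists>f. square_integrable f \<and> y = toL2 f"
  proof (transfer, goal_cases)
    case (1 f)
    then show ?case by (intro exI[of _ f]) auto
  qed
  then show ?thesis using that by blast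
qed

lemma toL2_zero: "toL2 (\<lambda>x. 0) = 0"
  by transfer (simp add: square_integrable_zero)

lemma toL2_add:
  "square_integrable f \<Longrightarrow> square_integrable g \<Longrightarrow> toL2 (\<lambda>x. f x + g x) = toL2 f + toL2 g"
  by transfer (simp add: square_integrable_add)

lemma toL2_diff:
  "square_integrable f \<Longrightarrow> square_integrable g \<Longrightarrow> toL2 (\<lambda>x. f x - g x) = toL2 f - toL2 g"
  by transfer (simp add: square_integrable_diff)

lemma toL2_scaleR: "square_integrable f \<Longrightarrow> toL2 (\<lambda>x. c *\<^sub>R f x) = c *\<^sub>R toL2 f"
  by transfer (simp add: square_integrable_scaleR)

lemma inner_toL2:
  "square_integrable f \<Longrightarrow> square_integrable g \<Longrightarrow> toL2 f \<bullet> toL2 g = (LINT x|lebesgue. f x \<bullet> g x)"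
  by transfer simp

lemma norm_toL2:
  "square_integrable f \<Longrightarrow> (norm (toL2 f))\<^sup>2 = (LINT x|lebesgue. (norm (f x))\<^sup>2)"
  by (simp add: power2_norm_eq_inner inner_toL2)

lemma nn_integral_toL2:
  assumes "square_integrable f"
  shows "(\<integral>\<^sup>+x. ennreal ((norm (f x))\<^sup>2) \<partial>lebesgue) = ennreal ((norm (toL2 f))\<^sup>2)"
  using assms by (simp add: norm_toL2 nn_integral_eq_integral square_integrable_def)

text \<open>If \<open>\<parallel>f\<^sub>k\<^sub>+\<^sub>1 - f\<^sub>k\<parallel>\<^sup>2 \<le> 8\<^sup>-\<^sup>k\<close>, then \<open>\<Sum>\<^sub>k 4\<^sup>k |f\<^sub>k\<^sub>+\<^sub>1(x) - f\<^sub>k(x)|\<^sup>2\<close> has finite integral,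
  so almost every \<open>f\<^sub>k(x)\<close> is Cauchy.\<close>

lemma AE_convergent_of_fast_Cauchy:
  fixes f :: "nat \<Rightarrow> 'd::euclidean_space \<Rightarrow> 'b::euclidean_space"
  assumes f: "\<And>k. square_integrable (f k)"
    and fast: "\<And>k. (norm (toL2 (f (Suc k)) - toL2 (f k)))\<^sup>2 \<le> (1/8)^k"
  shows "AE x in lebesgue. convergent (\<lambda>k. f k x)"
proof -
  \<comment> \<open>The weight \<open>4^k\<close> splits the rate \<open>(1/8)^k\<close>: the
    integrals still decay like \<open>(1/2)^k\<close>, and a term below 1 bounds the increment
    itself by \<open>(1/2)^k\<close>, which is again summable.\<close>
  define h where "h k x = (4::real)^k * (norm (f (Suc k) x - f k x))\<^sup>2" for k x
  note [measurable] = square_integrable_measurable[OF f]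
  have hm[measurable]: "h k \<in> borel_measurable lebesgue" for k
    unfolding h_def by measurable
  have int: "(\<integral>\<^sup>+x. ennreal (h k x) \<partial>lebesgue) \<le> ennreal ((1/2)^k)" for k
  proof -
    have "(\<integral>\<^sup>+x. ennreal (h k x) \<partial>lebesgue)
        = ennreal (4^k) * (\<integral>\<^sup>+x. ennreal ((norm (f (Suc k) x - f k x))\<^sup>2) \<partial>lebesgue)"
      unfolding h_def by (subst nn_integral_cmult[symmetric]) (auto simp: ennreal_mult)
    also have "\<dots> = ennreal (4^k * (norm (toL2 (f (Suc k)) - toL2 (f k)))\<^sup>2)"
      using nn_integral_toL2[OF square_integrable_diff[OF f f]]
      by (simp add: toL2_diff f ennreal_mult)
    also have "\<dots> \<le> ennreal (4^k * (1/8)^k)"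
      using fast by (intro ennreal_leI mult_left_mono) auto
    also have "4^k * (1/8)^k = (1/2::real)^k"
      by (simp flip: power_mult_distrib)
    finally show ?thesis .
  qed
  have "(\<integral>\<^sup>+x. (\<Sum>k. ennreal (h k x)) \<partial>lebesgue) = (\<Sum>k. \<integral>\<^sup>+x. ennreal (h k x) \<partial>lebesgue)"
    by (rule nn_integral_suminf) simp
  also have "\<dots> \<le> (\<Sum>k. ennreal ((1/2)^k))"
    by (intro suminf_le int) auto
  also have "\<dots> = ennreal (\<Sum>k. (1/2)^k)"
    by (intro suminf_ennreal2) auto
  finally have "(\<integral>\<^sup>+x. (\<Sum>k. ennreal (h k x)) \<partial>lebesgue) \<noteq> \<infinity>"
    by (metis ennreal_neq_top infinity_ennreal_def top.extremum_uniqueI)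
  then have "AE x in lebesgue. (\<Sum>k. ennreal (h k x)) \<noteq> \<infinity>"
    by (intro nn_integral_PInf_AE) auto
  then show ?thesis
  proof eventually_elim
    case (elim x)
    have "summable (\<lambda>k. h k x)"
      using elim by (intro summable_suminf_not_top) (auto simp: h_def)
    then have "(\<lambda>k. h k x) \<longlonglongrightarrow> 0"
      by (rule summable_LIMSEQ_zero)
    then have "\<forall>\<^sub>F k in sequentially. h k x < 1"
      by (rule order_tendstoD) simp
    then have "\<forall>\<^sub>F k in sequentially. norm (f (Suc k) x - f k x) \<le> (1/2)^k"
    proof eventually_elim
      case (elim k)
      have "(2^k * norm (f (Suc k) x - f k x))\<^sup>2 = h k x"
        using power_mult_distrib[of "2::real" 2 k]
        by (simp add: h_def power_mult_distrib power2_eq_square flip: power_mult_distrib)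
      then have "(2^k * norm (f (Suc k) x - f k x))\<^sup>2 \<le> 1\<^sup>2"
        using elim by (simp only: power_one)
      then have "2^k * norm (f (Suc k) x - f k x) \<le> 1"
        by (rule power2_le_imp_le) simp
      then show ?case by (simp add: power_divide field_simps)
    qed
    then have "summable (\<lambda>k. f (Suc k) x - f k x)"
      by (rule summable_comparison_test_ev) simp
    then have "convergent (\<lambda>n. \<Sum>k<n. f (Suc k) x - f k x)"
      by (simp add: summable_iff_convergent)
    then have "convergent (\<lambda>n. f n x - f 0 x)"
      using sum_lessThan_telescope[of "\<lambda>k. f k x"] by simp
    then show "convergent (\<lambda>k. f k x)"
      using convergent_add[OF _ convergent_const[of "f 0 x"]] by fastforce
  qed
qed

text \<open>The fast rate yields a pointwise limit almost everywhere. Fatou's lemma for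
  \<open>f n - f m\<close> as \<open>n\<close> grows then does double duty: it shows that the limit
  is square-integrable and that it is the limit in norm.\<close>

lemma LIMSEQ_toL2_of_fast_Cauchy:
  fixes f :: "nat \<Rightarrow> 'd::euclidean_space \<Rightarrow> 'b::euclidean_space"
  assumes f: "\<And>k. square_integrable (f k)"
    and fast: "\<And>k. (norm (toL2 (f (Suc k)) - toL2 (f k)))\<^sup>2 \<le> (1/8)^k"
    and Cauchy: "Cauchy (\<lambda>k. toL2 (f k))"
  shows "\<exists>y. (\<lambda>k. toL2 (f k)) \<longlonglongrightarrow> y"
proof -
  note [measurable] = square_integrable_measurable[OF f]
  \<comment> \<open>The default 0 where the sequence diverges makes \<open>F\<close> measurable on
    the whole space.\<close>
  define F where "F x = (if convergent (\<lambda>k. f k x) then lim (\<lambda>k. f k x) else 0)" for x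
  have Fm[measurable]: "F \<in> borel_measurable lebesgue"
    unfolding F_def convergent_def
    by (rule measurable_If) (measurable, simp add: flip: convergent_def Cauchy_convergent_iff, measurable)
  have lim: "AE x in lebesgue. (\<lambda>k. f k x) \<longlonglongrightarrow> F x"
    using AE_convergent_of_fast_Cauchy[OF f fast]
    by eventually_elim (simp add: F_def convergent_LIMSEQ_iff)
  have Fatou: "(\<integral>\<^sup>+x. ennreal ((norm (F x - f m x))\<^sup>2) \<partial>lebesgue) \<le> ennreal (e\<^sup>2)"
    if e: "\<And>n. n \<ge> m \<Longrightarrow> norm (toL2 (f n) - toL2 (f m)) \<le> e" for m e
  proof -
    have "(\<integral>\<^sup>+x. ennreal ((norm (F x - f m x))\<^sup>2) \<partial>lebesgue)
        = (\<integral>\<^sup>+x. liminf (\<lambda>n. ennreal ((norm (f n x - f m x))\<^sup>2)) \<partial>lebesgue)"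
      using lim
      by (intro nn_integral_cong_AE, eventually_elim)
         (intro lim_imp_Liminf[symmetric] tendsto_intros; simp)
    also have "\<dots> \<le> liminf (\<lambda>n. \<integral>\<^sup>+x. ennreal ((norm (f n x - f m x))\<^sup>2) \<partial>lebesgue)"
      by (rule nn_integral_liminf) measurable
    also have "\<dots> = liminf (\<lambda>n. ennreal ((norm (toL2 (f n) - toL2 (f m)))\<^sup>2))"
      using nn_integral_toL2[OF square_integrable_diff[OF f f]] by (simp add: toL2_diff f)
    also have "\<dots> \<le> liminf (\<lambda>n. ennreal (e\<^sup>2))"
      using e by (intro Liminf_mono eventually_sequentiallyI[of m] ennreal_leI power_mono) auto
    finally show ?thesis by (simp add: Liminf_const)
  qed
  have ev: "\<exists>M. \<forall>m\<ge>M. \<forall>n\<ge>m. norm (toL2 (f n) - toL2 (f m)) \<le> e" if "e > 0" for e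
    using Cauchy that unfolding Cauchy_def dist_norm by (meson le_trans less_imp_le)
  have F: "square_integrable F"
  proof -
    obtain M where "\<And>n. n \<ge> M \<Longrightarrow> norm (toL2 (f n) - toL2 (f M)) \<le> 1"
      using ev[of 1] by auto
    then have "(\<integral>\<^sup>+x. ennreal ((norm (F x - f M x))\<^sup>2) \<partial>lebesgue) \<le> ennreal (1\<^sup>2)"
      by (rule Fatou)
    also have "\<dots> < \<infinity>" by simp
    finally have "(\<integral>\<^sup>+x. ennreal ((norm (F x - f M x))\<^sup>2) \<partial>lebesgue) < \<infinity>" .
    then have "integrable lebesgue (\<lambda>x. (norm (F x - f M x))\<^sup>2)"
      by (intro integrableI_bounded) auto
    then have "square_integrable (\<lambda>x. F x - f M x)"
      by (simp add: square_integrable_def)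
    from square_integrable_add[OF this f[of M]] show ?thesis by simp
  qed
  have "(\<lambda>k. toL2 (f k)) \<longlonglongrightarrow> toL2 F"
  proof (rule metric_LIMSEQ_I)
    fix e :: real assume "e > 0"
    then obtain M where M: "\<forall>m\<ge>M. \<forall>n\<ge>m. norm (toL2 (f n) - toL2 (f m)) \<le> e/2"
      using ev[of "e/2"] by auto
    have "dist (toL2 (f m)) (toL2 F) < e" if "m \<ge> M" for m
    proof -
      have "ennreal ((norm (toL2 F - toL2 (f m)))\<^sup>2) \<le> ennreal ((e/2)\<^sup>2)"
        using Fatou[of m "e/2"] nn_integral_toL2[OF square_integrable_diff[OF F f]] M that
        by (simp add: toL2_diff F f)
      then have "norm (toL2 F - toL2 (f m)) \<le> e/2"
        using \<open>e > 0\<close> by (simp add: power2_le_iff_abs_le)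
      with \<open>e > 0\<close> show ?thesis by (simp add: dist_norm norm_minus_commute)
    qed
    then show "\<exists>M. \<forall>m\<ge>M. dist (toL2 (f m)) (toL2 F) < e" by blast
  qed
  then show ?thesis by blast
qed

instance L2 :: (euclidean_space, euclidean_space) complete_space
proof
  fix Y :: "nat \<Rightarrow> ('a, 'b) L2"
  assume Y: "Cauchy Y"
  define e where "e k = sqrt ((1/8)^k)" for k :: nat
  have "\<exists>M. \<forall>m\<ge>M. \<forall>n\<ge>M. norm (Y m - Y n) < e k" for k
    using CauchyD[OF Y, of "e k"] by (auto simp: e_def)
  then obtain M where M: "\<And>k m n. m \<ge> M k \<Longrightarrow> n \<ge> M k \<Longrightarrow> norm (Y m - Y n) < e k"
    by metis
  \<comment> \<open>The sum dominates every \<open>M i\<close> with \<open>i \<le> k\<close>, and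
    the summand \<open>k\<close> makes \<open>s\<close> strictly increasing even where
    \<open>M\<close> vanishes.\<close>
  define s where "s k = (\<Sum>i\<le>k. M i) + k" for k
  have s_ge: "s k \<ge> M k" "s (Suc k) \<ge> M k" for k
    unfolding s_def using member_le_sum[of k "{..k}" M] by auto
  have "strict_mono s"
    by (rule strict_monoI_Suc) (simp add: s_def)
  define g where "g k = (SOME f. square_integrable f \<and> Y k = toL2 f)" for k
  have g: "square_integrable (g k)" "Y k = toL2 (g k)" for k
    unfolding g_def by (metis (mono_tags, lifting) someI_ex toL2_cases)+
  have "Cauchy (\<lambda>k. Y (s k))"
    using Cauchy_subseq_Cauchy[OF Y \<open>strict_mono s\<close>] by (simp add: o_def)
  moreover have "(norm (Y (s (Suc k)) - Y (s k)))\<^sup>2 \<le> (1/8)^k" for k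
  proof -
    have "(norm (Y (s (Suc k)) - Y (s k)))\<^sup>2 \<le> (e k)\<^sup>2"
      using M[OF s_ge(2) s_ge(1), of k] by (intro power_mono) auto
    then show ?thesis by (simp add: e_def)
  qed
  ultimately obtain y where "(\<lambda>k. Y (s k)) \<longlonglongrightarrow> y"
    using LIMSEQ_toL2_of_fast_Cauchy[of "\<lambda>k. g (s k)"] g by auto
  then show "convergent Y"
    using Cauchy_converges_subseq[OF Y \<open>strict_mono s\<close>, of y]
    by (auto simp: convergent_def o_def)
qed

instance L2 :: (euclidean_space, euclidean_space) banach ..

section \<open>Ordinary differential equations in Banach spaces\<close>

text \<open>Riemann sums are linear combinations of values of \<open>f\<close>, so they lie in
  \<open>S\<close>, and the integral is a limit of them. This keeps the Picard iterates inside the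
  subspace.\<close>

lemma integral_in_closed_subspace:
  fixes f :: "real \<Rightarrow> 'a::banach"
  assumes "closed S" "subspace S" and f: "continuous_on {a..b} f"
    and fS: "\<And>t. t \<in> {a..b} \<Longrightarrow> f t \<in> S"
  shows "integral {a..b} f \<in> S"
proof -
  have "(f has_integral integral {a..b} f) {a..b}"
    using f by (intro integrable_integral integrable_continuous_real)
  then have I: "\<And>e. e > 0 \<Longrightarrow> \<exists>d. gauge d \<and> (\<forall>D. D tagged_division_of {a..b} \<and> d fine D \<longrightarrow>
      norm ((\<Sum>(x,k) \<in> D. measure lborel k *\<^sub>R f x) - integral {a..b} f) < e)"
    by (simp only: has_integral_real)
  have "\<exists>y\<in>S. dist y (integral {a..b} f) < e" if "e > 0" for e
  proof -
    obtain d where d: "gauge d \<and> (\<forall>D. D tagged_division_of {a..b} \<and> d fine D \<longrightarrow>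
        norm ((\<Sum>(x,k) \<in> D. measure lborel k *\<^sub>R f x) - integral {a..b} f) < e)"
      using I[OF \<open>e > 0\<close>] by (rule exE)
    obtain D where D: "D tagged_division_of {a..b}" "d fine D"
      using fine_division_exists_real[OF conjunct1[OF d]] .
    have "(\<Sum>(x,k) \<in> D. measure lborel k *\<^sub>R f x) \<in> S"
    proof (rule subspace_sum[OF \<open>subspace S\<close>], clarify)
      fix x k assume "(x, k) \<in> D"
      then have "x \<in> {a..b}"
        using tagged_division_ofD(2,3)[OF D(1)] by blast
      then show "measure lborel k *\<^sub>R f x \<in> S"
        by (intro subspace_scale \<open>subspace S\<close> fS)
    qed
    moreover have "norm ((\<Sum>(x,k) \<in> D. measure lborel k *\<^sub>R f x) - integral {a..b} f) < e"
      using d D by simp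
    ultimately show ?thesis by (auto simp: dist_norm)
  qed
  then show ?thesis using closed_approachable[OF \<open>closed S\<close>] by blast
qed

text \<open>Because the Lipschitz constant is uniform in \<open>x\<close> on each
  \<open>{0..T}\<close>, the iterates converge on every bounded interval at once and no continuation
  argument is required. The set \<open>S\<close> enters only as an invariant of the iteration,
  preserved in the limit because it is closed.\<close>

lemma global_Picard:
  fixes f :: "real \<Rightarrow> 'a::banach \<Rightarrow> 'a"
  assumes S: "closed S" "subspace S" "x0 \<in> S"
    and cont: "continuous_on ({0..} \<times> UNIV) (\<lambda>(t, x). f t x)"
    and lip: "\<And>T. T \<ge> 0 \<Longrightarrow> \<exists>L. \<forall>t\<in>{0..T}. \<forall>x y. norm (f t x - f t y) \<le> L * norm (x - y)"
    and inv: "\<And>t x. t \<ge> 0 \<Longrightarrow> x \<in> S \<Longrightarrow> f t x \<in> S"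
  obtains x where "x 0 = x0" "\<And>t. t \<ge> 0 \<Longrightarrow> x t \<in> S"
    "\<And>t. t \<ge> 0 \<Longrightarrow> (x has_vector_derivative f t (x t)) (at t within {0..})"
proof -
  have contf: "continuous_on {0..T} (\<lambda>s. f s (g s))" if "continuous_on {0..T} g" for g T
    using continuous_on_compose2[OF cont, of "{0..T}" "\<lambda>s. (s, g s)"] that
    by (force intro!: continuous_intros)
  define X where "X = rec_nat (\<lambda>t. x0) (\<lambda>_ Y t. x0 + integral {0..t} (\<lambda>s. f s (Y s)))"
  have X0: "X 0 = (\<lambda>t. x0)" and XSuc: "X (Suc n) = (\<lambda>t. x0 + integral {0..t} (\<lambda>s. f s (X n s)))" for n
    by (simp_all add: X_def)
  have contX: "continuous_on {0..T} (X n)" for n T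
  proof (induction n)
    case 0
    show ?case by (simp add: X0)
  next
    case (Suc n)
    show ?case unfolding XSuc
      by (intro continuous_intros indefinite_integral_continuous_1 integrable_continuous_real contf Suc)
  qed
  have XS: "X n t \<in> S" if "t \<ge> 0" for n t
    using that
  proof (induction n arbitrary: t)
    case 0
    then show ?case using S by (simp add: X0)
  next
    case (Suc n)
    have "integral {0..t} (\<lambda>s. f s (X n s)) \<in> S"
      using Suc by (intro integral_in_closed_subspace S contf contX inv) auto
    then show ?case using S by (simp add: XSuc subspace_add)
  qed
  define x where "x t = x0 + (\<Sum>n. X (Suc n) t - X n t)" for t
  have unif: "uniform_limit {0..T} X x sequentially" if T: "T \<ge> 0" for T
  proof -
    obtain L' where L': "\<And>t x y. t \<in> {0..T} \<Longrightarrow> norm (f t x - f t y) \<le> L' * norm (x - y)"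
      using lip[OF T] by blast
    define L where "L = max L' 0"
    have L: "norm (f t x - f t y) \<le> L * norm (x - y)" if "t \<in> {0..T}" for t x y
      using L'[OF that, of x y] unfolding L_def
      by (meson max.cobounded1 mult_right_mono norm_ge_zero order_trans)
    have "L \<ge> 0" by (simp add: L_def)
    have "continuous_on {0..T} (\<lambda>t. X (Suc 0) t - X 0 t)"
      by (intro continuous_intros contX)
    then have "bounded ((\<lambda>t. X (Suc 0) t - X 0 t) ` {0..T})"
      by (intro compact_imp_bounded compact_continuous_image) auto
    then obtain M where "\<forall>t\<in>{0..T}. norm (X (Suc 0) t - X 0 t) \<le> M"
      unfolding bounded_iff by auto
    then have M: "norm (X (Suc 0) t - X 0 t) \<le> M" if "t \<in> {0..T}" for t
      using that by blast
    have "M \<ge> 0" using order_trans[OF norm_ge_zero M[of 0]] T by simp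
    \<comment> \<open>The weight \<open>exp (2 * L * t)\<close> of Bielecki's norm: integrating
      \<open>L * exp (2 * L * s)\<close> gains a factor 1/2, so the iteration contracts on an
      interval of any length.\<close>
    have step: "norm (X (Suc n) t - X n t) \<le> M * (1/2)^n * exp (2 * L * t)" if "t \<in> {0..T}" for n t
      using that
    proof (induction n arbitrary: t)
      case 0
      have "norm (X (Suc 0) t - X 0 t) \<le> M * 1" using M[OF 0] by simp
      also have "\<dots> \<le> M * exp (2 * L * t)"
        using 0 \<open>M \<ge> 0\<close> \<open>L \<ge> 0\<close> by (intro mult_left_mono) auto
      finally show ?case by simp
    next
      case (Suc n)
      define c where "c = M * (1/2)^n"
      have "c \<ge> 0" using \<open>M \<ge> 0\<close> by (simp add: c_def)
      have int: "(\<lambda>s. f s (X m s)) integrable_on {0..t}" for m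
        by (intro integrable_continuous_real contf contX)
      have ftc: "((\<lambda>s. L * (c * exp (2 * L * s))) has_integral
          (c / 2 * exp (2 * L * t) - c / 2 * exp (2 * L * 0))) {0..t}"
        using Suc.prems
        by (intro fundamental_theorem_of_calculus)
           (auto intro!: derivative_eq_intros simp flip: has_real_derivative_iff_has_vector_derivative)
      have "X (Suc (Suc n)) t - X (Suc n) t
          = integral {0..t} (\<lambda>s. f s (X (Suc n) s) - f s (X n s))"
        unfolding XSuc[of "Suc n"] by (subst (2) XSuc, subst integral_diff[OF int int]) simp
      also have "norm \<dots> \<le> integral {0..t} (\<lambda>s. L * (c * exp (2 * L * s)))"
      proof (rule integral_norm_bound_integral)
        show "(\<lambda>s. f s (X (Suc n) s) - f s (X n s)) integrable_on {0..t}"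
          by (intro integrable_diff int)
        show "(\<lambda>s. L * (c * exp (2 * L * s))) integrable_on {0..t}"
          using ftc by blast
        fix s assume "s \<in> {0..t}"
        then have s: "s \<in> {0..T}" using Suc.prems by auto
        show "norm (f s (X (Suc n) s) - f s (X n s)) \<le> L * (c * exp (2 * L * s))"
          using L[OF s, of "X (Suc n) s" "X n s"] mult_left_mono[OF Suc.IH[OF s] \<open>L \<ge> 0\<close>]
          by (simp add: c_def)
      qed
      also have "\<dots> = c / 2 * exp (2 * L * t) - c / 2"
        using integral_unique[OF ftc] by simp
      also have "\<dots> \<le> M * (1/2)^Suc n * exp (2 * L * t)"
        using \<open>c \<ge> 0\<close> by (simp add: c_def)
      finally show ?case .
    qed
    have "uniform_limit {0..T} (\<lambda>n t. \<Sum>i<n. X (Suc i) t - X i t) (\<lambda>t. \<Sum>i. X (Suc i) t - X i t) sequentially"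
    proof (rule Weierstrass_m_test)
      show "norm (X (Suc n) t - X n t) \<le> M * exp (2 * L * T) * (1/2)^n" if "t \<in> {0..T}" for n t
      proof -
        have "M * (1/2)^n * exp (2 * L * t) \<le> M * (1/2)^n * exp (2 * L * T)"
          using that \<open>M \<ge> 0\<close> \<open>L \<ge> 0\<close> by (intro mult_left_mono) (auto intro: mult_left_mono)
        with step[OF that, of n] show ?thesis by (simp add: mult_ac)
      qed
      show "summable (\<lambda>n. M * exp (2 * L * T) * (1/2)^n)"
        by (intro summable_mult summable_geometric) simp
    qed
    then have "uniform_limit {0..T} (\<lambda>n t. x0 + (\<Sum>i<n. X (Suc i) t - X i t)) x sequentially"
      unfolding x_def by (intro uniform_limit_add uniform_limit_const)
    moreover have "x0 + (\<Sum>i<n. X (Suc i) t - X i t) = X n t" for n t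
      using sum_lessThan_telescope[of "\<lambda>i. X i t" n] by (simp add: X0)
    ultimately show ?thesis by simp
  qed
  have contx: "continuous_on {0..T} x" for T
  proof (cases "T \<ge> 0")
    case True
    show ?thesis
      by (rule uniform_limit_theorem[OF _ unif[OF True]]) (auto simp: contX)
  qed auto
  have lim: "(\<lambda>n. X n t) \<longlonglongrightarrow> x t" if "t \<ge> 0" for t
    using tendsto_uniform_limitI[OF unif[OF that], of t] that by auto
  have eq: "x t = x0 + integral {0..t} (\<lambda>s. f s (x s))" if t: "t \<ge> 0" for t
  proof -
    obtain L where L: "\<And>s x y. s \<in> {0..t} \<Longrightarrow> norm (f s x - f s y) \<le> L * norm (x - y)"
      using lip[OF t] by blast
    have "uniform_limit {0..t} (\<lambda>n s. f s (X n s)) (\<lambda>s. f s (x s)) sequentially"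
    proof (rule uniform_limitI)
      fix e :: real assume "e > 0"
      define d where "d = e / (\<bar>L\<bar> + 1)"
      have "d > 0" using \<open>e > 0\<close> by (simp add: d_def add_pos_nonneg add.commute)
      from uniform_limitD[OF unif[OF that] this]
      show "\<forall>\<^sub>F n in sequentially. \<forall>s\<in>{0..t}. dist (f s (X n s)) (f s (x s)) < e"
      proof eventually_elim
        case (elim n)
        show ?case
        proof
          fix s assume s: "s \<in> {0..t}"
          have "dist (f s (X n s)) (f s (x s)) \<le> L * norm (X n s - x s)"
            using L[OF s] by (simp add: dist_norm)
          also have "\<dots> \<le> (\<bar>L\<bar> + 1) * norm (X n s - x s)"
            by (intro mult_right_mono) auto
          also have "\<dots> < (\<bar>L\<bar> + 1) * d"
            using elim s by (intro mult_strict_left_mono) (auto simp: dist_norm)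
          also have "\<dots> = e" by (simp add: d_def)
          finally show "dist (f s (X n s)) (f s (x s)) < e" .
        qed
      qed
    qed
    then obtain I J where I: "\<And>n. ((\<lambda>s. f s (X n s)) has_integral I n) {0..t}"
      and J: "((\<lambda>s. f s (x s)) has_integral J) {0..t}" and IJ: "I \<longlonglongrightarrow> J"
      by (rule uniform_limit_integral) (auto intro: contf contX)
    have "(\<lambda>n. X (Suc n) t) \<longlonglongrightarrow> x0 + J"
      unfolding XSuc integral_unique[OF I] by (intro tendsto_intros IJ)
    moreover have "(\<lambda>n. X (Suc n) t) \<longlonglongrightarrow> x t"
      using lim[OF that] by (rule LIMSEQ_Suc)
    ultimately show ?thesis
      using LIMSEQ_unique integral_unique[OF J] by blast
  qed
  show ?thesis
  proof (rule that[of x])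
    show "x 0 = x0" using eq[of 0] by simp
    show "x t \<in> S" if "t \<ge> 0" for t
      using closed_sequentially[OF S(1) _ lim[OF that]] XS[OF that] by blast
    show "(x has_vector_derivative f t (x t)) (at t within {0..})" if "t \<ge> 0" for t
    proof -
      have "((\<lambda>t. integral {0..t} (\<lambda>s. f s (x s))) has_vector_derivative f t (x t)) (at t within {0..t+1})"
        using that by (intro integral_has_vector_derivative contf contx) auto
      \<comment> \<open>The derivative of the integral is taken on a compact interval; extending it
        past \<open>t\<close> leaves the neighbourhoods of \<open>t\<close> in \<open>{0..}\<close>
        unchanged, also at \<open>t = 0\<close>.\<close>
      moreover have "at t within {0..t+1} = at t within {0..}"
        by (rule at_within_nhd[of _ "{..<t+1}"]) auto
      ultimately have "((\<lambda>t. x0 + integral {0..t} (\<lambda>s. f s (x s))) has_vector_derivative f t (x t)) (at t within {0..})"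
        by (auto intro!: derivative_eq_intros)
      then show ?thesis
        using that eq by (subst has_vector_derivative_cong_ev[where g = "\<lambda>t. x0 + integral {0..t} (\<lambda>s. f s (x s))"]) auto
    qed
  qed
qed

text \<open>Multiplying by \<open>exp (- K * t)\<close> makes the function nonincreasing. At the
  endpoint 0 there is only a one-sided derivative, so the monotonicity criterion is the one that
  asks for derivatives inside the interval and continuity on the closed one.\<close>

lemma Gronwall:
  fixes \<phi> \<phi>' :: "real \<Rightarrow> real"
  assumes "T \<ge> 0"
    and deriv: "\<And>t. t \<ge> 0 \<Longrightarrow> (\<phi> has_real_derivative \<phi>' t) (at t within {0..})"
    and le: "\<And>t. 0 \<le> t \<Longrightarrow> t \<le> T \<Longrightarrow> \<phi>' t \<le> K * \<phi> t"
  shows "\<phi> T \<le> \<phi> 0 * exp (K * T)"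
proof -
  define \<psi> where "\<psi> t = \<phi> t * exp (- K * t)" for t
  have D: "(\<psi> has_real_derivative (\<phi>' t - K * \<phi> t) * exp (- K * t)) (at t within {0..})" if "t \<ge> 0" for t
    unfolding \<psi>_def
    by (rule derivative_eq_intros deriv[OF that] refl)+ (simp add: algebra_simps)
  have "\<psi> T \<le> \<psi> 0"
  proof (rule DERIV_nonpos_imp_decreasing_open[OF \<open>T \<ge> 0\<close>])
    fix t assume t: "0 < t" "t < T"
    have "at t within {0..} = at t"
      using t by (intro at_within_interior) (simp add: interior_real_atLeast)
    moreover have "(\<phi>' t - K * \<phi> t) * exp (- K * t) \<le> 0"
      using le[of t] t by (intro mult_nonpos_nonneg) auto
    ultimately show "\<exists>y. (\<psi> has_real_derivative y) (at t) \<and> y \<le> 0"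
      using D[of t] t by auto
  next
    have "continuous_on {0..} \<psi>"
      using D by (intro DERIV_continuous_on) auto
    then show "continuous_on {0..T} \<psi>"
      by (rule continuous_on_subset) auto
  qed
  then show ?thesis by (simp add: \<psi>_def exp_minus field_simps)
qed

text \<open>Gram-Schmidt in place of a spectral decomposition: removing one direction from the
  family splits off a value of the quadratic form of \<open>q\<close>, and afterwards one index
  fewer may carry a nonzero vector. A vector that is already zero has \<open>sgn\<close> zero, so
  then nothing is removed.\<close>

lemma psd_Gram_trace_nonneg:
  fixes q :: "'n::finite \<Rightarrow> 'n \<Rightarrow> real" and u :: "'n \<Rightarrow> 'a::real_inner"
  assumes "psd q"
  shows "0 \<le> (\<Sum>i\<in>UNIV. \<Sum>j\<in>UNIV. q i j * (u i \<bullet> u j))"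
proof -
  have "0 \<le> (\<Sum>i\<in>UNIV. \<Sum>j\<in>UNIV. q i j * (u i \<bullet> u j))"
    if "finite I" "\<And>i. i \<notin> I \<Longrightarrow> u i = 0" for I and u :: "'n \<Rightarrow> 'a"
    using that
  proof (induction I arbitrary: u rule: finite_induct)
    case empty
    then show ?case by simp
  next
    case (insert k I)
    \<comment> \<open>Split off the component of every \<open>u i\<close> along \<open>u k\<close>.\<close>
    define w where "w = sgn (u k)"
    define c where "c i = u i \<bullet> w" for i
    define v where "v i = u i - c i *\<^sub>R w" for i
    have ww: "u k = norm (u k) *\<^sub>R w" "u k \<noteq> 0 \<Longrightarrow> w \<bullet> w = 1"
      by (simp_all add: w_def sgn_div_norm power2_norm_eq_inner[symmetric] power2_eq_square field_simps)
    have "c k *\<^sub>R w = u k"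
    proof (cases "u k = 0")
      case False
      have "c k = norm (u k)"
        unfolding c_def using ww(2)[OF False] by (subst ww(1)) simp
      then show ?thesis using ww(1) by simp
    qed (simp add: c_def w_def)
    then have vk: "v k = 0" by (simp add: v_def)
    have "v i = 0" if "i \<notin> I" for i
      using vk insert.prems[of i] that by (cases "i = k") (auto simp: v_def c_def)
    then have "0 \<le> (\<Sum>i\<in>UNIV. \<Sum>j\<in>UNIV. q i j * (v i \<bullet> v j))"
      by (rule insert.IH)
    moreover have "0 \<le> (\<Sum>i\<in>UNIV. \<Sum>j\<in>UNIV. c i * q i j * c j)"
      using \<open>psd q\<close> by (simp add: psd_def)
    moreover have "u i \<bullet> u j = v i \<bullet> v j + c i * c j" for i j
    proof (cases "u k = 0")
      case True
      then show ?thesis by (simp add: v_def c_def w_def)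
    next
      case False
      then show ?thesis
        using ww(2) by (simp add: v_def c_def inner_simps inner_commute algebra_simps)
    qed
    ultimately show ?case
      by (simp add: distrib_left sum.distrib mult_ac)
  qed
  from this[of UNIV u] show ?thesis by simp
qed

section \<open>The flow in an abstract Hilbert space\<close>

text \<open>For \<open>q x y = (G x, y)\<close> this is the term
  \<open>U \<langle>G U, U\<rangle>\<close>. Stating it for an arbitrary \<open>q\<close> reduces
  homogeneity and Lipschitz bounds to bilinearity, and positivity to that of
  \<open>q x x\<close>.\<close>

definition oja_cubic :: "('a::real_vector \<Rightarrow> 'a \<Rightarrow> real) \<Rightarrow> 'a ^ 'n \<Rightarrow> 'a ^ 'n" where
  "oja_cubic q U = (\<chi> i. \<Sum>j\<in>UNIV. q (U $ j) (U $ i) *\<^sub>R U $ j)"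

definition oja_field :: "('a::real_vector \<Rightarrow> 'a) \<Rightarrow> ('a \<Rightarrow> 'a \<Rightarrow> real) \<Rightarrow> 'a ^ 'n \<Rightarrow> 'a ^ 'n" where
  "oja_field G q U = (\<chi> i. G (U $ i)) - oja_cubic q U"

lemma norm_vec_le_mult:
  fixes f :: "'a::real_normed_vector \<Rightarrow> 'b::real_normed_vector"
  assumes "\<And>x. norm (f x) \<le> norm x * C" "C \<ge> 0"
  shows "norm (\<chi> i. f (U $ i)) \<le> C * norm (U :: 'a ^ 'n)"
proof -
  have "norm (\<chi> i. f (U $ i)) \<le> L2_set (\<lambda>i. C * norm (U $ i)) UNIV"
    unfolding norm_vec_def using assms by (intro L2_set_mono) (auto simp: mult.commute)
  also have "\<dots> = C * norm U"
    unfolding norm_vec_def using \<open>C \<ge> 0\<close> by (rule L2_set_right_distrib[symmetric])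
  finally show ?thesis .
qed

text \<open>Each summand is trilinear, so its increment telescopes into three terms with one
  differenced factor each; this gives \<open>3 * B\<close>. One factor \<open>CARD('n)\<close>
  counts the summands of an entry, the other comes from bounding the norm of a tuple by the sum of
  the norms of its entries.\<close>

lemma oja_cubic_Lipschitz:
  fixes q :: "'a::real_normed_vector \<Rightarrow> 'a \<Rightarrow> real"
  assumes q: "bounded_bilinear q"
  obtains K where "K \<ge> 0" "\<And>R (U :: 'a ^ 'n) W. norm U \<le> R \<Longrightarrow> norm W \<le> R \<Longrightarrow>
    norm (oja_cubic q U - oja_cubic q W) \<le> K * R\<^sup>2 * norm (U - W)"
proof -
  interpret bounded_bilinear q by (rule q)
  obtain B where B: "B \<ge> 0" "\<And>x y. norm (q x y) \<le> norm x * norm y * B"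
    using nonneg_bounded by blast
  let ?K = "real CARD('n) * real CARD('n) * (3 * B)"
  show ?thesis
  proof (rule that[of ?K])
    show "?K \<ge> 0" using B by simp
    fix R and U W :: "'a ^ 'n"
    assume U: "norm U \<le> R" and W: "norm W \<le> R"
    define d where "d = norm (U - W)"
    have "R \<ge> 0" using U norm_ge_zero order_trans by blast
    have "d \<ge> 0" by (simp add: d_def)
    have Ui: "norm (U $ i) \<le> R" and Wi: "norm (W $ i) \<le> R"
      and di: "norm (U $ i - W $ i) \<le> d" for i
      using Finite_Cartesian_Product.norm_nth_le[of U i] Finite_Cartesian_Product.norm_nth_le[of W i]
        Finite_Cartesian_Product.norm_nth_le[of "U - W" i] U W
      by (auto simp: d_def)
    have qb: "\<bar>q x y\<bar> \<le> a * b * B" if "norm x \<le> a" "norm y \<le> b" for x y a b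
    proof -
      have "norm x * norm y \<le> a * b"
        using that by (intro mult_mono) (auto intro: order_trans[OF norm_ge_zero])
      then have "norm x * norm y * B \<le> a * b * B"
        using B(1) by (rule mult_right_mono)
      then show ?thesis using B(2)[of x y] by simp
    qed
    have summand: "norm (q (U $ j) (U $ i) *\<^sub>R U $ j - q (W $ j) (W $ i) *\<^sub>R W $ j) \<le> 3 * B * R\<^sup>2 * d" for i j
    proof -
      have "q (U $ j) (U $ i) *\<^sub>R U $ j - q (W $ j) (W $ i) *\<^sub>R W $ j
          = q (U $ j - W $ j) (U $ i) *\<^sub>R U $ j + q (W $ j) (U $ i - W $ i) *\<^sub>R U $ j
            + q (W $ j) (W $ i) *\<^sub>R (U $ j - W $ j)"
        by (simp add: diff_left diff_right algebra_simps)
      also have "norm \<dots> \<le> norm (q (U $ j - W $ j) (U $ i) *\<^sub>R U $ j)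
          + norm (q (W $ j) (U $ i - W $ i) *\<^sub>R U $ j) + norm (q (W $ j) (W $ i) *\<^sub>R (U $ j - W $ j))"
        by (intro norm_triangle_le add_mono) auto
      also have "\<dots> \<le> d * R * B * R + R * d * B * R + R * R * B * d"
        unfolding norm_scaleR using \<open>R \<ge> 0\<close> \<open>d \<ge> 0\<close> B(1)
        by (intro add_mono mult_mono qb Ui Wi di) auto
      also have "\<dots> = 3 * B * R\<^sup>2 * d" by (simp add: power2_eq_square algebra_simps)
      finally show ?thesis .
    qed
    have "norm (oja_cubic q U - oja_cubic q W) \<le> (\<Sum>i\<in>UNIV. norm ((oja_cubic q U - oja_cubic q W) $ i))"
      unfolding norm_vec_def by (rule L2_set_le_sum) simp
    also have "\<dots> \<le> (\<Sum>i::'n\<in>UNIV. \<Sum>j::'n\<in>UNIV. 3 * B * R\<^sup>2 * d)"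
      unfolding oja_cubic_def vector_minus_component vec_lambda_beta sum_subtractf[symmetric]
      by (intro sum_mono order_trans[OF norm_sum] summand)
    also have "\<dots> = ?K * R\<^sup>2 * norm (U - W)" by (simp add: d_def)
    finally show "norm (oja_cubic q U - oja_cubic q W) \<le> ?K * R\<^sup>2 * norm (U - W)" .
  qed
qed

lemma continuous_on_oja_cubic:
  assumes "bounded_bilinear q" "continuous_on A f"
  shows "continuous_on A (\<lambda>x. oja_cubic q (f x))"
  unfolding oja_cubic_def using assms(2)
  by (intro continuous_on_vec_lambda continuous_on_sum continuous_on_scaleR
      bounded_bilinear.continuous_on[OF assms(1)] continuous_on_component)

lemma continuous_on_oja_linear:
  assumes "bounded_linear G" "continuous_on A f"
  shows "continuous_on A (\<lambda>x. \<chi> i. G (f x $ i))"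
  by (intro continuous_on_vec_lambda bounded_linear.continuous_on[OF assms(1)]
      continuous_on_component assms(2))

lemma continuous_on_oja_field:
  assumes "bounded_linear G" "bounded_bilinear q" "continuous_on A f"
  shows "continuous_on A (\<lambda>x. oja_field G q (f x))"
  unfolding oja_field_def
  by (intro continuous_intros continuous_on_oja_linear continuous_on_oja_cubic assms)

lemma oja_cubic_scaleR:
  assumes "bounded_bilinear q"
  shows "oja_cubic q (s *\<^sub>R U) = s ^ 3 *\<^sub>R oja_cubic q U"
proof -
  interpret bounded_bilinear q by fact
  show ?thesis
    by (simp add: oja_cubic_def vec_eq_iff scaleR_left scaleR_right scaleR_sum_right power3_eq_cube mult_ac)
qed

text \<open>The pairing expands to the sum over \<open>i\<close>, \<open>j\<close> of
  \<open>q (U $ j) (U $ i)\<close> times the Gram entry of the tuple, a trace of the kind treated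
  above.\<close>

lemma inner_oja_cubic_nonneg:
  fixes q :: "'a::real_inner \<Rightarrow> 'a \<Rightarrow> real" and U :: "'a ^ 'n"
  assumes "bounded_bilinear q" and pos: "\<And>x. 0 \<le> q x x"
  shows "0 \<le> U \<bullet> oja_cubic q U"
proof -
  interpret bounded_bilinear q by fact
  have "psd (\<lambda>i j. q (U $ j) (U $ i))"
    unfolding psd_def
  proof
    fix \<xi> :: "'n \<Rightarrow> real"
    \<comment> \<open>The quadratic form of the matrix at \<open>\<xi>\<close> is \<open>q\<close>
      on the diagonal, at the combination of the \<open>U $ i\<close> with coefficients
      \<open>\<xi>\<close>.\<close>
    have "q (\<Sum>j\<in>UNIV. \<xi> j *\<^sub>R U $ j) (\<Sum>i\<in>UNIV. \<xi> i *\<^sub>R U $ i)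
        = (\<Sum>i\<in>UNIV. \<Sum>j\<in>UNIV. \<xi> i * q (U $ j) (U $ i) * \<xi> j)"
      by (simp add: sum_left sum_right scaleR_left scaleR_right sum_distrib_left mult_ac)
    then show "0 \<le> (\<Sum>i\<in>UNIV. \<Sum>j\<in>UNIV. \<xi> i * q (U $ j) (U $ i) * \<xi> j)"
      using pos by metis
  qed
  from psd_Gram_trace_nonneg[OF this, of "\<lambda>i. U $ i"] show ?thesis
    by (simp add: inner_vec_def oja_cubic_def inner_sum_right)
qed

text \<open>The constant 2 collects two contributions of at most \<open>norm (x - y)\<close>: the
  vector changes under a fixed factor, and the factor changes on a fixed vector.\<close>

lemma radial_retraction:
  fixes x y :: "'a::real_normed_vector"
  assumes "r > 0"
  defines "\<rho> \<equiv> \<lambda>x. (r / max r (norm x)) *\<^sub>R x"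
  shows "norm (\<rho> x) \<le> r" "norm (\<rho> x - \<rho> y) \<le> 2 * norm (x - y)"
proof -
  define m where "m x = max r (norm x)" for x :: 'a
  have m: "m x > 0" "r \<le> m x" "norm x \<le> m x" for x
    using \<open>r > 0\<close> by (auto simp: m_def)
  show "norm (\<rho> x) \<le> r"
    using m[of x] \<open>r > 0\<close> by (simp add: \<rho>_def m_def[symmetric] field_simps)
  have md: "\<bar>m y - m x\<bar> \<le> norm (x - y)"
    using norm_triangle_ineq3[of x y] by (auto simp: m_def)
  have 1: "(r / m x) * norm (x - y) \<le> 1 * norm (x - y)"
    using m[of x] \<open>r > 0\<close> by (intro mult_right_mono) auto
  have "\<bar>r / m x - r / m y\<bar> * norm y = (r / m x) * (\<bar>m y - m x\<bar> * (norm y / m y))"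
  proof -
    have "r / m x - r / m y = (r / m x) * ((m y - m x) / m y)"
      using m[of x] m[of y] by (simp add: field_simps)
    then show ?thesis
      using m(1)[of x] m(1)[of y] \<open>r > 0\<close> by (simp add: abs_mult)
  qed
  also have "\<dots> \<le> 1 * (norm (x - y) * 1)"
    using m[of x] m[of y] \<open>r > 0\<close> md by (intro mult_mono) auto
  finally have 2: "\<bar>r / m x - r / m y\<bar> * norm y \<le> norm (x - y)" by simp
  have "\<rho> x - \<rho> y = (r / m x) *\<^sub>R (x - y) + (r / m x - r / m y) *\<^sub>R y"
    by (simp add: \<rho>_def m_def algebra_simps)
  also have "norm \<dots> \<le> \<bar>r / m x\<bar> * norm (x - y) + \<bar>r / m x - r / m y\<bar> * norm y"
    by (rule norm_triangle_le) simp
  finally show "norm (\<rho> x - \<rho> y) \<le> 2 * norm (x - y)"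
    using 1 2 m[of x] \<open>r > 0\<close> by simp
qed

section \<open>Global existence and uniqueness of the flow\<close>

lemma has_real_derivative_norm_square:
  fixes x :: "real \<Rightarrow> 'a::real_inner"
  assumes "(x has_vector_derivative x') (at t within A)"
  shows "((\<lambda>t. (norm (x t))\<^sup>2) has_real_derivative 2 * (x t \<bullet> x')) (at t within A)"
proof -
  have "((\<lambda>t. x t \<bullet> x t) has_derivative (\<lambda>h. x t \<bullet> (h *\<^sub>R x') + (h *\<^sub>R x') \<bullet> x t)) (at t within A)"
    using assms unfolding has_vector_derivative_def by (intro has_derivative_inner)
  then show ?thesis
    unfolding has_field_derivative_def power2_norm_eq_inner
    by (rule has_derivative_eq_rhs) (auto simp: inner_commute)
qed

text \<open>The truncated field is Lipschitz uniformly on bounded time intervals, so it has a global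
  solution. Truncation only rescales the dissipative cubic term by a nonnegative factor, so the
  linear term alone limits the growth, and the resulting bound lies below the truncation
  radius.\<close>

lemma oja_flow_exists:
  fixes G :: "'a::{real_inner,banach} \<Rightarrow> 'a" and U0 :: "'a ^ 'n"
  assumes G: "bounded_linear G" and q: "bounded_bilinear q" and pos: "\<And>x. 0 \<le> q x x"
    and S: "closed S" "subspace S" "\<And>x. x \<in> S \<Longrightarrow> G x \<in> S" "\<And>i. U0 $ i \<in> S"
  shows "\<exists>U. U 0 = U0 \<and> (\<forall>t\<ge>0. (\<forall>i. U t $ i \<in> S) \<and>
    (U has_vector_derivative oja_field G q (U t)) (at t within {0..}))"
proof -
  obtain C where C: "C \<ge> 0" "\<And>x. norm (G x) \<le> norm x * C"
    using bounded_linear.nonneg_bounded[OF G] by blast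
  obtain K where K: "K \<ge> 0" "\<And>R (U :: 'a ^ 'n) W. norm U \<le> R \<Longrightarrow> norm W \<le> R \<Longrightarrow>
      norm (oja_cubic q U - oja_cubic q W) \<le> K * R\<^sup>2 * norm (U - W)"
    using oja_cubic_Lipschitz[OF q] by blast
  \<comment> \<open>\<open>norm U0 * exp (C * t)\<close> is the bound that Gronwall's inequality
    will give; adding 1 keeps the radius positive when \<open>U0 = 0\<close>.\<close>
  define R where "R t = (norm U0 + 1) * exp (C * t)" for t
  have Rpos: "R t > 0" for t by (simp add: R_def add_nonneg_pos)
  \<comment> \<open>The cubic term is cut off outside the ball of radius \<open>R t\<close>, which the solution never leaves.\<close>
  define f where "f t U = (\<chi> i. G (U $ i)) - oja_cubic q ((R t / max (R t) (norm U)) *\<^sub>R U)"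
    for t and U :: "'a ^ 'n"
  define S' where "S' = {U :: 'a ^ 'n. \<forall>i. U $ i \<in> S}"
  have "closed S'"
  proof -
    have "S' = (\<Inter>i. (\<lambda>U. U $ i) -` S)" by (auto simp: S'_def)
    then show ?thesis
      using \<open>closed S\<close> by (auto intro!: closed_INT closed_vimage continuous_intros)
  qed
  have "subspace S'"
    using \<open>subspace S\<close> by (auto simp: S'_def subspace_def)
  have fS: "f t U \<in> S'" if "U \<in> S'" for t U
    using that S(2,3)
    by (auto simp: S'_def f_def oja_cubic_def intro!: subspace_diff subspace_sum subspace_scale)
  have contf: "continuous_on ({0..} \<times> UNIV) (\<lambda>(t, U). f t U)"
  proof -
    have R: "continuous_on A (\<lambda>p. R (fst p))" for A :: "(real \<times> ('a ^ 'n)) set"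
      unfolding R_def by (intro continuous_intros)
    have "max (R (fst p)) (norm (snd p)) \<noteq> 0" for p :: "real \<times> ('a ^ 'n)"
      using Rpos[of "fst p"] by linarith
    then show ?thesis
      unfolding f_def case_prod_beta
      by (intro continuous_on_diff continuous_on_oja_linear[OF G] continuous_on_oja_cubic[OF q]
          continuous_on_scaleR continuous_on_divide continuous_on_max R continuous_on_norm
          continuous_on_snd continuous_on_id) auto
  qed
  have lip: "\<exists>L. \<forall>t\<in>{0..T}. \<forall>U W. norm (f t U - f t W) \<le> L * norm (U - W)" for T
  proof (intro exI ballI allI)
    fix t and U W :: "'a ^ 'n" assume t: "t \<in> {0..T}"
    define \<rho> where "\<rho> U = (R t / max (R t) (norm U)) *\<^sub>R U" for U :: "'a ^ 'n"
    have \<rho>: "norm (\<rho> x) \<le> R t" "norm (\<rho> x - \<rho> y) \<le> 2 * norm (x - y)" for x y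
      unfolding \<rho>_def by (rule radial_retraction[OF Rpos])+
    have "R t \<le> R T"
      using t \<open>C \<ge> 0\<close> by (auto simp: R_def intro!: mult_left_mono)
    have "f t U - f t W = (\<chi> i. G ((U - W) $ i)) - (oja_cubic q (\<rho> U) - oja_cubic q (\<rho> W))"
      by (simp add: f_def \<rho>_def vec_eq_iff linear_diff[OF bounded_linear.linear[OF G]])
    also have "norm \<dots> \<le> norm (\<chi> i. G ((U - W) $ i)) + norm (oja_cubic q (\<rho> U) - oja_cubic q (\<rho> W))"
      by (rule norm_triangle_ineq4)
    also have "\<dots> \<le> C * norm (U - W) + K * (R T)\<^sup>2 * (2 * norm (U - W))"
    proof (rule add_mono)
      have "norm (oja_cubic q (\<rho> U) - oja_cubic q (\<rho> W)) \<le> K * (R T)\<^sup>2 * norm (\<rho> U - \<rho> W)"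
        using \<rho>(1) \<open>R t \<le> R T\<close> by (intro K) (auto intro: order_trans)
      also have "\<dots> \<le> K * (R T)\<^sup>2 * (2 * norm (U - W))"
        using \<rho>(2) K(1) by (intro mult_left_mono) auto
      finally show "norm (oja_cubic q (\<rho> U) - oja_cubic q (\<rho> W)) \<le> \<dots>" .
    qed (rule norm_vec_le_mult[OF C(2,1)])
    finally show "norm (f t U - f t W) \<le> (C + 2 * K * (R T)\<^sup>2) * norm (U - W)"
      by (simp add: algebra_simps)
  qed
  obtain U where U: "U 0 = U0" "\<And>t. t \<ge> 0 \<Longrightarrow> U t \<in> S'"
    "\<And>t. t \<ge> 0 \<Longrightarrow> (U has_vector_derivative f t (U t)) (at t within {0..})"
    using global_Picard[OF \<open>closed S'\<close> \<open>subspace S'\<close> _ contf lip fS, of U0] S(4)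
    by (auto simp: S'_def)
  have bound: "norm (U T) \<le> R T" if "T \<ge> 0" for T
  proof -
    have "(norm (U T))\<^sup>2 \<le> (norm (U 0))\<^sup>2 * exp (2 * C * T)"
    proof (rule Gronwall[OF \<open>T \<ge> 0\<close> has_real_derivative_norm_square[OF U(3)]])
      fix t :: real assume "0 \<le> t" "t \<le> T"
      define s where "s = R t / max (R t) (norm (U t))"
      have "s \<ge> 0" using Rpos[of t] by (simp add: s_def)
      \<comment> \<open>Retracting multiplies the argument by \<open>s\<close>, hence the cubic term
        by \<open>s ^ 3\<close>, so its sign in the energy balance survives.\<close>
      have "0 \<le> s ^ 3 * (U t \<bullet> oja_cubic q (U t))"
        by (intro mult_nonneg_nonneg zero_le_power \<open>s \<ge> 0\<close> inner_oja_cubic_nonneg[OF q pos])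
      moreover have "U t \<bullet> (\<chi> i. G (U t $ i)) \<le> norm (U t) * (C * norm (U t))"
        by (intro order_trans[OF norm_cauchy_schwarz] mult_left_mono norm_vec_le_mult C) auto
      ultimately show "2 * (U t \<bullet> f t (U t)) \<le> 2 * C * (norm (U t))\<^sup>2"
        unfolding f_def s_def[symmetric] oja_cubic_scaleR[OF q]
        by (simp add: inner_diff_right power2_eq_square mult_ac)
    qed
    also have "\<dots> = (norm U0 * exp (C * T))\<^sup>2"
      using exp_double[of "C * T"] by (simp add: U(1) power_mult_distrib mult.assoc)
    finally have "norm (U T) \<le> norm U0 * exp (C * T)"
      by (rule power2_le_imp_le) simp
    also have "\<dots> \<le> R T" by (simp add: R_def)
    finally show ?thesis .
  qed
  \<comment> \<open>Inside the ball the truncation factor is \<open>R t / R t = 1\<close>.\<close>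
  have "f t (U t) = oja_field G q (U t)" if "t \<ge> 0" for t
    using bound[OF that] Rpos[of t] by (simp add: f_def oja_field_def max_def)
  with U show ?thesis
    by (intro exI[of _ U]) (auto simp: S'_def)
qed

text \<open>Two given solutions are continuous, hence bounded on the compact interval
  \<open>{0..T}\<close>. There the field is Lipschitz along both, and Gronwall's inequality for
  their squared distance starts from 0.\<close>

lemma oja_flow_unique:
  fixes G :: "'a::real_inner \<Rightarrow> 'a" and U W :: "real \<Rightarrow> 'a ^ 'n"
  assumes G: "bounded_linear G" and q: "bounded_bilinear q" and "U 0 = W 0"
    and U: "\<And>t. t \<ge> 0 \<Longrightarrow> (U has_vector_derivative oja_field G q (U t)) (at t within {0..})"
    and W: "\<And>t. t \<ge> 0 \<Longrightarrow> (W has_vector_derivative oja_field G q (W t)) (at t within {0..})"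
    and "T \<ge> 0"
  shows "U T = W T"
proof -
  obtain C where C: "C \<ge> 0" "\<And>x. norm (G x) \<le> norm x * C"
    using bounded_linear.nonneg_bounded[OF G] by blast
  obtain K where K: "K \<ge> 0" "\<And>R (U :: 'a ^ 'n) W. norm U \<le> R \<Longrightarrow> norm W \<le> R \<Longrightarrow>
      norm (oja_cubic q U - oja_cubic q W) \<le> K * R\<^sup>2 * norm (U - W)"
    using oja_cubic_Lipschitz[OF q] by blast
  have bdd: "\<exists>R. \<forall>t\<in>{0..T}. norm (X t) \<le> R"
    if X: "\<And>t. t \<ge> 0 \<Longrightarrow> (X has_vector_derivative oja_field G q (X t)) (at t within {0..})"
    for X :: "real \<Rightarrow> 'a ^ 'n"
  proof -
    have "continuous_on {0..} X"
      using X by (intro continuous_on_vector_derivative) auto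
    then have "continuous_on {0..T} X"
      by (rule continuous_on_subset) auto
    then have "bounded (X ` {0..T})"
      by (intro compact_imp_bounded compact_continuous_image) auto
    then show ?thesis unfolding bounded_iff by auto
  qed
  obtain R1 R2 where R12: "\<forall>t\<in>{0..T}. norm (U t) \<le> R1" "\<forall>t\<in>{0..T}. norm (W t) \<le> R2"
    using bdd[OF U] bdd[OF W] by blast
  define R where "R = max R1 R2"
  define L where "L = C + K * R\<^sup>2"
  have "(norm (U T - W T))\<^sup>2 \<le> (norm (U 0 - W 0))\<^sup>2 * exp (2 * L * T)"
  proof (rule Gronwall[OF \<open>T \<ge> 0\<close> has_real_derivative_norm_square[OF has_vector_derivative_diff[OF U W]]])
    fix t assume t: "0 \<le> t" "t \<le> T"
    have "norm (oja_cubic q (U t) - oja_cubic q (W t)) \<le> K * R\<^sup>2 * norm (U t - W t)"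
      using R12 t by (intro K) (auto simp: R_def le_max_iff_disj)
    moreover have "oja_field G q (U t) - oja_field G q (W t)
        = (\<chi> i. G ((U t - W t) $ i)) - (oja_cubic q (U t) - oja_cubic q (W t))"
      by (simp add: oja_field_def vec_eq_iff linear_diff[OF bounded_linear.linear[OF G]])
    ultimately have "norm (oja_field G q (U t) - oja_field G q (W t)) \<le> L * norm (U t - W t)"
      using norm_triangle_ineq4[of "\<chi> i. G ((U t - W t) $ i)" "oja_cubic q (U t) - oja_cubic q (W t)"]
        norm_vec_le_mult[OF C(2,1), of "U t - W t"]
      by (simp add: L_def distrib_right)
    then have "(U t - W t) \<bullet> (oja_field G q (U t) - oja_field G q (W t))
        \<le> norm (U t - W t) * (L * norm (U t - W t))"
      by (intro order_trans[OF norm_cauchy_schwarz] mult_left_mono) auto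
    then show "2 * ((U t - W t) \<bullet> (oja_field G q (U t) - oja_field G q (W t)))
        \<le> 2 * L * (norm (U t - W t))\<^sup>2"
      by (simp add: power2_eq_square mult_ac)
  qed auto
  with \<open>U 0 = W 0\<close> show ?thesis by simp
qed

section \<open>Coercive forms\<close>

text \<open>The laws are demanded on \<open>S\<close> only, because the energy form is carried over
  through representatives that exist just for elements of \<open>S\<close>. Boundedness is asked on
  the diagonal, the form in which the assumption on the potential supplies it.\<close>

locale coercive_form =
  fixes S :: "'a::banach set" and \<alpha> :: "'a \<Rightarrow> 'a \<Rightarrow> real" and c C :: real
  assumes closed: "closed S" and subspace: "subspace S"
    and add: "\<And>x y z. x \<in> S \<Longrightarrow> y \<in> S \<Longrightarrow> z \<in> S \<Longrightarrow> \<alpha> (x + y) z = \<alpha> x z + \<alpha> y z"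
    and scale: "\<And>r x y. x \<in> S \<Longrightarrow> y \<in> S \<Longrightarrow> \<alpha> (r *\<^sub>R x) y = r * \<alpha> x y"
    and sym: "\<And>x y. x \<in> S \<Longrightarrow> y \<in> S \<Longrightarrow> \<alpha> x y = \<alpha> y x"
    and c_pos: "c > 0"
    and coercive: "\<And>x. x \<in> S \<Longrightarrow> c * (norm x)\<^sup>2 \<le> \<alpha> x x"
    and bounded: "\<And>x. x \<in> S \<Longrightarrow> \<alpha> x x \<le> C * (norm x)\<^sup>2"
begin

lemma nonneg: "x \<in> S \<Longrightarrow> 0 \<le> \<alpha> x x"
  using coercive[of x] c_pos by (meson mult_nonneg_nonneg order.trans less_imp_le zero_le_power2)

lemma add_right: "x \<in> S \<Longrightarrow> y \<in> S \<Longrightarrow> z \<in> S \<Longrightarrow> \<alpha> z (x + y) = \<alpha> z x + \<alpha> z y"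
  using add sym subspace_add[OF subspace] by metis

lemma scale_right: "x \<in> S \<Longrightarrow> y \<in> S \<Longrightarrow> \<alpha> y (r *\<^sub>R x) = r * \<alpha> y x"
  using scale sym subspace_scale[OF subspace] by metis

lemma diff: "x \<in> S \<Longrightarrow> y \<in> S \<Longrightarrow> z \<in> S \<Longrightarrow> \<alpha> (x - y) z = \<alpha> x z - \<alpha> y z"
  using add[of x "(-1) *\<^sub>R y" z] scale[of y z "-1"] subspace_scale[OF subspace, of y "-1"] by simp

lemma eq_zero: "x \<in> S \<Longrightarrow> \<alpha> x x = 0 \<Longrightarrow> x = 0"
  using coercive[of x] c_pos by (simp add: mult_le_0_iff)

lemma square_add_scale:
  assumes "x \<in> S" "y \<in> S"
  shows "\<alpha> (x + r *\<^sub>R y) (x + r *\<^sub>R y) = \<alpha> x x + 2 * r * \<alpha> x y + r\<^sup>2 * \<alpha> y y"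
  using assms subspace_add[OF subspace] subspace_scale[OF subspace]
  by (simp add: add add_right scale scale_right sym[of y x] power2_eq_square algebra_simps)

text \<open>Expanding \<open>\<alpha> (y + v) (y + v) \<ge> 0\<close> and
  \<open>\<alpha> (y - v) (y - v) \<ge> 0\<close> for the normalised \<open>y\<close> bounds
  \<open>\<alpha> y v\<close> by diagonal values. The constant depends on \<open>v\<close>, which is
  enough for continuity in the first argument with \<open>v\<close> fixed.\<close>

lemma abs_le:
  assumes x: "x \<in> S" and v: "v \<in> S"
  shows "\<bar>\<alpha> x v\<bar> \<le> (C + \<alpha> v v) / 2 * norm x"
proof (cases "x = 0")
  case True
  then show ?thesis using scale[OF x v, of 0] by simp
next
  case False
  define y where "y = inverse (norm x) *\<^sub>R x"
  have y: "y \<in> S" using x by (simp add: y_def subspace_scale[OF subspace])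
  have "norm y = 1" using False by (simp add: y_def)
  then have "\<alpha> y y \<le> C" using bounded[OF y] by simp
  moreover have "0 \<le> \<alpha> (y + 1 *\<^sub>R v) (y + 1 *\<^sub>R v)" "0 \<le> \<alpha> (y + (-1) *\<^sub>R v) (y + (-1) *\<^sub>R v)"
    using y v subspace_add[OF subspace] subspace_scale[OF subspace] by (blast intro: nonneg)+
  ultimately have "\<bar>\<alpha> y v\<bar> \<le> (C + \<alpha> v v) / 2"
    unfolding square_add_scale[OF y v] by simp
  moreover have "\<alpha> y v = inverse (norm x) * \<alpha> x v"
    unfolding y_def by (rule scale[OF x v])
  ultimately show ?thesis
    using False by (simp add: abs_mult field_simps)
qed

text \<open>The representing vector minimises \<open>\<alpha> w w - 2 l w\<close>; minimising sequences are Cauchy by the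
  parallelogram law.\<close>

lemma Riesz_representation:
  assumes l: "bounded_linear l"
  shows "\<exists>w\<in>S. \<forall>v\<in>S. \<alpha> w v = l v"
proof -
  interpret l: bounded_linear l by fact
  obtain K where K: "K \<ge> 0" "\<And>x. norm (l x) \<le> norm x * K"
    using l.nonneg_bounded by blast
  define J where "J w = \<alpha> w w - 2 * l w" for w
  have J_add: "J (w + r *\<^sub>R v) = J w + 2 * r * (\<alpha> w v - l v) + r\<^sup>2 * \<alpha> v v"
    if "w \<in> S" "v \<in> S" for w v r
    by (simp add: J_def square_add_scale[OF that] l.add l.scaleR algebra_simps)
  have lower: "J w \<ge> - (K\<^sup>2 / c)" if "w \<in> S" for w
  proof -
    \<comment> \<open>Completing the square in \<open>norm w\<close> produces the lower bound
      \<open>- (K^2 / c)\<close>.\<close>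
    have "0 \<le> (c * norm w - K)\<^sup>2" by simp
    also have "(c * norm w - K)\<^sup>2 = c * (c * (norm w)\<^sup>2 - 2 * (norm w * K) + K\<^sup>2 / c)"
      using c_pos
      by (simp add: power2_diff power2_eq_square right_diff_distrib distrib_left mult_ac)
    finally have "0 \<le> c * (c * (norm w)\<^sup>2 - 2 * (norm w * K) + K\<^sup>2 / c)" .
    then have "0 \<le> c * (norm w)\<^sup>2 - 2 * (norm w * K) + K\<^sup>2 / c"
      using c_pos by (simp add: zero_le_mult_iff)
    moreover have "l w \<le> norm w * K" using K(2)[of w] by simp
    ultimately show ?thesis using coercive[OF that] by (simp add: J_def)
  qed
  define m where "m = Inf (J ` S)"
  have "0 \<in> S" by (rule subspace_0[OF subspace])
  have m: "m \<le> J w" if "w \<in> S" for w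
    unfolding m_def using lower that by (intro cInf_lower) (auto intro!: bdd_belowI)
  have "\<exists>w\<in>S. J w < m + 1 / real (Suc k)" for k
    using cInf_lessD[of "J ` S" "m + 1 / real (Suc k)"] \<open>0 \<in> S\<close> by (auto simp: m_def)
  then obtain w where w: "\<And>k. w k \<in> S" "\<And>k. J (w k) < m + 1 / real (Suc k)"
    by metis
  \<comment> \<open>With \<open>d = w j - w i\<close>, the sum \<open>J (w i) + J (w j)\<close>
    exceeds twice the value at the midpoint by \<open>\<alpha> d d / 2\<close>, and the midpoint
    value is at least \<open>m\<close>.\<close>
  have close: "c * (norm (w i - w j))\<^sup>2 \<le> 2 * (1 / real (Suc i) + 1 / real (Suc j))" for i j
  proof -
    define d where "d = w j - w i"
    have d: "d \<in> S" by (simp add: d_def w subspace_diff[OF subspace])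
    have "J (w j) = J (w i) + 2 * (\<alpha> (w i) d - l d) + \<alpha> d d"
      using J_add[OF w(1) d, of i 1] by (simp add: d_def)
    moreover have "m \<le> J (w i) + (\<alpha> (w i) d - l d) + \<alpha> d d / 4"
      using J_add[OF w(1) d, of i "1/2"] m[of "w i + (1/2) *\<^sub>R d"] d w(1)
        subspace_add[OF subspace] subspace_scale[OF subspace]
      by (simp add: power2_eq_square)
    moreover have "c * (norm d)\<^sup>2 \<le> \<alpha> d d" by (rule coercive[OF d])
    ultimately show ?thesis
      using w(2)[of i] w(2)[of j] by (simp add: d_def norm_minus_commute)
  qed
  have "Cauchy w"
  proof (rule CauchyI')
    fix e :: real assume "e > 0"
    obtain M where M: "1 / real (Suc M) < c * e\<^sup>2 / 4"
      using nat_approx_posE[of "c * e\<^sup>2 / 4"] \<open>e > 0\<close> c_pos by auto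
    have "dist (w i) (w j) < e" if "i \<ge> M" "j > i" for i j
    proof -
      have "1 / real (Suc i) \<le> 1 / real (Suc M)" "1 / real (Suc j) \<le> 1 / real (Suc M)"
        using that by (auto intro!: divide_left_mono)
      then have "c * (norm (w i - w j))\<^sup>2 < c * e\<^sup>2"
        using close[of i j] M unfolding distrib_left by argo
      then have "(norm (w i - w j))\<^sup>2 < e\<^sup>2" using c_pos by simp
      then show ?thesis
        using \<open>e > 0\<close> by (simp add: dist_norm power_less_imp_less_base)
    qed
    then show "\<exists>M. \<forall>i\<ge>M. \<forall>j>i. dist (w i) (w j) < e" by blast
  qed
  then obtain z where z: "w \<longlonglongrightarrow> z"
    using Cauchy_convergent convergent_def by blast
  have "z \<in> S" by (rule closed_sequentially[OF closed w(1) z])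
  have "\<alpha> z v = l v" if v: "v \<in> S" for v
  proof -
    have "(\<lambda>k. \<alpha> (w k) v - \<alpha> z v) \<longlonglongrightarrow> 0"
    proof (rule Lim_null_comparison)
      show "\<forall>\<^sub>F k in sequentially. norm (\<alpha> (w k) v - \<alpha> z v) \<le> (C + \<alpha> v v) / 2 * norm (w k - z)"
        using abs_le[of "w _ - z" v] diff w(1) \<open>z \<in> S\<close> v subspace_diff[OF subspace] by simp
      show "(\<lambda>k. (C + \<alpha> v v) / 2 * norm (w k - z)) \<longlonglongrightarrow> 0"
        using z by (intro tendsto_mult_right_zero tendsto_norm_zero) (simp add: LIM_zero)
    qed
    then have lim: "(\<lambda>k. \<alpha> (w k) v) \<longlonglongrightarrow> \<alpha> z v"
      by (rule LIM_zero_cancel)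
    \<comment> \<open>\<open>J\<close> itself is never passed to the limit: the inequality
      \<open>m \<le> J (w k + r *\<^sub>R v)\<close> is expanded around \<open>w k\<close>, where
      \<open>J (w k)\<close> is within \<open>1 / (k + 1)\<close> of \<open>m\<close>, and only the
      linear quantity \<open>\<alpha> (w k) v\<close> has to converge.\<close>
    have ge: "0 \<le> 2 * r * (\<alpha> z v - l v) + r\<^sup>2 * \<alpha> v v" for r
    proof (rule LIMSEQ_le_const)
      have "(\<lambda>k. 1 / real (Suc k)) \<longlonglongrightarrow> 0"
        using LIMSEQ_inverse_real_of_nat by (simp add: inverse_eq_divide)
      moreover have "(\<lambda>k. 2 * r * (\<alpha> (w k) v - l v) + r\<^sup>2 * \<alpha> v v) \<longlonglongrightarrow>
          2 * r * (\<alpha> z v - l v) + r\<^sup>2 * \<alpha> v v"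
        by (intro tendsto_intros lim)
      ultimately show "(\<lambda>k. 1 / real (Suc k) + (2 * r * (\<alpha> (w k) v - l v) + r\<^sup>2 * \<alpha> v v)) \<longlonglongrightarrow>
         2 * r * (\<alpha> z v - l v) + r\<^sup>2 * \<alpha> v v"
        using tendsto_add by fastforce
      have "0 \<le> 1 / real (Suc k) + (2 * r * (\<alpha> (w k) v - l v) + r\<^sup>2 * \<alpha> v v)" for k
        using m[of "w k + r *\<^sub>R v"] J_add[OF w(1) v, of k r] w(2)[of k] w(1) v
          subspace_add[OF subspace] subspace_scale[OF subspace]
        by simp
      then show "\<exists>N. \<forall>k\<ge>N. 0 \<le> 1 / real (Suc k) + (2 * r * (\<alpha> (w k) v - l v) + r\<^sup>2 * \<alpha> v v)"
        by blast
    qed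
    define b where "b = \<alpha> z v - l v"
    \<comment> \<open>The choice \<open>r = - b / A\<close> in the inequality leaves
      \<open>b^2 / A \<le> 0\<close>; the summand 1 keeps \<open>A\<close> positive when
      \<open>v = 0\<close>.\<close>
    define A where "A = \<alpha> v v + 1"
    have "A > 0" using nonneg[OF v] by (simp add: A_def)
    have "0 \<le> 2 * (- b / A) * b + (- b / A)\<^sup>2 * \<alpha> v v" using ge[of "- b / A"] by (simp add: b_def)
    also have "\<dots> \<le> 2 * (- b / A) * b + (- b / A)\<^sup>2 * A"
      by (intro add_left_mono mult_left_mono) (auto simp: A_def)
    also have "\<dots> = - (b\<^sup>2 / A)" using \<open>A > 0\<close> by (simp add: power2_eq_square field_simps)
    finally have "b\<^sup>2 / A \<le> 0" by simp
    then have "b = 0" using \<open>A > 0\<close> by (simp add: divide_le_0_iff)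
    then show ?thesis by (simp add: b_def)
  qed
  with \<open>z \<in> S\<close> show ?thesis by blast
qed

lemma eqI:
  assumes x: "x \<in> S" and y: "y \<in> S" and eq: "\<And>v. v \<in> S \<Longrightarrow> \<alpha> x v = \<alpha> y v"
  shows "x = y"
proof -
  have "x - y \<in> S" using x y by (rule subspace_diff[OF subspace])
  then have "\<alpha> (x - y) (x - y) = 0"
    using diff[OF x y, of "x - y"] eq[of "x - y"] by simp
  then show ?thesis using eq_zero[OF \<open>x - y \<in> S\<close>] by simp
qed

text \<open>Linearity follows from uniqueness of the representing vector, boundedness from testing
  the equation with \<open>G x\<close> and using coercivity. The right-hand side \<open>b\<close>
  will be the \<open>L^2\<close> pairing of first components.\<close>

lemma solution_operator:
  assumes b: "bounded_bilinear b"
  obtains G where "bounded_linear G" "\<And>f. G f \<in> S" "\<And>f v. v \<in> S \<Longrightarrow> \<alpha> (G f) v = b f v"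
proof -
  interpret b: bounded_bilinear b by fact
  have "\<exists>w\<in>S. \<forall>v\<in>S. \<alpha> w v = b f v" for f
    by (rule Riesz_representation) (rule b.bounded_linear_right)
  then obtain G where G: "\<And>f. G f \<in> S" "\<And>f v. v \<in> S \<Longrightarrow> \<alpha> (G f) v = b f v"
    by metis
  obtain K where K: "K \<ge> 0" "\<And>x y. norm (b x y) \<le> norm x * norm y * K"
    using b.nonneg_bounded by blast
  have "bounded_linear G"
  proof (rule bounded_linear_intro)
    show "G (x + y) = G x + G y" for x y
      by (rule eqI) (auto simp: G add subspace_add[OF subspace] b.add_left)
    show "G (r *\<^sub>R x) = r *\<^sub>R G x" for r x
      by (rule eqI) (auto simp: G scale subspace_scale[OF subspace] b.scaleR_left)
    show "norm (G x) \<le> norm x * (K / c)" for x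
    proof (cases "G x = 0")
      case False
      have "c * (norm (G x))\<^sup>2 \<le> b x (G x)"
        using coercive[OF G(1)] G(2)[OF G(1)] by metis
      also have "\<dots> \<le> norm x * norm (G x) * K" using K(2)[of x "G x"] by simp
      finally show ?thesis
        using False c_pos by (simp add: power2_eq_square field_simps)
    qed (use K c_pos in simp)
  qed
  with G show ?thesis by (intro that)
qed

end

section \<open>Test functions\<close>

text \<open>The smoothness half of \<open>testfun\<close>, separated from the support condition so
  that polynomials can multiply test functions.\<close>

definition C1_grad :: "('d::euclidean_space \<Rightarrow> real) \<Rightarrow> ('d \<Rightarrow> 'd) \<Rightarrow> bool" where
  "C1_grad \<eta> g \<longleftrightarrow> (\<forall>x. (\<eta> has_derivative (\<lambda>h. g x \<bullet> h)) (at x)) \<and> continuous_on UNIV g"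

lemma testfun_iff:
  "testfun \<Omega> \<phi> \<psi> \<longleftrightarrow>
    C1_grad \<phi> \<psi> \<and> compact (closure {x. \<phi> x \<noteq> 0}) \<and> closure {x. \<phi> x \<noteq> 0} \<subseteq> \<Omega>"
  by (auto simp: testfun_def C1_grad_def)

lemma C1_grad_continuous: "C1_grad \<eta> g \<Longrightarrow> continuous_on A \<eta>" "C1_grad \<eta> g \<Longrightarrow> continuous_on A g"
  by (auto simp: C1_grad_def intro: has_derivative_continuous continuous_at_imp_continuous_on
      continuous_on_subset)

lemma C1_grad_mult:
  assumes "C1_grad \<eta> g" "C1_grad \<theta> k"
  shows "C1_grad (\<lambda>x. \<eta> x * \<theta> x) (\<lambda>x. \<eta> x *\<^sub>R k x + \<theta> x *\<^sub>R g x)"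
  unfolding C1_grad_def
proof (intro conjI allI)
  show "((\<lambda>x. \<eta> x * \<theta> x) has_derivative (\<lambda>h. (\<eta> x *\<^sub>R k x + \<theta> x *\<^sub>R g x) \<bullet> h)) (at x)" for x
    using assms unfolding C1_grad_def
    by (auto intro!: derivative_eq_intros simp: inner_simps algebra_simps)
  show "continuous_on UNIV (\<lambda>x. \<eta> x *\<^sub>R k x + \<theta> x *\<^sub>R g x)"
    by (intro continuous_intros C1_grad_continuous[OF assms(1)] C1_grad_continuous[OF assms(2)])
qed

lemma C1_grad_add:
  assumes "C1_grad \<eta> g" "C1_grad \<theta> k"
  shows "C1_grad (\<lambda>x. \<eta> x + \<theta> x) (\<lambda>x. g x + k x)"
  using assms unfolding C1_grad_def
  by (auto intro!: derivative_eq_intros continuous_intros simp: inner_simps)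

lemma C1_grad_const: "C1_grad (\<lambda>x. c) (\<lambda>x. 0)"
  by (simp add: C1_grad_def)

lemma C1_grad_inner: "C1_grad (\<lambda>x. x \<bullet> e) (\<lambda>x. e)"
  by (auto simp: C1_grad_def inner_commute intro!: derivative_eq_intros)

lemma C1_grad_real_polynomial:
  "real_polynomial_function p \<Longrightarrow> \<exists>g. C1_grad p g"
proof (induction rule: real_polynomial_function.induct)
  case (linear f)
  have "f = (\<lambda>x. x \<bullet> (\<Sum>b\<in>Basis. f b *\<^sub>R b))"
  proof
    fix x
    have "f x = f (\<Sum>b\<in>Basis. (x \<bullet> b) *\<^sub>R b)" by (simp add: euclidean_representation)
    also have "\<dots> = (\<Sum>b\<in>Basis. (x \<bullet> b) * f b)"
      using bounded_linear.linear[OF linear] by (simp add: linear_sum linear_scale)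
    finally show "f x = x \<bullet> (\<Sum>b\<in>Basis. f b *\<^sub>R b)"
      by (simp add: inner_sum_right mult.commute)
  qed
  then show ?case using C1_grad_inner by metis
qed (use C1_grad_const C1_grad_add C1_grad_mult in blast)+

lemma testfun_mult:
  assumes "testfun \<Omega> \<phi> \<psi>" "C1_grad \<eta> g"
  shows "testfun \<Omega> (\<lambda>x. \<phi> x * \<eta> x) (\<lambda>x. \<phi> x *\<^sub>R g x + \<eta> x *\<^sub>R \<psi> x)"
proof -
  have sub: "closure {x. \<phi> x * \<eta> x \<noteq> 0} \<subseteq> closure {x. \<phi> x \<noteq> 0}"
    by (intro closure_mono) auto
  moreover have "bounded {x. \<phi> x * \<eta> x \<noteq> 0}"
    using assms(1) unfolding testfun_iff compact_closure
    by (auto intro: bounded_subset[of "{x. \<phi> x \<noteq> 0}"])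
  ultimately show ?thesis
    using assms C1_grad_mult[of \<phi> \<psi> \<eta> g] unfolding testfun_iff compact_closure by auto
qed

lemma testfun_zero: "testfun \<Omega> (\<lambda>x. 0) (\<lambda>x. 0)"
  by (simp add: testfun_iff C1_grad_const)

lemma testfun_add:
  assumes "testfun \<Omega> \<phi> \<psi>" "testfun \<Omega> \<phi>' \<psi>'"
  shows "testfun \<Omega> (\<lambda>x. \<phi> x + \<phi>' x) (\<lambda>x. \<psi> x + \<psi>' x)"
proof -
  let ?K = "closure {x. \<phi> x \<noteq> 0} \<union> closure {x. \<phi>' x \<noteq> 0}"
  have sub: "closure {x. \<phi> x + \<phi>' x \<noteq> 0} \<subseteq> ?K"
    unfolding closure_Un[symmetric] by (intro closure_mono) auto
  moreover have "bounded {x. \<phi> x + \<phi>' x \<noteq> 0}"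
    using assms unfolding testfun_iff compact_closure
    by (auto intro: bounded_subset[of "{x. \<phi> x \<noteq> 0} \<union> {x. \<phi>' x \<noteq> 0}"])
  ultimately show ?thesis
    using assms C1_grad_add[of \<phi> \<psi> \<phi>' \<psi>'] unfolding testfun_iff compact_closure by auto
qed

lemma testfun_scale:
  assumes "testfun \<Omega> \<phi> \<psi>"
  shows "testfun \<Omega> (\<lambda>x. c * \<phi> x) (\<lambda>x. c *\<^sub>R \<psi> x)"
  using testfun_mult[OF assms C1_grad_const[of c]] by (simp add: mult.commute)

text \<open>\<open>testfun\<close> restricts the support of \<open>\<phi>\<close> alone. Off that
  closed set \<open>\<phi>\<close> is locally zero, so uniqueness of the derivative forces its
  gradient to vanish too.\<close>

lemma testfun_eq_0:
  assumes "testfun \<Omega> \<phi> \<psi>" "x \<notin> closure {x. \<phi> x \<noteq> 0}"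
  shows "\<phi> x = 0" "\<psi> x = 0"
proof -
  show "\<phi> x = 0" using assms(2) closure_subset[of "{x. \<phi> x \<noteq> 0}"] by auto
  have "(\<phi> has_derivative (\<lambda>h. 0)) (at x)"
  proof (rule has_derivative_transform_within_open)
    show "((\<lambda>x. 0) has_derivative (\<lambda>h. 0)) (at x)" by simp
    show "open (- closure {x. \<phi> x \<noteq> 0})" by auto
    show "x \<in> - closure {x. \<phi> x \<noteq> 0}" using assms by simp
    show "0 = \<phi> y" if "y \<in> - closure {x. \<phi> x \<noteq> 0}" for y
      using that closure_subset[of "{x. \<phi> x \<noteq> 0}"] by auto
  qed
  moreover have "(\<phi> has_derivative (\<lambda>h. \<psi> x \<bullet> h)) (at x)"
    using assms by (simp add: testfun_def)
  ultimately have "(\<lambda>h. \<psi> x \<bullet> h) = (\<lambda>h. 0)"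
    by (rule has_derivative_unique[rotated])
  then show "\<psi> x = 0" by (metis inner_eq_zero_iff)
qed

lemma integrable_continuous_compact_support:
  fixes f :: "'d::euclidean_space \<Rightarrow> 'b::euclidean_space"
  assumes "continuous_on UNIV f" "compact K" "\<And>x. x \<notin> K \<Longrightarrow> f x = 0"
  shows "integrable lborel f"
proof -
  have "integrable lborel (\<lambda>x. indicator K x *\<^sub>R f x)"
    using assms by (intro borel_integrable_compact) (auto intro: continuous_on_subset)
  moreover have "(\<lambda>x. indicator K x *\<^sub>R f x) = f"
    using assms(3) by (force simp: indicator_def)
  ultimately show ?thesis by simp
qed

text \<open>By translation invariance the difference quotients \<open>(\<phi>(x + h e) - \<phi>(x)) / h\<close> have
  integral zero; let \<open>h\<close> tend to zero.\<close>

lemma integral_grad_testfun: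
  assumes "testfun \<Omega> \<phi> \<psi>"
  shows "(LINT x|lborel. \<psi> x \<bullet> e) = 0"
proof -
  define K where "K = closure {x. \<phi> x \<noteq> 0}"
  have "compact K" using assms by (simp add: testfun_iff K_def)
  have zero: "\<phi> x = 0" "\<psi> x = 0" if "x \<notin> K" for x
    by (rule testfun_eq_0[OF assms that[unfolded K_def]])+
  have C1: "C1_grad \<phi> \<psi>" using assms by (simp add: testfun_iff)
  note cont = C1_grad_continuous[OF C1]
  have [measurable]: "\<phi> \<in> borel_measurable borel" "\<psi> \<in> borel_measurable borel"
    by (rule borel_measurable_continuous_onI[OF cont(1)], rule borel_measurable_continuous_onI[OF cont(2)])
  have "bounded (\<psi> ` K)"
    by (intro compact_imp_bounded compact_continuous_image cont \<open>compact K\<close>)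
  then obtain B' where B': "\<And>x. x \<in> K \<Longrightarrow> norm (\<psi> x) \<le> B'"
    unfolding bounded_iff by auto
  \<comment> \<open>If \<open>K\<close> is empty, \<open>B'\<close> carries no information and may
    be negative.\<close>
  define B where "B = max B' 0"
  have B: "norm (\<psi> x) \<le> B" for x
    using B'[of x] zero(2)[of x] by (cases "x \<in> K") (auto simp: B_def)
  have lipschitz: "\<bar>\<phi> (x + v) - \<phi> x\<bar> \<le> B * norm v" for x v
  proof -
    have "norm (\<phi> (x + v) - \<phi> x) \<le> B * norm (x + v - x)"
    proof (rule differentiable_bound[of UNIV])
      show "(\<phi> has_derivative (\<lambda>h. \<psi> y \<bullet> h)) (at y within UNIV)" for y
        using C1 by (simp add: C1_grad_def)
      show "onorm (\<lambda>h. \<psi> y \<bullet> h) \<le> B" for y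
        using B[of y] by (intro onorm_bound)
          (auto intro!: order_trans[OF Cauchy_Schwarz_ineq2] mult_right_mono simp: B_def)
    qed auto
    then show ?thesis by simp
  qed
  obtain r where r: "K \<subseteq> cball 0 r"
    using compact_imp_bounded[OF \<open>compact K\<close>] by (auto simp: bounded_iff subset_eq)
  \<comment> \<open>Since \<open>h n \<le> 1\<close>, this ball contains the supports of all the
    shifted functions, so one integrable majorant serves every \<open>n\<close>.\<close>
  define K' :: "'a set" where "K' = cball 0 (r + norm e)"
  define h where "h n = 1 / real (Suc n)" for n
  have h: "h n > 0" "h n \<le> 1" for n by (auto simp: h_def)
  define s where "s n x = (\<phi> (h n *\<^sub>R e + x) - \<phi> x) / h n" for n x
  have int: "integrable lborel \<phi>"
    by (rule integrable_continuous_compact_support[OF cont(1) \<open>compact K\<close> zero(1)])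
  have shift: "integrable lborel (\<lambda>x. \<phi> (c + x))" "(LINT x|lborel. \<phi> (c + x)) = (LINT x|lborel. \<phi> x)" for c
  proof -
    have eq: "distr lborel lborel ((+) c) = (lborel :: 'a measure)"
      using lborel_distr_plus[of c] by (simp cong: distr_cong)
    show "integrable lborel (\<lambda>x. \<phi> (c + x))"
      using int integrable_distr_eq[of "(+) c" lborel lborel \<phi>] by (simp add: eq)
    show "(LINT x|lborel. \<phi> (c + x)) = (LINT x|lborel. \<phi> x)"
      using integral_distr[of "(+) c" lborel lborel \<phi>] by (simp add: eq)
  qed
  have "(\<lambda>n. LINT x|lborel. s n x) \<longlonglongrightarrow> (LINT x|lborel. \<psi> x \<bullet> e)"
  proof (rule integral_dominated_convergence[where w = "\<lambda>x. indicator K' x *\<^sub>R (B * norm e)"])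
    show "integrable lborel (\<lambda>x. indicator K' x *\<^sub>R (B * norm e))"
      unfolding K'_def by (intro borel_integrable_compact) auto
    show "AE x in lborel. norm (s n x) \<le> indicator K' x *\<^sub>R (B * norm e)" for n
    proof (rule AE_I2)
      fix x
      show "norm (s n x) \<le> indicator K' x *\<^sub>R (B * norm e)"
      proof (cases "x \<in> K'")
        case True
        have "\<bar>\<phi> (h n *\<^sub>R e + x) - \<phi> x\<bar> \<le> B * norm (h n *\<^sub>R e)"
          using lipschitz[of x "h n *\<^sub>R e"] by (simp add: add.commute)
        then show ?thesis
          using True h[of n] by (simp add: s_def field_simps)
      next
        case False
        have "norm x \<le> norm (h n *\<^sub>R e + x) + norm (h n *\<^sub>R e)"
          by (metis add_diff_cancel_left' norm_triangle_sub norm_minus_commute add.commute norm_triangle_ineq4)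
        moreover have "norm (h n *\<^sub>R e) \<le> norm e"
          using h[of n] by (simp add: mult_left_le_one_le)
        ultimately have "\<not> norm x \<le> r" "\<not> norm (h n *\<^sub>R e + x) \<le> r"
          using False norm_ge_zero[of e] unfolding K'_def mem_cball_0 by linarith+
        then have "x \<notin> K" "h n *\<^sub>R e + x \<notin> K"
          using r by auto
        then show ?thesis using zero by (simp add: s_def False)
      qed
    qed
    show "AE x in lborel. (\<lambda>n. s n x) \<longlonglongrightarrow> \<psi> x \<bullet> e"
    proof (rule AE_I2)
      fix x
      have "((\<lambda>t. \<phi> (t *\<^sub>R e + x)) has_derivative (\<lambda>t. \<psi> x \<bullet> (t *\<^sub>R e))) (at 0)"
      proof (rule has_derivative_compose[of "\<lambda>t. t *\<^sub>R e + x" "\<lambda>t. t *\<^sub>R e", where g = \<phi>])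
        show "((\<lambda>t. t *\<^sub>R e + x) has_derivative (\<lambda>t. t *\<^sub>R e)) (at 0)"
          by (auto intro!: derivative_eq_intros)
        show "(\<phi> has_derivative (\<bullet>) (\<psi> x)) (at (0 *\<^sub>R e + x))"
          using C1 by (simp add: C1_grad_def)
      qed
      then have "((\<lambda>t. \<phi> (t *\<^sub>R e + x)) has_real_derivative \<psi> x \<bullet> e) (at 0)"
        unfolding has_field_derivative_def by (rule has_derivative_eq_rhs) (simp add: fun_eq_iff)
      then have "((\<lambda>t. (\<phi> (t *\<^sub>R e + x) - \<phi> x) / t) \<longlongrightarrow> \<psi> x \<bullet> e) (at 0)"
        by (simp add: has_field_derivative_iff)
      moreover have "filterlim h (at 0) sequentially"
      proof -
        have "h = (\<lambda>n. inverse (real (Suc n)))"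
          by (simp add: h_def inverse_eq_divide fun_eq_iff)
        then have "h \<longlonglongrightarrow> 0" using LIMSEQ_inverse_real_of_nat by simp
        then show ?thesis
          using h(1) unfolding filterlim_at by (simp add: less_imp_neq[THEN not_sym])
      qed
      ultimately show "(\<lambda>n. s n x) \<longlonglongrightarrow> \<psi> x \<bullet> e"
        unfolding s_def by (rule filterlim_compose)
    qed
  qed (auto simp: s_def)
  moreover have "(LINT x|lborel. s n x) = 0" for n
    unfolding s_def using shift int by simp
  ultimately show ?thesis by (simp add: LIMSEQ_const_iff)
qed

section \<open>The Sobolev space as a closed subspace\<close>

text \<open>Turns integrals over \<open>\<Omega>\<close> into integrals over the whole space. Test
  functions and their gradients are unchanged by it, so they need no restriction.\<close>

definition zero_ext :: "'d set \<Rightarrow> ('d \<Rightarrow> 'b::zero) \<Rightarrow> 'd \<Rightarrow> 'b" where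
  "zero_ext \<Omega> f = (\<lambda>x. if x \<in> \<Omega> then f x else 0)"

lemma zero_ext_testfun:
  assumes "testfun \<Omega> \<phi> \<psi>"
  shows "zero_ext \<Omega> \<phi> = \<phi>" "zero_ext \<Omega> \<psi> = \<psi>"
proof -
  have "x \<notin> closure {x. \<phi> x \<noteq> 0}" if "x \<notin> \<Omega>" for x
    using assms that by (auto simp: testfun_iff)
  then have "\<phi> x = 0" "\<psi> x = 0" if "x \<notin> \<Omega>" for x
    using testfun_eq_0[OF assms] that by blast+
  then show "zero_ext \<Omega> \<phi> = \<phi>" "zero_ext \<Omega> \<psi> = \<psi>"
    by (simp_all add: zero_ext_def fun_eq_iff)
qed

lemma square_integrable_compact_support:
  fixes f :: "'d::euclidean_space \<Rightarrow> 'b::euclidean_space"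
  assumes "continuous_on UNIV f" "compact K" "\<And>x. x \<notin> K \<Longrightarrow> f x = 0"
  shows "square_integrable f"
proof -
  have "integrable lborel (\<lambda>x. (norm (f x))\<^sup>2)"
    using assms by (intro integrable_continuous_compact_support[of _ K]) (auto intro!: continuous_intros)
  from this this have "integrable lebesgue (\<lambda>x. (norm (f x))\<^sup>2)"
    by (rule integrable_completion[THEN iffD2, OF borel_measurable_integrable])
  moreover have "f \<in> borel_measurable lebesgue"
    using borel_measurable_continuous_onI[OF assms(1)] by (intro measurable_completion) simp
  ultimately show ?thesis by (simp add: square_integrable_def)
qed

lemma square_integrable_testfun:
  assumes "testfun \<Omega> \<phi> \<psi>"
  shows "square_integrable \<phi>" "square_integrable \<psi>"
proof -
  have C1: "C1_grad \<phi> \<psi>" and K: "compact (closure {x. \<phi> x \<noteq> 0})"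
    using assms by (simp_all add: testfun_iff)
  show "square_integrable \<phi>" "square_integrable \<psi>"
    by (rule square_integrable_compact_support[OF _ K], rule C1_grad_continuous[OF C1],
        erule testfun_eq_0[OF assms])+
qed

lemma square_integrable_zero_ext_continuous:
  fixes f :: "'d::euclidean_space \<Rightarrow> 'b::euclidean_space"
  assumes "open \<Omega>" "bounded \<Omega>" "continuous_on UNIV f"
  shows "square_integrable (zero_ext \<Omega> f)"
proof -
  obtain r where r: "\<Omega> \<subseteq> cball 0 r" using \<open>bounded \<Omega>\<close> by (auto simp: bounded_iff subset_eq)
  have [measurable]: "\<Omega> \<in> sets lebesgue" using \<open>open \<Omega>\<close> by simp
  have fm[measurable]: "f \<in> borel_measurable lebesgue"
    using borel_measurable_continuous_onI[OF assms(3)] by (intro measurable_completion) simp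
  have zm[measurable]: "zero_ext \<Omega> f \<in> borel_measurable lebesgue"
    unfolding zero_ext_def by (intro measurable_If) auto
  have "integrable lborel (\<lambda>x. indicator (cball 0 r) x *\<^sub>R (norm (f x))\<^sup>2)"
    using assms(3) by (intro borel_integrable_compact) (auto intro!: continuous_intros intro: continuous_on_subset)
  from this this have "integrable lebesgue (\<lambda>x. indicator (cball 0 r) x *\<^sub>R (norm (f x))\<^sup>2)"
    by (rule integrable_completion[THEN iffD2, OF borel_measurable_integrable])
  then have "integrable lebesgue (\<lambda>x. (norm (zero_ext \<Omega> f x))\<^sup>2)"
    by (rule Bochner_Integration.integrable_bound)
       (use r in \<open>auto intro!: AE_I2 simp: zero_ext_def indicator_def subset_eq\<close>)
  then show ?thesis by (simp add: square_integrable_def)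
qed

text \<open>\<open>\<phi> * \<eta>\<close> is again a test function, whatever \<open>\<eta>\<close>
  does at the boundary, so the integral of its derivative along \<open>e\<close> vanishes. Written
  with \<open>L^2\<close> inner products against fixed elements, the identity is a closed condition
  and extends to \<open>H1_space\<close>.\<close>

lemma testfun_integration_by_parts:
  assumes \<Omega>: "open \<Omega>" "bounded \<Omega>" and \<phi>: "testfun \<Omega> \<phi> \<psi>" and \<eta>: "C1_grad \<eta> g"
  shows "toL2 \<phi> \<bullet> toL2 (zero_ext \<Omega> (\<lambda>x. g x \<bullet> e)) + toL2 \<psi> \<bullet> toL2 (zero_ext \<Omega> (\<lambda>x. \<eta> x *\<^sub>R e)) = 0"
proof -
  note cont = C1_grad_continuous[OF \<eta>]
  have sq: "square_integrable (zero_ext \<Omega> (\<lambda>x. g x \<bullet> e))" "square_integrable (zero_ext \<Omega> (\<lambda>x. \<eta> x *\<^sub>R e))"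
    by (intro square_integrable_zero_ext_continuous \<Omega> continuous_intros cont)+
  note sq\<phi> = square_integrable_testfun[OF \<phi>]
  have t: "testfun \<Omega> (\<lambda>x. \<phi> x * \<eta> x) (\<lambda>x. \<phi> x *\<^sub>R g x + \<eta> x *\<^sub>R \<psi> x)"
    by (rule testfun_mult[OF \<phi> \<eta>])
  have C1: "C1_grad \<phi> \<psi>" using \<phi> by (simp add: testfun_iff)
  have pt: "\<phi> x \<bullet> zero_ext \<Omega> (\<lambda>x. g x \<bullet> e) x + \<psi> x \<bullet> zero_ext \<Omega> (\<lambda>x. \<eta> x *\<^sub>R e) x
      = (\<phi> x *\<^sub>R g x + \<eta> x *\<^sub>R \<psi> x) \<bullet> e" for x
    using fun_cong[OF zero_ext_testfun(1)[OF \<phi>], of x] fun_cong[OF zero_ext_testfun(2)[OF \<phi>], of x]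
    by (auto simp: zero_ext_def inner_simps split: if_splits)
  have "toL2 \<phi> \<bullet> toL2 (zero_ext \<Omega> (\<lambda>x. g x \<bullet> e)) + toL2 \<psi> \<bullet> toL2 (zero_ext \<Omega> (\<lambda>x. \<eta> x *\<^sub>R e))
      = (LINT x|lebesgue. (\<phi> x *\<^sub>R g x + \<eta> x *\<^sub>R \<psi> x) \<bullet> e)"
    unfolding pt[symmetric] using sq sq\<phi>
    by (simp only: inner_toL2 Bochner_Integration.integral_add square_integrable_inner)
  also have "\<dots> = (LINT x|lborel. (\<phi> x *\<^sub>R g x + \<eta> x *\<^sub>R \<psi> x) \<bullet> e)"
    by (intro integral_completion)
      (auto intro!: borel_measurable_continuous_onI continuous_intros cont C1_grad_continuous[OF C1])
  also have "\<dots> = 0" by (rule integral_grad_testfun[OF t])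
  finally show ?thesis .
qed

lemma subspace_closure:
  fixes A :: "'a::real_normed_vector set"
  assumes "subspace A"
  shows "subspace (closure A)"
proof (rule subspaceI)
  show "0 \<in> closure A"
    using subspace_0[OF assms] closure_subset by blast
  show "x + y \<in> closure A" if xy: "x \<in> closure A" "y \<in> closure A" for x y
  proof -
    obtain f g where "\<forall>n. f n \<in> A" "f \<longlonglongrightarrow> x" "\<forall>n. g n \<in> A" "g \<longlonglongrightarrow> y"
      using xy unfolding closure_sequential by blast
    then show ?thesis
      unfolding closure_sequential
      by (intro exI[of _ "\<lambda>n. f n + g n"]) (auto intro: tendsto_add subspace_add[OF assms])
  qed
  show "c *\<^sub>R x \<in> closure A" if x: "x \<in> closure A" for c x
  proof -
    obtain f where "\<forall>n. f n \<in> A" "f \<longlonglongrightarrow> x"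
      using x unfolding closure_sequential by blast
    then show ?thesis
      unfolding closure_sequential
      by (intro exI[of _ "\<lambda>n. c *\<^sub>R f n"]) (auto intro: tendsto_scaleR subspace_scale[OF assms])
  qed
qed

section \<open>The closure of the test pairs and its zero extensions\<close>

locale bounded_open =
  fixes \<Omega> :: "'d::euclidean_space set"
  assumes open_\<Omega>: "open \<Omega>" and bounded_\<Omega>: "bounded \<Omega>"
begin

lemma sets_\<Omega>[measurable]: "\<Omega> \<in> sets lebesgue"
  using open_\<Omega> by simp

definition test_pairs :: "(('d, real) L2 \<times> ('d, 'd) L2) set" where
  "test_pairs = {(toL2 \<phi>, toL2 \<psi>) | \<phi> \<psi>. testfun \<Omega> \<phi> \<psi>}"

definition H1_space :: "(('d, real) L2 \<times> ('d, 'd) L2) set" where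
  "H1_space = closure test_pairs"

lemma subspace_H1_space: "subspace H1_space"
  unfolding H1_space_def
proof (rule subspace_closure, rule subspaceI)
  show "0 \<in> test_pairs"
    unfolding test_pairs_def mem_Collect_eq
    by (intro exI[of _ "\<lambda>x. 0"]) (simp add: testfun_zero toL2_zero zero_prod_def)
next
  fix x y assume "x \<in> test_pairs" "y \<in> test_pairs"
  then obtain \<phi> \<psi> \<phi>' \<psi>' where t: "testfun \<Omega> \<phi> \<psi>" "testfun \<Omega> \<phi>' \<psi>'"
    and xy: "x = (toL2 \<phi>, toL2 \<psi>)" "y = (toL2 \<phi>', toL2 \<psi>')"
    by (auto simp: test_pairs_def)
  have "x + y = (toL2 (\<lambda>x. \<phi> x + \<phi>' x), toL2 (\<lambda>x. \<psi> x + \<psi>' x))"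
    using t by (simp add: xy toL2_add square_integrable_testfun)
  then show "x + y \<in> test_pairs"
    unfolding test_pairs_def using testfun_add[OF t] by blast
next
  fix c :: real and x assume "x \<in> test_pairs"
  then obtain \<phi> \<psi> where t: "testfun \<Omega> \<phi> \<psi>" and x: "x = (toL2 \<phi>, toL2 \<psi>)"
    by (auto simp: test_pairs_def)
  have "c *\<^sub>R x = (toL2 (\<lambda>x. c * \<phi> x), toL2 (\<lambda>x. c *\<^sub>R \<psi> x))"
    using t toL2_scaleR[of \<phi> c] by (simp add: x toL2_scaleR square_integrable_testfun)
  then show "c *\<^sub>R x \<in> test_pairs"
    unfolding test_pairs_def using testfun_scale[OF t] by blast
qed

lemma closed_H1_space: "closed H1_space"
  by (simp add: H1_space_def)

text \<open>The density argument as an induction rule: a closed property needs checking on test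
  functions only.\<close>

lemma H1_space_induct:
  assumes "closed {x. P x}" "\<And>\<phi> \<psi>. testfun \<Omega> \<phi> \<psi> \<Longrightarrow> P (toL2 \<phi>, toL2 \<psi>)" "s \<in> H1_space"
  shows "P s"
proof -
  have "test_pairs \<subseteq> {x. P x}" using assms(2) by (auto simp: test_pairs_def)
  then have "H1_space \<subseteq> {x. P x}"
    unfolding H1_space_def using assms(1) by (rule closure_minimal)
  then show ?thesis using assms(3) by blast
qed

lemma zero_ext_measurable:
  fixes f :: "'d \<Rightarrow> 'b::euclidean_space"
  shows "zero_ext \<Omega> f \<in> borel_measurable lebesgue \<longleftrightarrow> f \<in> borel_measurable (lebesgue_on \<Omega>)"
  unfolding zero_ext_def by (rule borel_measurable_if[OF sets_\<Omega>])

lemma square_integrable_zero_ext: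
  fixes f :: "'d \<Rightarrow> 'b::euclidean_space"
  shows "square_integrable (zero_ext \<Omega> f) \<longleftrightarrow>
    f \<in> borel_measurable (lebesgue_on \<Omega>) \<and> integrable (lebesgue_on \<Omega>) (\<lambda>x. (norm (f x))\<^sup>2)"
proof -
  have "(\<lambda>x. (norm (zero_ext \<Omega> f x))\<^sup>2) = (\<lambda>x. if x \<in> \<Omega> then (norm (f x))\<^sup>2 else 0)"
    by (auto simp: zero_ext_def)
  then show ?thesis
    unfolding square_integrable_def zero_ext_measurable
    by (simp add: Lebesgue_Measure.integrable_restrict_UNIV)
qed

lemma integral_zero_ext:
  fixes f :: "'d \<Rightarrow> 'b::euclidean_space"
  shows "(LINT x|lebesgue_on \<Omega>. f x) = (LINT x|lebesgue. zero_ext \<Omega> f x)"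
  unfolding zero_ext_def by (rule Lebesgue_Measure.integral_restrict_UNIV[OF sets_\<Omega>, symmetric])

lemma inner_zero_ext:
  fixes f g :: "'d \<Rightarrow> 'b::euclidean_space"
  assumes "square_integrable (zero_ext \<Omega> f)" "square_integrable (zero_ext \<Omega> g)"
  shows "toL2 (zero_ext \<Omega> f) \<bullet> toL2 (zero_ext \<Omega> g) = (LINT x|lebesgue_on \<Omega>. f x \<bullet> g x)"
    "integrable (lebesgue_on \<Omega>) (\<lambda>x. f x \<bullet> g x)"
proof -
  have "(\<lambda>x. zero_ext \<Omega> f x \<bullet> zero_ext \<Omega> g x) = zero_ext \<Omega> (\<lambda>x. f x \<bullet> g x)"
    by (auto simp: zero_ext_def)
  then show "toL2 (zero_ext \<Omega> f) \<bullet> toL2 (zero_ext \<Omega> g) = (LINT x|lebesgue_on \<Omega>. f x \<bullet> g x)"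
    "integrable (lebesgue_on \<Omega>) (\<lambda>x. f x \<bullet> g x)"
    using inner_toL2[OF assms] square_integrable_inner[OF assms]
    unfolding integral_zero_ext Lebesgue_Measure.integrable_restrict_UNIV[OF sets_\<Omega>, symmetric]
    by (simp_all add: zero_ext_def)
qed

lemma AE_zero_ext_iff:
  "(AE x in lebesgue. zero_ext \<Omega> f x = zero_ext \<Omega> g x) \<longleftrightarrow> (AE x in lebesgue_on \<Omega>. f x = g x)"
  by (auto simp: AE_restrict_space_iff zero_ext_def intro: AE_cong)

lemma zero_ext_diff:
  fixes f g :: "'d \<Rightarrow> 'b::euclidean_space"
  shows "zero_ext \<Omega> (\<lambda>x. f x - g x) = (\<lambda>x. zero_ext \<Omega> f x - zero_ext \<Omega> g x)"
    and zero_ext_add: "zero_ext \<Omega> (\<lambda>x. f x + g x) = (\<lambda>x. zero_ext \<Omega> f x + zero_ext \<Omega> g x)"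
  by (auto simp: zero_ext_def)

lemma norm_diff_toL2_testfun:
  assumes f: "square_integrable (zero_ext \<Omega> f)" and k: "square_integrable k" "zero_ext \<Omega> k = k"
  shows "(LINT x|lebesgue_on \<Omega>. (norm (k x - f x))\<^sup>2) = (norm (toL2 k - toL2 (zero_ext \<Omega> f)))\<^sup>2"
proof -
  have "zero_ext \<Omega> (\<lambda>x. (norm (k x - f x))\<^sup>2) = (\<lambda>x. (norm (k x - zero_ext \<Omega> f x))\<^sup>2)"
  proof
    fix x
    show "zero_ext \<Omega> (\<lambda>x. (norm (k x - f x))\<^sup>2) x = (norm (k x - zero_ext \<Omega> f x))\<^sup>2"
      using fun_cong[OF k(2), of x] by (auto simp: zero_ext_def split: if_splits)
  qed
  then show ?thesis
    using norm_toL2[OF square_integrable_diff[OF k(1) f]]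
    by (simp add: integral_zero_ext toL2_diff[OF k(1) f])
qed

text \<open>Closure in a metric space is sequential, and a sequence of pairs converges when both
  components do. Reading the integrals over \<open>\<Omega>\<close> as squared norms, this is the
  approximation condition of \<open>H01_pair\<close>.\<close>

lemma H01_pair_iff:
  "H01_pair \<Omega> u g \<longleftrightarrow> square_integrable (zero_ext \<Omega> u) \<and> square_integrable (zero_ext \<Omega> g) \<and>
    (toL2 (zero_ext \<Omega> u), toL2 (zero_ext \<Omega> g)) \<in> H1_space"
proof (cases "square_integrable (zero_ext \<Omega> u) \<and> square_integrable (zero_ext \<Omega> g)")
  case True
  let ?x = "toL2 (zero_ext \<Omega> u)" and ?y = "toL2 (zero_ext \<Omega> g)"
  have sq_lim: "(\<lambda>k. (norm (a k - b))\<^sup>2) \<longlonglongrightarrow> 0 \<longleftrightarrow> a \<longlonglongrightarrow> b"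
    for a :: "nat \<Rightarrow> 'c::real_normed_vector" and b
  proof -
    have "(\<lambda>k. (norm (a k - b))\<^sup>2) \<longlonglongrightarrow> 0 \<longleftrightarrow> (\<lambda>k. norm (a k - b)) \<longlonglongrightarrow> 0"
    proof
      assume "(\<lambda>k. (norm (a k - b))\<^sup>2) \<longlonglongrightarrow> 0"
      from tendsto_real_sqrt[OF this] show "(\<lambda>k. norm (a k - b)) \<longlonglongrightarrow> 0" by simp
    qed (rule tendsto_null_power, auto)
    then show ?thesis by (simp add: tendsto_norm_zero_iff LIM_zero_iff)
  qed
  have "H01_pair \<Omega> u g \<longleftrightarrow> (\<exists>\<phi> \<psi>. (\<forall>k. testfun \<Omega> (\<phi> k) (\<psi> k)) \<and>
        (\<lambda>k. LINT x|lebesgue_on \<Omega>. (norm (\<phi> k x - u x))\<^sup>2) \<longlonglongrightarrow> 0 \<and>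
        (\<lambda>k. LINT x|lebesgue_on \<Omega>. (norm (\<psi> k x - g x))\<^sup>2) \<longlonglongrightarrow> 0)"
    using True by (simp add: H01_pair_def square_integrable_zero_ext)
  also have "\<dots> \<longleftrightarrow> (\<exists>\<phi> \<psi>. (\<forall>k. testfun \<Omega> (\<phi> k) (\<psi> k)) \<and>
      (\<lambda>k. toL2 (\<phi> k)) \<longlonglongrightarrow> ?x \<and> (\<lambda>k. toL2 (\<psi> k)) \<longlonglongrightarrow> ?y)"
  proof (intro ex_cong1 conj_cong refl)
    fix \<phi> :: "nat \<Rightarrow> 'd \<Rightarrow> real" and \<psi> assume t: "\<forall>k. testfun \<Omega> (\<phi> k) (\<psi> k)"
    have "(LINT x|lebesgue_on \<Omega>. (norm (\<phi> k x - u x))\<^sup>2) = (norm (toL2 (\<phi> k) - ?x))\<^sup>2"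
      "(LINT x|lebesgue_on \<Omega>. (norm (\<psi> k x - g x))\<^sup>2) = (norm (toL2 (\<psi> k) - ?y))\<^sup>2" for k
    proof -
      have tk: "testfun \<Omega> (\<phi> k) (\<psi> k)" using t by blast
      note facts = square_integrable_testfun[OF tk] zero_ext_testfun[OF tk]
      show "(LINT x|lebesgue_on \<Omega>. (norm (\<phi> k x - u x))\<^sup>2) = (norm (toL2 (\<phi> k) - ?x))\<^sup>2"
        by (rule norm_diff_toL2_testfun[OF conjunct1[OF True] facts(1,3)])
      show "(LINT x|lebesgue_on \<Omega>. (norm (\<psi> k x - g x))\<^sup>2) = (norm (toL2 (\<psi> k) - ?y))\<^sup>2"
        by (rule norm_diff_toL2_testfun[OF conjunct2[OF True] facts(2,4)])
    qed
    then show "(\<lambda>k. LINT x|lebesgue_on \<Omega>. (norm (\<phi> k x - u x))\<^sup>2) \<longlonglongrightarrow> 0 \<longleftrightarrow> (\<lambda>k. toL2 (\<phi> k)) \<longlonglongrightarrow> ?x"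
      "(\<lambda>k. LINT x|lebesgue_on \<Omega>. (norm (\<psi> k x - g x))\<^sup>2) \<longlonglongrightarrow> 0 \<longleftrightarrow> (\<lambda>k. toL2 (\<psi> k)) \<longlonglongrightarrow> ?y"
      using sq_lim[of "\<lambda>k. toL2 (\<phi> k)" ?x] sq_lim[of "\<lambda>k. toL2 (\<psi> k)" ?y]
      by (simp_all only:)
  qed
  also have "\<dots> \<longleftrightarrow> (\<exists>s. (\<forall>k. s k \<in> test_pairs) \<and> s \<longlonglongrightarrow> (?x, ?y))"
  proof (intro iffI; elim exE conjE)
    fix \<phi> :: "nat \<Rightarrow> 'd \<Rightarrow> real" and \<psi> assume *: "\<forall>k. testfun \<Omega> (\<phi> k) (\<psi> k)"
      "(\<lambda>k. toL2 (\<phi> k)) \<longlonglongrightarrow> ?x" "(\<lambda>k. toL2 (\<psi> k)) \<longlonglongrightarrow> ?y"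
    show "\<exists>s. (\<forall>k. s k \<in> test_pairs) \<and> s \<longlonglongrightarrow> (?x, ?y)"
      using * tendsto_Pair[OF *(2,3)]
      by (intro exI[of _ "\<lambda>k. (toL2 (\<phi> k), toL2 (\<psi> k))"]) (auto simp: test_pairs_def)
  next
    fix s assume s: "\<forall>k. s k \<in> test_pairs" "s \<longlonglongrightarrow> (?x, ?y)"
    have "\<forall>k. \<exists>\<phi> \<psi>. testfun \<Omega> \<phi> \<psi> \<and> s k = (toL2 \<phi>, toL2 \<psi>)"
      using s(1) unfolding test_pairs_def mem_Collect_eq by blast
    then obtain \<phi> \<psi> where *: "\<And>k. testfun \<Omega> (\<phi> k) (\<psi> k)" "\<And>k. s k = (toL2 (\<phi> k), toL2 (\<psi> k))"
      by metis
    show "\<exists>\<phi> \<psi>. (\<forall>k. testfun \<Omega> (\<phi> k) (\<psi> k)) \<and>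
      (\<lambda>k. toL2 (\<phi> k)) \<longlonglongrightarrow> ?x \<and> (\<lambda>k. toL2 (\<psi> k)) \<longlonglongrightarrow> ?y"
      using * tendsto_fst[OF s(2)] tendsto_snd[OF s(2)]
      by (intro exI[of _ \<phi>] exI[of _ \<psi>]) auto
  qed
  also have "\<dots> \<longleftrightarrow> (?x, ?y) \<in> H1_space"
    by (simp add: H1_space_def closure_sequential)
  finally show ?thesis using True by simp
next
  case False
  then show ?thesis by (auto simp: H01_pair_def square_integrable_zero_ext)
qed

text \<open>Elements of the closure vanish outside \<open>\<Omega>\<close>, being orthogonal to their own part there.\<close>

lemma H1_space_zero_ext:
  assumes "(toL2 u, toL2 g) \<in> H1_space" and u: "square_integrable u" and g: "square_integrable g"
  shows "square_integrable (zero_ext \<Omega> u)" "square_integrable (zero_ext \<Omega> g)"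
    "toL2 (zero_ext \<Omega> u) = toL2 u" "toL2 (zero_ext \<Omega> g) = toL2 g"
proof -
  have sq: "square_integrable (zero_ext \<Omega> f)" if f: "square_integrable f"
    for f :: "'d \<Rightarrow> 'b::euclidean_space"
  proof -
    have m[measurable]: "f \<in> borel_measurable lebesgue" using f by (rule square_integrable_measurable)
    have "zero_ext \<Omega> f \<in> borel_measurable lebesgue"
      unfolding zero_ext_def by (intro measurable_If) auto
    moreover have "integrable lebesgue (\<lambda>x. (norm (zero_ext \<Omega> f x))\<^sup>2)"
    proof (rule Bochner_Integration.integrable_bound)
      show "integrable lebesgue (\<lambda>x. (norm (f x))\<^sup>2)"
        using f by (simp add: square_integrable_def)
    qed (use calculation in \<open>auto intro!: AE_I2 simp: zero_ext_def\<close>)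
    ultimately show ?thesis by (simp add: square_integrable_def)
  qed
  show sqs: "square_integrable (zero_ext \<Omega> u)" "square_integrable (zero_ext \<Omega> g)"
    by (intro sq u g)+
  have orth: "toL2 f \<bullet> toL2 (\<lambda>x. h x - zero_ext \<Omega> h x) = 0"
    if f: "square_integrable f" "zero_ext \<Omega> f = f" and h: "square_integrable h"
    for f h :: "'d \<Rightarrow> 'b::euclidean_space"
  proof -
    have "f x \<bullet> (h x - zero_ext \<Omega> h x) = 0" for x
      using fun_cong[OF f(2), of x] by (auto simp: zero_ext_def split: if_splits)
    then show ?thesis
      by (simp add: inner_toL2 f square_integrable_diff h sq)
  qed
  have self: "toL2 (zero_ext \<Omega> h) = toL2 h"
    if h: "square_integrable h" and z: "toL2 h \<bullet> toL2 (\<lambda>x. h x - zero_ext \<Omega> h x) = 0"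
    for h :: "'d \<Rightarrow> 'b::euclidean_space"
  proof -
    have "toL2 (zero_ext \<Omega> h) \<bullet> toL2 (\<lambda>x. h x - zero_ext \<Omega> h x) = 0"
      by (rule orth[OF sq[OF h] _ h]) (auto simp: zero_ext_def)
    with z have "(toL2 h - toL2 (zero_ext \<Omega> h)) \<bullet> (toL2 h - toL2 (zero_ext \<Omega> h)) = 0"
      by (simp add: toL2_diff h sq inner_diff_left)
    then show ?thesis by simp
  qed
  show "toL2 (zero_ext \<Omega> u) = toL2 u"
  proof (rule self[OF u])
    have "fst (toL2 u, toL2 g) \<bullet> toL2 (\<lambda>x. u x - zero_ext \<Omega> u x) = 0"
      by (rule H1_space_induct[OF _ _ assms(1)])
         (auto intro!: closed_Collect_eq continuous_intros orth u simp: square_integrable_testfun zero_ext_testfun)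
    then show "toL2 u \<bullet> toL2 (\<lambda>x. u x - zero_ext \<Omega> u x) = 0" by simp
  qed
  show "toL2 (zero_ext \<Omega> g) = toL2 g"
  proof (rule self[OF g])
    have "snd (toL2 u, toL2 g) \<bullet> toL2 (\<lambda>x. g x - zero_ext \<Omega> g x) = 0"
      by (rule H1_space_induct[OF _ _ assms(1)])
         (auto intro!: closed_Collect_eq continuous_intros orth g simp: square_integrable_testfun zero_ext_testfun)
    then show "toL2 g \<bullet> toL2 (\<lambda>x. g x - zero_ext \<Omega> g x) = 0" by simp
  qed
qed

lemma H1_space_cases:
  assumes "s \<in> H1_space"
  obtains u g where "H01_pair \<Omega> u g" "s = (toL2 (zero_ext \<Omega> u), toL2 (zero_ext \<Omega> g))"
proof -
  obtain u where u: "square_integrable u" "fst s = toL2 u" by (rule toL2_cases)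
  obtain g where g: "square_integrable g" "snd s = toL2 g" by (rule toL2_cases)
  have s: "s = (toL2 u, toL2 g)" using u g by (simp add: prod_eq_iff)
  with assms have "(toL2 u, toL2 g) \<in> H1_space" by simp
  note z = H1_space_zero_ext[OF this u(1) g(1)]
  have "H01_pair \<Omega> u g"
    unfolding H01_pair_iff using z assms s by simp
  then show ?thesis using that[of u g] s z by simp
qed

text \<open>For a unit vector \<open>e\<close>, integrating the derivative of \<open>(x \<bullet> e) \<phi>\<^sup>2\<close> along \<open>e\<close> gives
  \<open>\<integral>\<phi>\<^sup>2 = - 2 \<integral>(x \<bullet> e) \<phi> (\<nabla>\<phi> \<bullet> e)\<close>.\<close>

lemma Poincare:
  obtains C where "C \<ge> 0" "\<And>s. s \<in> H1_space \<Longrightarrow> norm (fst s) \<le> C * norm (snd s)"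
proof -
  obtain r where r: "\<And>x. x \<in> \<Omega> \<Longrightarrow> norm x \<le> r"
    using bounded_\<Omega> by (auto simp: bounded_iff)
  define R where "R = max r 0"
  have R: "R \<ge> 0" "\<And>x. x \<in> \<Omega> \<Longrightarrow> norm x \<le> R" using r by (force simp: R_def)+
  obtain e :: 'd where e: "e \<in> Basis" using nonempty_Basis by blast
  then have ne: "norm e = 1" by simp
  have le: "norm (toL2 \<phi>) \<le> 2 * R * norm (toL2 \<psi>)" if t: "testfun \<Omega> \<phi> \<psi>" for \<phi> \<psi>
  proof -
    have C1: "C1_grad \<phi> \<psi>" using t by (simp add: testfun_iff)
    note cont = C1_grad_continuous[OF C1]
    note sq = square_integrable_testfun[OF t]
    \<comment> \<open>The coordinate is bounded by \<open>R\<close> on \<open>\<Omega>\<close> and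
      the gradient vanishes elsewhere, so the norm of \<open>k\<close> is at most \<open>R\<close>
      times that of the gradient.\<close>
    define k where "k x = (x \<bullet> e) * (\<psi> x \<bullet> e)" for x
    have \<psi>0: "\<psi> x = 0" if "x \<notin> \<Omega>" for x
      using fun_cong[OF zero_ext_testfun(2)[OF t], of x] that by (simp add: zero_ext_def)
    have k: "\<bar>k x\<bar> \<le> R * norm (\<psi> x)" for x
    proof (cases "x \<in> \<Omega>")
      case True
      have "\<bar>x \<bullet> e\<bar> \<le> R" "\<bar>\<psi> x \<bullet> e\<bar> \<le> norm (\<psi> x)"
        using R(2)[OF True] Cauchy_Schwarz_ineq2[of x e] Cauchy_Schwarz_ineq2[of "\<psi> x" e] ne by auto
      then show ?thesis unfolding k_def abs_mult using R(1) by (intro mult_mono) auto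
    qed (simp add: k_def \<psi>0)
    have kc: "continuous_on UNIV k"
      unfolding k_def by (intro continuous_intros cont)
    have km: "k \<in> borel_measurable lebesgue"
      using borel_measurable_continuous_onI[OF kc] by (intro measurable_completion) simp
    have k2: "(norm (k x))\<^sup>2 \<le> R\<^sup>2 * (norm (\<psi> x))\<^sup>2" for x
      using power_mono[OF k[of x], of 2] by (simp add: power_mult_distrib)
    have intR: "integrable lebesgue (\<lambda>x. R\<^sup>2 * (norm (\<psi> x))\<^sup>2)"
      using sq(2) by (simp add: square_integrable_def)
    have sqk: "square_integrable k"
      unfolding square_integrable_def
    proof (intro conjI km Bochner_Integration.integrable_bound[OF intR])
      show "AE x in lebesgue. norm ((norm (k x))\<^sup>2) \<le> norm (R\<^sup>2 * (norm (\<psi> x))\<^sup>2)"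
        using k2 by (intro AE_I2) simp
    qed (use km in auto)
    have "(norm (toL2 k))\<^sup>2 \<le> (LINT x|lebesgue. R\<^sup>2 * (norm (\<psi> x))\<^sup>2)"
      unfolding norm_toL2[OF sqk] using sqk intR k2
      by (intro integral_mono) (auto simp: square_integrable_def)
    also have "\<dots> = (R * norm (toL2 \<psi>))\<^sup>2"
      by (simp add: norm_toL2[OF sq(2)] power_mult_distrib)
    finally have nk: "norm (toL2 k) \<le> R * norm (toL2 \<psi>)"
      by (rule power2_le_imp_le) (simp add: R(1))
    \<comment> \<open>\<open>(x \<bullet> e) \<phi>^2\<close>, bracketed as a test function times a
      continuously differentiable one; its derivative along \<open>e\<close> is
      \<open>\<phi>^2\<close> plus twice \<open>\<phi> k\<close>.\<close>
    have t2: "testfun \<Omega> (\<lambda>x. \<phi> x * (\<phi> x * (x \<bullet> e)))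
        (\<lambda>x. \<phi> x *\<^sub>R (\<phi> x *\<^sub>R e + (x \<bullet> e) *\<^sub>R \<psi> x) + (\<phi> x * (x \<bullet> e)) *\<^sub>R \<psi> x)"
      by (rule testfun_mult[OF t C1_grad_mult[OF C1 C1_grad_inner]])
    have pt: "(\<phi> x *\<^sub>R (\<phi> x *\<^sub>R e + (x \<bullet> e) *\<^sub>R \<psi> x) + (\<phi> x * (x \<bullet> e)) *\<^sub>R \<psi> x) \<bullet> e
        = \<phi> x \<bullet> \<phi> x + 2 * (\<phi> x \<bullet> k x)" for x
      using e by (simp add: k_def inner_simps inner_same_Basis algebra_simps)
    have "0 = (LINT x|lborel. \<phi> x \<bullet> \<phi> x + 2 * (\<phi> x \<bullet> k x))"
      using integral_grad_testfun[OF t2, of e] unfolding pt by simp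
    also have "\<dots> = (LINT x|lebesgue. \<phi> x \<bullet> \<phi> x + 2 * (\<phi> x \<bullet> k x))"
      by (intro integral_completion[symmetric])
        (auto intro!: borel_measurable_continuous_onI continuous_intros cont kc)
    also have "\<dots> = toL2 \<phi> \<bullet> toL2 \<phi> + 2 * (toL2 \<phi> \<bullet> toL2 k)"
      using square_integrable_inner[OF sq(1) sq(1)] square_integrable_inner[OF sq(1) sqk]
      by (simp add: inner_toL2 sq sqk del: inner_real_def)
    finally have "(norm (toL2 \<phi>))\<^sup>2 = 2 * - (toL2 \<phi> \<bullet> toL2 k)"
      by (simp add: power2_norm_eq_inner)
    also have "\<dots> \<le> 2 * (norm (toL2 \<phi>) * norm (toL2 k))"
      using Cauchy_Schwarz_ineq2[of "toL2 \<phi>" "toL2 k"] by simp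
    also have "\<dots> \<le> 2 * (norm (toL2 \<phi>) * (R * norm (toL2 \<psi>)))"
      using nk by (intro mult_left_mono) auto
    finally have *: "norm (toL2 \<phi>) * norm (toL2 \<phi>) \<le> norm (toL2 \<phi>) * (2 * R * norm (toL2 \<psi>))"
      by (simp add: power2_eq_square mult_ac)
    show ?thesis
    proof (cases "norm (toL2 \<phi>) = 0")
      case True
      then show ?thesis using R(1) by simp
    next
      case False
      then show ?thesis using * by (simp add: mult_le_cancel_left)
    qed
  qed
  show ?thesis
  proof (rule that[of "2 * R"])
    show "norm (fst s) \<le> 2 * R * norm (snd s)" if "s \<in> H1_space" for s
      by (rule H1_space_induct[OF _ _ that])
         (auto intro!: closed_Collect_le continuous_intros le)
  qed (use R in simp)
qed

text \<open>A function on \<open>\<Omega>\<close> that is orthogonal to all polynomials is orthogonal to all continuous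
  functions, hence, by approximating its sign, vanishes almost everywhere.\<close>

lemma orthogonal_polynomials_imp_zero:
  assumes g: "square_integrable (zero_ext \<Omega> g)"
    and orth: "\<And>p e. real_polynomial_function p \<Longrightarrow>
      toL2 (zero_ext \<Omega> g) \<bullet> toL2 (zero_ext \<Omega> (\<lambda>x. p x *\<^sub>R e)) = 0"
  shows "toL2 (zero_ext \<Omega> g) = (0 :: ('d, 'd) L2)"
proof -
  have sq: "square_integrable (zero_ext \<Omega> h)" if "continuous_on UNIV h"
    for h :: "'d \<Rightarrow> 'b::euclidean_space"
    by (rule square_integrable_zero_ext_continuous[OF open_\<Omega> bounded_\<Omega> that])
  \<comment> \<open>The norm of the indicator of \<open>\<Omega>\<close>, meaningful because
    \<open>\<Omega>\<close> is bounded; it converts uniform bounds on \<open>\<Omega>\<close> into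
    norm bounds.\<close>
  define m where "m = norm (toL2 (zero_ext \<Omega> (\<lambda>x. 1 :: real)))"
  have sup: "norm (toL2 (zero_ext \<Omega> h)) \<le> \<epsilon> * norm e * m"
    if h: "continuous_on UNIV h" "\<And>x. x \<in> \<Omega> \<Longrightarrow> norm (h x) \<le> \<epsilon> * norm e" and \<epsilon>: "\<epsilon> \<ge> 0"
    for h :: "'d \<Rightarrow> 'd" and \<epsilon> and e :: 'd
  proof -
    have one: "square_integrable (zero_ext \<Omega> (\<lambda>x. 1 :: real))"
      by (rule sq) simp
    have "(norm (toL2 (zero_ext \<Omega> h)))\<^sup>2 = (LINT x|lebesgue. (norm (zero_ext \<Omega> h x))\<^sup>2)"
      by (rule norm_toL2[OF sq[OF h(1)]])
    also have "\<dots> \<le> (LINT x|lebesgue. (\<epsilon> * norm e)\<^sup>2 * (norm (zero_ext \<Omega> (\<lambda>x. 1 :: real) x))\<^sup>2)"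
    proof (rule integral_mono)
      show "integrable lebesgue (\<lambda>x. (norm (zero_ext \<Omega> h x))\<^sup>2)"
        using sq[OF h(1)] by (simp add: square_integrable_def)
      show "integrable lebesgue (\<lambda>x. (\<epsilon> * norm e)\<^sup>2 * (norm (zero_ext \<Omega> (\<lambda>x. 1 :: real) x))\<^sup>2)"
        using one by (intro integrable_mult_right) (simp add: square_integrable_def)
      show "(norm (zero_ext \<Omega> h x))\<^sup>2 \<le> (\<epsilon> * norm e)\<^sup>2 * (norm (zero_ext \<Omega> (\<lambda>x. 1 :: real) x))\<^sup>2" for x
        using power_mono[OF h(2)[of x], of 2] by (auto simp: zero_ext_def)
    qed
    also have "\<dots> = (\<epsilon> * norm e * m)\<^sup>2"
      by (simp add: m_def norm_toL2[OF one] power_mult_distrib)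
    finally show ?thesis
      by (rule power2_le_imp_le) (simp add: \<epsilon> m_def)
  qed
  have cont_orth: "(LINT x|lebesgue_on \<Omega>. g x \<bullet> (h x *\<^sub>R e)) = 0"
    if h: "continuous_on UNIV h" for h :: "'d \<Rightarrow> real" and e :: 'd
  proof -
    let ?y = "toL2 (zero_ext \<Omega> g)"
    have ch: "continuous_on UNIV (\<lambda>x. h x *\<^sub>R e)"
      using h by (intro continuous_intros)
    have bound: "\<bar>?y \<bullet> toL2 (zero_ext \<Omega> (\<lambda>x. h x *\<^sub>R e))\<bar> \<le> norm ?y * norm e * m * \<epsilon>" if "\<epsilon> > 0" for \<epsilon>
    proof -
      have "compact (closure \<Omega>)" using bounded_\<Omega> by simp
      then obtain p where p: "polynomial_function p" "\<And>x. x \<in> closure \<Omega> \<Longrightarrow> norm (h x - p x) < \<epsilon>"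
        using Stone_Weierstrass_polynomial_function[of "closure \<Omega>" h \<epsilon>] h \<open>\<epsilon> > 0\<close>
        by (auto intro: continuous_on_subset)
      have rp: "real_polynomial_function p"
        using p(1) by (simp add: real_polynomial_function_eq)
      then have cp: "continuous_on UNIV p"
        using continuous_on_polymonial_function real_polynomial_function_eq by blast
      have cpe: "continuous_on UNIV (\<lambda>x. p x *\<^sub>R e)"
        using cp by (intro continuous_intros)
      have chp: "continuous_on UNIV (\<lambda>x. h x *\<^sub>R e - p x *\<^sub>R e)"
        by (intro continuous_intros ch cpe)
      have "?y \<bullet> toL2 (zero_ext \<Omega> (\<lambda>x. h x *\<^sub>R e)) = ?y \<bullet> toL2 (zero_ext \<Omega> (\<lambda>x. h x *\<^sub>R e - p x *\<^sub>R e))"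
        using orth[OF rp, of e] by (simp add: zero_ext_diff toL2_diff sq[OF ch] sq[OF cpe] inner_diff_right)
      also have "\<bar>\<dots>\<bar> \<le> norm ?y * norm (toL2 (zero_ext \<Omega> (\<lambda>x. h x *\<^sub>R e - p x *\<^sub>R e)))"
        by (rule Cauchy_Schwarz_ineq2)
      also have "\<dots> \<le> norm ?y * (\<epsilon> * norm e * m)"
      proof (intro mult_left_mono sup[OF chp])
        fix x assume "x \<in> \<Omega>"
        then have "norm (h x - p x) \<le> \<epsilon>" using p(2)[of x] closure_subset by force
        then show "norm (h x *\<^sub>R e - p x *\<^sub>R e) \<le> \<epsilon> * norm e"
          by (simp add: scaleR_diff_left[symmetric] mult_right_mono)
      qed (use \<open>\<epsilon> > 0\<close> in auto)
      finally show ?thesis by (simp add: mult_ac)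
    qed
    have "\<bar>?y \<bullet> toL2 (zero_ext \<Omega> (\<lambda>x. h x *\<^sub>R e))\<bar> \<le> 0"
    proof (rule field_le_epsilon)
      fix \<delta> :: real assume "\<delta> > 0"
      define c where "c = norm ?y * norm e * m"
      have "c \<ge> 0" by (simp add: c_def m_def)
      then have "c * (\<delta> / (c + 1)) \<le> \<delta>" using \<open>\<delta> > 0\<close> by (simp add: field_simps)
      moreover have "\<delta> / (c + 1) > 0" using \<open>c \<ge> 0\<close> \<open>\<delta> > 0\<close> by simp
      ultimately show "\<bar>?y \<bullet> toL2 (zero_ext \<Omega> (\<lambda>x. h x *\<^sub>R e))\<bar> \<le> 0 + \<delta>"
        using bound[of "\<delta> / (c + 1)"] by (simp add: c_def)
    qed
    then show ?thesis by (simp add: inner_zero_ext(1)[OF g sq[OF ch]])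
  qed
  have "AE x in lebesgue_on \<Omega>. g x \<bullet> e = 0" for e
  proof -
    define k where "k = (\<lambda>x. g x \<bullet> e)"
    have gm[measurable]: "g \<in> borel_measurable (lebesgue_on \<Omega>)"
      using g by (simp add: square_integrable_zero_ext)
    have km[measurable]: "k \<in> borel_measurable (lebesgue_on \<Omega>)"
      unfolding k_def by measurable
    \<comment> \<open>On a bounded set constants are square-integrable, so pairing with the constant
      \<open>e\<close> shows that \<open>k\<close> is integrable.\<close>
    have kint: "integrable (lebesgue_on \<Omega>) k"
      unfolding k_def by (rule inner_zero_ext(2)[OF g sq]) simp
    have "zero_ext \<Omega> (\<lambda>x. sgn (k x)) \<in> borel_measurable lebesgue"
      unfolding zero_ext_measurable by measurable
    \<comment> \<open>This notion of measurability supplies continuous functions converging to the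
      sign of \<open>k\<close> off a negligible set.\<close>
    then have "(zero_ext \<Omega> (\<lambda>x. sgn (k x))) measurable_on UNIV"
      by (rule lebesgue_measurable_imp_measurable_on) simp
    then obtain N h where N: "negligible N" and h: "\<And>n. continuous_on UNIV (h n)"
      "\<And>x. x \<notin> N \<Longrightarrow> (\<lambda>n. h n x) \<longlonglongrightarrow> zero_ext \<Omega> (\<lambda>x. sgn (k x)) x"
      by (auto simp: measurable_on_def)
    \<comment> \<open>Clipping to \<open>[-1, 1]\<close> keeps continuity and the limit, and
      provides the majorant \<open>\<bar>k\<bar>\<close> for dominated convergence.\<close>
    define c where "c n x = max (-1) (min 1 (h n x))" for n x
    have cc: "continuous_on UNIV (c n)" for n
      unfolding c_def by (intro continuous_intros h)
    have c1: "\<bar>c n x\<bar> \<le> 1" for n x by (auto simp: c_def)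
    have cm: "c n \<in> borel_measurable (lebesgue_on \<Omega>)" for n
      using continuous_imp_measurable_on_sets_lebesgue[OF continuous_on_subset[OF cc] sets_\<Omega>] by simp
    have AE_N: "AE x in lebesgue_on \<Omega>. x \<notin> N"
      using N by (subst AE_restrict_space_iff) (auto simp: negligible_iff_null_sets dest: AE_not_in)
    have "(\<lambda>n. LINT x|lebesgue_on \<Omega>. k x * c n x) \<longlonglongrightarrow> (LINT x|lebesgue_on \<Omega>. \<bar>k x\<bar>)"
    proof (rule integral_dominated_convergence[where w = "\<lambda>x. \<bar>k x\<bar>"])
      show "AE x in lebesgue_on \<Omega>. (\<lambda>n. k x * c n x) \<longlonglongrightarrow> \<bar>k x\<bar>"
        using AE_N AE_space
      proof eventually_elim
        case (elim x)
        then have "x \<in> \<Omega>" by (simp add: space_restrict_space)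
        then have "(\<lambda>n. h n x) \<longlonglongrightarrow> sgn (k x)" using h(2)[OF elim(1)] by (simp add: zero_ext_def)
        then have "(\<lambda>n. k x * c n x) \<longlonglongrightarrow> k x * max (-1) (min 1 (sgn (k x)))"
          unfolding c_def by (intro tendsto_intros)
        also have "k x * max (-1) (min 1 (sgn (k x))) = \<bar>k x\<bar>" by (auto simp: sgn_if)
        finally show ?case .
      qed
      show "AE x in lebesgue_on \<Omega>. norm (k x * c n x) \<le> \<bar>k x\<bar>" for n
        using c1[of n] by (intro AE_I2) (simp add: abs_mult mult_left_le)
      show "(\<lambda>x. k x * c n x) \<in> borel_measurable (lebesgue_on \<Omega>)" for n
        using km cm by (rule borel_measurable_times)
    qed (use kint in auto)
    moreover have "(LINT x|lebesgue_on \<Omega>. k x * c n x) = 0" for n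
      using cont_orth[OF cc, of n e] by (simp add: k_def mult.commute)
    ultimately have "(LINT x|lebesgue_on \<Omega>. \<bar>k x\<bar>) = 0"
      by (simp add: LIMSEQ_const_iff)
    then have "AE x in lebesgue_on \<Omega>. \<bar>k x\<bar> = 0"
      using kint by (subst (asm) integral_nonneg_eq_0_iff_AE) auto
    then show ?thesis by (simp add: k_def)
  qed
  then have "AE x in lebesgue_on \<Omega>. \<forall>e\<in>Basis. g x \<bullet> e = 0"
    by (intro AE_finite_allI) auto
  then have "AE x in lebesgue_on \<Omega>. g x = 0"
    by eventually_elim (auto intro: euclidean_eqI)
  then have "AE x in lebesgue. zero_ext \<Omega> g x = zero_ext \<Omega> (\<lambda>x. 0) x"
    by (simp add: AE_zero_ext_iff)
  then have "toL2 (zero_ext \<Omega> g) = toL2 (zero_ext \<Omega> (\<lambda>x. 0))"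
    by (subst toL2_eq_iff[OF g sq]) auto
  also have "zero_ext \<Omega> (\<lambda>x. 0 :: 'd) = (\<lambda>x. 0)" by (auto simp: zero_ext_def)
  finally show ?thesis by (simp add: toL2_zero)
qed

text \<open>For the difference of the two pairs the first component is zero, so integration by
  parts, extended to the closure, makes its second component orthogonal to every
  \<open>p x *\<^sub>R e\<close> with \<open>p\<close> a polynomial.\<close>

lemma H1_space_grad_unique:
  assumes s: "s \<in> H1_space" and s': "s' \<in> H1_space" and eq: "fst s = fst s'"
  shows "s = s'"
proof -
  have "s - s' \<in> H1_space" by (rule subspace_diff[OF subspace_H1_space s s'])
  then obtain u g where pair: "H01_pair \<Omega> u g" and ug: "s - s' = (toL2 (zero_ext \<Omega> u), toL2 (zero_ext \<Omega> g))"
    by (rule H1_space_cases)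
  have "toL2 (zero_ext \<Omega> g) = 0"
  proof (rule orthogonal_polynomials_imp_zero)
    show "square_integrable (zero_ext \<Omega> g)" using pair by (simp add: H01_pair_iff)
    fix p :: "'d \<Rightarrow> real" and e :: 'd
    assume "real_polynomial_function p"
    then obtain p' where p': "C1_grad p p'" using C1_grad_real_polynomial by blast
    have "fst (s - s') \<bullet> toL2 (zero_ext \<Omega> (\<lambda>x. p' x \<bullet> e)) + snd (s - s') \<bullet> toL2 (zero_ext \<Omega> (\<lambda>x. p x *\<^sub>R e)) = 0"
      by (rule H1_space_induct[OF _ _ \<open>s - s' \<in> H1_space\<close>])
         (auto intro!: closed_Collect_eq continuous_intros
            testfun_integration_by_parts[OF open_\<Omega> bounded_\<Omega> _ p'])
    then show "toL2 (zero_ext \<Omega> g) \<bullet> toL2 (zero_ext \<Omega> (\<lambda>x. p x *\<^sub>R e)) = 0"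
      using eq ug by (simp add: prod_eq_iff)
  qed
  then show ?thesis using ug eq by (simp add: prod_eq_iff)
qed

end

section \<open>Functions in the Sobolev space as elements of the closure\<close>

context bounded_open
begin

definition embed :: "('d \<Rightarrow> real) \<Rightarrow> ('d, real) L2 \<times> ('d, 'd) L2" where
  "embed u = (toL2 (zero_ext \<Omega> u), toL2 (zero_ext \<Omega> (wgrad \<Omega> u)))"

lemma H01_pair_wgrad: "u \<in> H01 \<Omega> \<Longrightarrow> H01_pair \<Omega> u (wgrad \<Omega> u)"
  unfolding H01_def wgrad_def by (simp add: someI_ex[of "H01_pair \<Omega> u"])

lemma embed_in_H1_space: "u \<in> H01 \<Omega> \<Longrightarrow> embed u \<in> H1_space"
  using H01_pair_wgrad[of u] by (simp add: H01_pair_iff embed_def)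

lemma square_integrable_H01:
  assumes "u \<in> H01 \<Omega>"
  shows "square_integrable (zero_ext \<Omega> u)" "square_integrable (zero_ext \<Omega> (wgrad \<Omega> u))"
  using H01_pair_wgrad[OF assms] by (auto simp: H01_pair_iff)

text \<open>\<open>wgrad\<close> is an arbitrary choice, so nothing about it can be computed
  directly. Instead a candidate pair with the right first component is exhibited, and uniqueness of
  the gradient identifies it with the chosen one; linearity of \<open>embed\<close> follows in this
  way.\<close>

lemma H01I:
  assumes "square_integrable (zero_ext \<Omega> u)" "s \<in> H1_space" "fst s = toL2 (zero_ext \<Omega> u)"
  shows "u \<in> H01 \<Omega> \<and> embed u = s"
proof -
  obtain u' g where pair: "H01_pair \<Omega> u' g" and s: "s = (toL2 (zero_ext \<Omega> u'), toL2 (zero_ext \<Omega> g))"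
    using assms(2) by (rule H1_space_cases)
  have "H01_pair \<Omega> u g"
    using pair assms s by (auto simp: H01_pair_iff)
  then have "u \<in> H01 \<Omega>" by (auto simp: H01_def)
  moreover from this have "embed u = s"
    using assms by (intro H1_space_grad_unique embed_in_H1_space) (simp_all add: embed_def)
  ultimately show ?thesis by simp
qed

lemma embed_surj:
  assumes "s \<in> H1_space"
  shows "\<exists>u\<in>H01 \<Omega>. embed u = s"
proof -
  obtain u g where "H01_pair \<Omega> u g" and s: "s = (toL2 (zero_ext \<Omega> u), toL2 (zero_ext \<Omega> g))"
    using assms by (rule H1_space_cases)
  with assms H01I[of u s] show ?thesis by (auto simp: H01_pair_iff)
qed

lemma embed_add:
  assumes u: "u \<in> H01 \<Omega>" and v: "v \<in> H01 \<Omega>"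
  shows "(\<lambda>x. u x + v x) \<in> H01 \<Omega> \<and> embed (\<lambda>x. u x + v x) = embed u + embed v"
proof (rule H01I)
  show "square_integrable (zero_ext \<Omega> (\<lambda>x. u x + v x))"
    unfolding zero_ext_add by (intro square_integrable_add square_integrable_H01 u v)
  show "embed u + embed v \<in> H1_space"
    by (intro subspace_add[OF subspace_H1_space] embed_in_H1_space u v)
  show "fst (embed u + embed v) = toL2 (zero_ext \<Omega> (\<lambda>x. u x + v x))"
    by (simp add: embed_def zero_ext_add toL2_add square_integrable_H01 u v)
qed

lemma embed_scale:
  assumes u: "u \<in> H01 \<Omega>"
  shows "(\<lambda>x. c * u x) \<in> H01 \<Omega> \<and> embed (\<lambda>x. c * u x) = c *\<^sub>R embed u"
proof (rule H01I)
  have eq: "zero_ext \<Omega> (\<lambda>x. c * u x) = (\<lambda>x. c *\<^sub>R zero_ext \<Omega> u x)"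
    by (auto simp: zero_ext_def)
  show "square_integrable (zero_ext \<Omega> (\<lambda>x. c * u x))"
    unfolding eq by (intro square_integrable_scaleR square_integrable_H01 u)
  show "c *\<^sub>R embed u \<in> H1_space"
    by (intro subspace_scale[OF subspace_H1_space] embed_in_H1_space u)
  show "fst (c *\<^sub>R embed u) = toL2 (zero_ext \<Omega> (\<lambda>x. c * u x))"
    unfolding eq by (simp only: toL2_scaleR square_integrable_H01 u embed_def fst_scaleR fst_conv)
qed

lemma embed_diff:
  assumes u: "u \<in> H01 \<Omega>" and v: "v \<in> H01 \<Omega>"
  shows "(\<lambda>x. u x - v x) \<in> H01 \<Omega> \<and> embed (\<lambda>x. u x - v x) = embed u - embed v"
  using embed_add[OF u conjunct1[OF embed_scale[OF v, of "-1"]]] embed_scale[OF v, of "-1"] by simp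

lemma embed_sum:
  assumes "finite A" "\<And>i. i \<in> A \<Longrightarrow> f i \<in> H01 \<Omega>"
  shows "(\<lambda>x. \<Sum>i\<in>A. f i x) \<in> H01 \<Omega> \<and> embed (\<lambda>x. \<Sum>i\<in>A. f i x) = (\<Sum>i\<in>A. embed (f i))"
  using assms
proof (induction A rule: finite_induct)
  case empty
  obtain u where "u \<in> H01 \<Omega>" using embed_surj[OF subspace_0[OF subspace_H1_space]] by blast
  then show ?case using embed_scale[of u 0] by simp
next
  case (insert i A)
  then show ?case using embed_add[of "f i" "\<lambda>x. \<Sum>i\<in>A. f i x"] by simp
qed

lemma L2inner_embed:
  assumes "u \<in> H01 \<Omega>" "v \<in> H01 \<Omega>"
  shows "L2inner \<Omega> u v = fst (embed u) \<bullet> fst (embed v)"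
  using inner_zero_ext(1)[of u v] assms by (simp add: L2inner_def embed_def square_integrable_H01)

lemma norm_wgrad:
  assumes "u \<in> H01 \<Omega>"
  shows "(LINT x|lebesgue_on \<Omega>. (norm (wgrad \<Omega> u x))\<^sup>2) = (norm (snd (embed u)))\<^sup>2"
  using inner_zero_ext(1)[of "wgrad \<Omega> u" "wgrad \<Omega> u"] assms
  by (simp add: embed_def square_integrable_H01 power2_norm_eq_inner)

lemma embed_eq_AE:
  assumes "u \<in> H01 \<Omega>" "v \<in> H01 \<Omega>" "embed u = embed v"
  shows "AE x in lebesgue_on \<Omega>. u x = v x"
  using assms toL2_eq_iff[of "zero_ext \<Omega> u" "zero_ext \<Omega> v"]
  by (simp add: embed_def square_integrable_H01 AE_zero_ext_iff)

end

section \<open>The energy form and the Green operator\<close>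

locale schroedinger = bounded_open \<Omega> for \<Omega> :: "'d::euclidean_space set" +
  fixes V :: "'d \<Rightarrow> real"
  assumes admissible: "admissible_potential \<Omega> V"
begin

lemma V_integrable:
  "u \<in> H01 \<Omega> \<Longrightarrow> v \<in> H01 \<Omega> \<Longrightarrow> integrable (lebesgue_on \<Omega>) (\<lambda>x. V x * u x * v x)"
  using admissible by (simp add: admissible_potential_def)

lemma aform_embed:
  assumes "u \<in> H01 \<Omega>" "v \<in> H01 \<Omega>"
  shows "aform \<Omega> V u v = snd (embed u) \<bullet> snd (embed v) + (LINT x|lebesgue_on \<Omega>. V x * u x * v x)"
  unfolding aform_def using inner_zero_ext[of "wgrad \<Omega> u" "wgrad \<Omega> v"] assms V_integrable[OF assms]
  by (simp add: embed_def square_integrable_H01)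

lemma aform_sym:
  assumes "u \<in> H01 \<Omega>" "v \<in> H01 \<Omega>"
  shows "aform \<Omega> V u v = aform \<Omega> V v u"
  using assms by (simp add: aform_embed inner_commute mult_ac)

text \<open>The potential enters through integrability of \<open>V u v\<close> alone and not as an
  inner product of classes, so independence of the representative is argued with almost-everywhere
  equality under the integral.\<close>

lemma aform_cong_left:
  assumes u: "u \<in> H01 \<Omega>" "u' \<in> H01 \<Omega>" "embed u = embed u'" and v: "v \<in> H01 \<Omega>"
  shows "aform \<Omega> V u v = aform \<Omega> V u' v"
proof -
  have "(LINT x|lebesgue_on \<Omega>. V x * u x * v x) = (LINT x|lebesgue_on \<Omega>. V x * u' x * v x)"
    using embed_eq_AE[OF u] V_integrable[OF u(1) v] V_integrable[OF u(2) v]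
    by (intro integral_cong_AE) (auto intro: borel_measurable_integrable)
  then show ?thesis using assms by (simp add: aform_embed)
qed

text \<open>The energy form read off from chosen representatives. It is meaningful only on
  \<open>H1_space\<close>, where \<open>form_embed\<close> shows that the choice does not
  matter.\<close>

definition form :: "('d, real) L2 \<times> ('d, 'd) L2 \<Rightarrow> ('d, real) L2 \<times> ('d, 'd) L2 \<Rightarrow> real" where
  "form s s' = aform \<Omega> V (SOME u. u \<in> H01 \<Omega> \<and> embed u = s) (SOME u. u \<in> H01 \<Omega> \<and> embed u = s')"

lemma form_embed:
  assumes u: "u \<in> H01 \<Omega>" and v: "v \<in> H01 \<Omega>"
  shows "form (embed u) (embed v) = aform \<Omega> V u v"
proof -
  define u' where "u' = (SOME w. w \<in> H01 \<Omega> \<and> embed w = embed u)"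
  define v' where "v' = (SOME w. w \<in> H01 \<Omega> \<and> embed w = embed v)"
  have u': "u' \<in> H01 \<Omega> \<and> embed u' = embed u"
    unfolding u'_def by (rule someI[of _ u]) (simp add: u)
  have v': "v' \<in> H01 \<Omega> \<and> embed v' = embed v"
    unfolding v'_def by (rule someI[of _ v]) (simp add: v)
  have "form (embed u) (embed v) = aform \<Omega> V u' v'"
    by (simp add: form_def u'_def v'_def)
  also have "\<dots> = aform \<Omega> V u v'"
    using u' v' u by (intro aform_cong_left) auto
  also have "\<dots> = aform \<Omega> V u v"
    using u' v' u v aform_cong_left[of v' v u] by (simp add: aform_sym[of u])
  finally show ?thesis .
qed

lemma coercive_form: obtains c C where "coercive_form H1_space form c C"
proof -
  obtain P where P: "P \<ge> 0" "\<And>s. s \<in> H1_space \<Longrightarrow> norm (fst s) \<le> P * norm (snd s)"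
    by (rule Poincare) blast
  obtain c1 c2 where c: "c1 > 0" "c2 > 0"
    and bounds: "\<And>u. u \<in> H01 \<Omega> \<Longrightarrow> c1 * (norm (snd (embed u)))\<^sup>2 \<le> aform \<Omega> V u u"
      "\<And>u. u \<in> H01 \<Omega> \<Longrightarrow> aform \<Omega> V u u \<le> c2 * (norm (snd (embed u)))\<^sup>2"
    using admissible unfolding admissible_potential_def by (auto simp: norm_wgrad)
  \<comment> \<open>By the Poincare inequality the squared norm of a pair is at most
    \<open>P^2 + 1\<close> times that of its gradient part; the coercivity constant loses this
    factor.\<close>
  define c where "c = c1 / (P\<^sup>2 + 1)"
  have "P\<^sup>2 + 1 > 0" by (simp add: add_nonneg_pos)
  have norm2: "(norm s)\<^sup>2 = (norm (fst s))\<^sup>2 + (norm (snd s))\<^sup>2"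
    for s :: "('d, real) L2 \<times> ('d, 'd) L2"
    by (cases s) (simp add: norm_Pair)
  show ?thesis
  proof (rule that, unfold_locales)
    show "closed H1_space" by (rule closed_H1_space)
    show "subspace H1_space" by (rule subspace_H1_space)
    show "c > 0" using c \<open>P\<^sup>2 + 1 > 0\<close> by (simp add: c_def)
  next
    fix x y z assume "x \<in> H1_space" "y \<in> H1_space" "z \<in> H1_space"
    then obtain u v w where uvw: "u \<in> H01 \<Omega>" "v \<in> H01 \<Omega>" "w \<in> H01 \<Omega>"
      and eq: "embed u = x" "embed v = y" "embed w = z"
      by (metis embed_surj)
    have "aform \<Omega> V (\<lambda>x. u x + v x) w = aform \<Omega> V u w + aform \<Omega> V v w"
    proof -
      have "(LINT x|lebesgue_on \<Omega>. V x * (u x + v x) * w x)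
          = (LINT x|lebesgue_on \<Omega>. V x * u x * w x) + (LINT x|lebesgue_on \<Omega>. V x * v x * w x)"
        unfolding distrib_left distrib_right
        by (intro Bochner_Integration.integral_add V_integrable uvw)
      then show ?thesis
        using uvw embed_add[OF uvw(1,2)] by (simp add: aform_embed inner_add_left)
    qed
    then show "form (x + y) z = form x z + form y z"
      using uvw embed_add[OF uvw(1,2)] form_embed by (metis eq)
  next
    fix r x y assume "x \<in> H1_space" "y \<in> H1_space"
    then obtain u v where uv: "u \<in> H01 \<Omega>" "v \<in> H01 \<Omega>" and eq: "embed u = x" "embed v = y"
      by (metis embed_surj)
    have "aform \<Omega> V (\<lambda>x. r * u x) v = r * aform \<Omega> V u v"
      using uv embed_scale[OF uv(1), of r] integral_mult_right_zero[of "lebesgue_on \<Omega>" r "\<lambda>x. V x * u x * v x"]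
      by (simp add: aform_embed distrib_left mult_ac)
    then show "form (r *\<^sub>R x) y = r * form x y"
      using uv embed_scale[OF uv(1), of r] form_embed by (metis eq)
    show "form x y = form y x"
      using uv form_embed aform_sym by (metis eq)
  next
    fix x assume "x \<in> H1_space"
    then obtain u where u: "u \<in> H01 \<Omega>" and x: "embed u = x" by (metis embed_surj)
    have "(norm (fst x))\<^sup>2 \<le> (P * norm (snd x))\<^sup>2"
      using P(2)[OF \<open>x \<in> H1_space\<close>] by (intro power_mono) auto
    then have "(norm x)\<^sup>2 \<le> (P\<^sup>2 + 1) * (norm (snd x))\<^sup>2"
      by (simp add: norm2 power_mult_distrib distrib_right)
    then have "c * (norm x)\<^sup>2 \<le> c * ((P\<^sup>2 + 1) * (norm (snd x))\<^sup>2)"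
      using c \<open>P\<^sup>2 + 1 > 0\<close> by (intro mult_left_mono) (auto simp: c_def)
    also have "\<dots> = c1 * (norm (snd x))\<^sup>2"
      using \<open>P\<^sup>2 + 1 > 0\<close> by (simp add: c_def)
    also have "\<dots> \<le> form x x"
      using bounds(1)[OF u] form_embed[OF u u] by (simp add: x)
    finally show "c * (norm x)\<^sup>2 \<le> form x x" .
    have "form x x \<le> c2 * (norm (snd x))\<^sup>2"
      using bounds(2)[OF u] form_embed[OF u u] by (simp add: x)
    also have "\<dots> \<le> c2 * (norm x)\<^sup>2"
      using c by (intro mult_left_mono) (auto simp: norm2)
    finally show "form x x \<le> c2 * (norm x)\<^sup>2" .
  qed
qed

lemma Hnorm_equivalence:
  obtains k K where "k > 0"
    "\<And>u. u \<in> H01 \<Omega> \<Longrightarrow> k * norm (embed u) \<le> Hnorm \<Omega> V u"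
    "\<And>u. u \<in> H01 \<Omega> \<Longrightarrow> Hnorm \<Omega> V u \<le> K * norm (embed u)"
proof -
  obtain c C where "coercive_form H1_space form c C" by (rule coercive_form)
  then interpret coercive_form H1_space form c C .
  show ?thesis
  proof (rule that[of "sqrt c" "sqrt C"])
    show "sqrt c > 0" using c_pos by simp
    fix u assume u: "u \<in> H01 \<Omega>"
    have "sqrt c * norm (embed u) = sqrt (c * (norm (embed u))\<^sup>2)"
      by (simp add: real_sqrt_mult)
    then show "sqrt c * norm (embed u) \<le> Hnorm \<Omega> V u"
      unfolding Hnorm_def using coercive[OF embed_in_H1_space[OF u]] form_embed[OF u u] by simp
    have "sqrt C * norm (embed u) = sqrt (C * (norm (embed u))\<^sup>2)"
      by (simp add: real_sqrt_mult)
    then show "Hnorm \<Omega> V u \<le> sqrt C * norm (embed u)"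
      unfolding Hnorm_def using bounded[OF embed_in_H1_space[OF u]] form_embed[OF u u] by simp
  qed
qed

text \<open>Membership is required only eventually, because solutions are constrained for
  nonnegative times alone and the limits run along one-sided filters.\<close>

lemma Hnorm_tendsto_0_iff:
  assumes "\<forall>\<^sub>F x in F. f x \<in> H01 \<Omega>"
  shows "((\<lambda>x. Hnorm \<Omega> V (f x)) \<longlongrightarrow> 0) F \<longleftrightarrow> ((\<lambda>x. norm (embed (f x))) \<longlongrightarrow> 0) F"
proof -
  obtain k K where k: "k > 0"
    "\<And>u. u \<in> H01 \<Omega> \<Longrightarrow> k * norm (embed u) \<le> Hnorm \<Omega> V u"
    "\<And>u. u \<in> H01 \<Omega> \<Longrightarrow> Hnorm \<Omega> V u \<le> K * norm (embed u)"
    by (rule Hnorm_equivalence) blast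
  have nonneg: "0 \<le> Hnorm \<Omega> V u" if "u \<in> H01 \<Omega>" for u
    using k(1) k(2)[OF that] by (meson mult_nonneg_nonneg norm_ge_zero order.trans less_imp_le)
  show ?thesis
  proof
    assume "((\<lambda>x. Hnorm \<Omega> V (f x)) \<longlongrightarrow> 0) F"
    then have lim: "((\<lambda>x. Hnorm \<Omega> V (f x) / k) \<longlongrightarrow> 0) F"
      by (rule tendsto_divide_zero)
    show "((\<lambda>x. norm (embed (f x))) \<longlongrightarrow> 0) F"
    proof (rule Lim_null_comparison[OF _ lim])
      show "\<forall>\<^sub>F x in F. norm (norm (embed (f x))) \<le> Hnorm \<Omega> V (f x) / k"
        using assms by eventually_elim (use k in \<open>simp add: field_simps\<close>)
    qed
  next
    assume "((\<lambda>x. norm (embed (f x))) \<longlongrightarrow> 0) F"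
    then have lim: "((\<lambda>x. K * norm (embed (f x))) \<longlongrightarrow> 0) F"
      by (rule tendsto_mult_right_zero)
    show "((\<lambda>x. Hnorm \<Omega> V (f x)) \<longlongrightarrow> 0) F"
    proof (rule Lim_null_comparison[OF _ lim])
      show "\<forall>\<^sub>F x in F. norm (Hnorm \<Omega> V (f x)) \<le> K * norm (embed (f x))"
        using assms by eventually_elim (use k nonneg in simp)
    qed
  qed
qed

lemma Hnorm_eq_0_iff:
  assumes "u \<in> H01 \<Omega>"
  shows "Hnorm \<Omega> V u = 0 \<longleftrightarrow> embed u = 0"
  using Hnorm_tendsto_0_iff[of "\<lambda>_. u" sequentially] assms by (simp add: LIMSEQ_const_iff)

lemma Hnorm_diff_eq_0_iff:
  assumes "u \<in> H01 \<Omega>" "v \<in> H01 \<Omega>"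
  shows "Hnorm \<Omega> V (\<lambda>x. u x - v x) = 0 \<longleftrightarrow> embed u = embed v"
  using embed_diff[OF assms] Hnorm_eq_0_iff by auto

text \<open>\<open>Gop\<close> is chosen among functions, but all solutions of the weak equation
  have the same image under \<open>embed\<close>, so the choice becomes a linear operator on
  pairs.\<close>

lemma Green_operator:
  obtains G where "bounded_linear G" "\<And>s. G s \<in> H1_space" "\<And>s. 0 \<le> fst (G s) \<bullet> fst s"
    "\<And>f. f \<in> H01 \<Omega> \<Longrightarrow> Gop \<Omega> V f \<in> H01 \<Omega> \<and> embed (Gop \<Omega> V f) = G (embed f)"
proof -
  obtain c C where "coercive_form H1_space form c C" by (rule coercive_form)
  then interpret coercive_form H1_space form c C .
  have b: "bounded_bilinear (\<lambda>s s' :: ('d, real) L2 \<times> ('d, 'd) L2. fst s \<bullet> fst s')"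
    by (rule bounded_bilinear.comp[OF bounded_bilinear_inner bounded_linear_fst bounded_linear_fst])
  obtain G :: "('d, real) L2 \<times> ('d, 'd) L2 \<Rightarrow> ('d, real) L2 \<times> ('d, 'd) L2"
    where G: "bounded_linear G" "\<And>f. G f \<in> H1_space"
    "\<And>f v. v \<in> H1_space \<Longrightarrow> form (G f) v = fst f \<bullet> fst v"
    using solution_operator[OF b] by blast
  show ?thesis
  proof (rule that[of G])
    show "bounded_linear G" by (rule G(1))
    show "G s \<in> H1_space" for s by (rule G(2))
    \<comment> \<open>Testing the weak equation of \<open>G s\<close> with \<open>G s\<close> itself
      turns this number into \<open>form (G s) (G s)\<close>.\<close>
    show "0 \<le> fst (G s) \<bullet> fst s" for s
      using nonneg[OF G(2)] G(3)[OF G(2), of s s] by (metis inner_commute)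
    fix f assume f: "f \<in> H01 \<Omega>"
    obtain w where w: "w \<in> H01 \<Omega>" "embed w = G (embed f)"
      using embed_surj[OF G(2)] by blast
    have "aform \<Omega> V w v = L2inner \<Omega> f v" if v: "v \<in> H01 \<Omega>" for v
      using form_embed[OF w(1) v] G(3)[OF embed_in_H1_space[OF v]] by (simp add: w(2) L2inner_embed f v)
    with w(1) have "w \<in> H01 \<Omega> \<and> (\<forall>v\<in>H01 \<Omega>. aform \<Omega> V w v = L2inner \<Omega> f v)" by blast
    then have Gop: "Gop \<Omega> V f \<in> H01 \<Omega> \<and> (\<forall>v\<in>H01 \<Omega>. aform \<Omega> V (Gop \<Omega> V f) v = L2inner \<Omega> f v)"
      unfolding Gop_def
      by (rule someI[of "\<lambda>w. w \<in> H01 \<Omega> \<and> (\<forall>v\<in>H01 \<Omega>. aform \<Omega> V w v = L2inner \<Omega> f v)"])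
    moreover have "embed (Gop \<Omega> V f) = G (embed f)"
    proof (rule eqI)
      fix s assume "s \<in> H1_space"
      then obtain v where v: "v \<in> H01 \<Omega>" "embed v = s" using embed_surj by blast
      show "form (embed (Gop \<Omega> V f)) s = form (G (embed f)) s"
        using Gop v f form_embed[of "Gop \<Omega> V f" v] G(3)[OF \<open>s \<in> H1_space\<close>]
        by (auto simp: L2inner_embed)
    qed (use Gop G in \<open>auto intro: embed_in_H1_space\<close>)
    ultimately show "Gop \<Omega> V f \<in> H01 \<Omega> \<and> embed (Gop \<Omega> V f) = G (embed f)" by blast
  qed
qed

end

section \<open>Transfer of the flow\<close>

text \<open>Connects the increment \<open>h\<close> ranging over \<open>{-t..}\<close> with the
  variable \<open>t + h\<close> ranging over \<open>{0..}\<close>: the two filters are translates of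
  each other, including the one-sided case \<open>t = 0\<close>.\<close>

lemma has_vector_derivative_iff_quotient:
  fixes f :: "real \<Rightarrow> 'a::real_normed_vector"
  shows "(f has_vector_derivative D) (at t within {0..}) \<longleftrightarrow>
    ((\<lambda>h. (f (t + h) - f t) /\<^sub>R h - D) \<longlongrightarrow> 0) (at 0 within {-t..})"
proof -
  have shift: "at t within {0..} = filtermap (\<lambda>h. t + h) (at 0 within {-t..})"
  proof (rule filter_eqI)
    fix P
    have "(\<exists>d>0. \<forall>x\<in>{0..}. x \<noteq> t \<and> dist x t < d \<longrightarrow> P x) \<longleftrightarrow>
        (\<exists>d>0. \<forall>h\<in>{-t..}. h \<noteq> 0 \<and> dist h 0 < d \<longrightarrow> P (t + h))"
    proof (intro ex_cong1 conj_cong refl iffI ballI impI)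
      fix d h assume "\<forall>x\<in>{0..}. x \<noteq> t \<and> dist x t < d \<longrightarrow> P x" "h \<in> {-t..}" "h \<noteq> 0 \<and> dist h 0 < d"
      then show "P (t + h)" by (auto simp: dist_real_def)
    next
      fix d x assume *: "\<forall>h\<in>{-t..}. h \<noteq> 0 \<and> dist h 0 < d \<longrightarrow> P (t + h)" "x \<in> {0..}" "x \<noteq> t \<and> dist x t < d"
      then show "P x" using bspec[OF *(1), of "x - t"] by (auto simp: dist_real_def)
    qed
    then show "eventually P (at t within {0..}) \<longleftrightarrow> eventually P (filtermap (\<lambda>h. t + h) (at 0 within {-t..}))"
      by (simp add: eventually_filtermap eventually_at)
  qed
  have "(f has_vector_derivative D) (at t within {0..}) \<longleftrightarrow>
      ((\<lambda>h. norm ((1 / norm h) *\<^sub>R (f (t + h) - (f t + h *\<^sub>R D)))) \<longlongrightarrow> 0) (at 0 within {-t..})"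
  proof -
    have "(f has_vector_derivative D) (at t within {0..}) \<longleftrightarrow>
        ((\<lambda>y. (1 / norm (y - t)) *\<^sub>R (f y - (f t + (y - t) *\<^sub>R D))) \<longlongrightarrow> 0) (at t within {0..})"
      by (simp only: has_vector_derivative_def has_derivative_within bounded_linear_scaleR_left simp_thms)
    then show ?thesis
      unfolding shift filterlim_filtermap by (simp only: tendsto_norm_zero_iff add_diff_cancel_left')
  qed
  also have "\<dots> \<longleftrightarrow> ((\<lambda>h. norm ((f (t + h) - f t) /\<^sub>R h - D)) \<longlongrightarrow> 0) (at 0 within {-t..})"
  proof (rule tendsto_cong)
    have "norm ((1 / norm h) *\<^sub>R (f (t + h) - (f t + h *\<^sub>R D))) = norm ((f (t + h) - f t) /\<^sub>R h - D)"
      if "h \<noteq> 0" for h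
    proof -
      have "f (t + h) - (f t + h *\<^sub>R D) = h *\<^sub>R ((f (t + h) - f t) /\<^sub>R h - D)"
        using that by (simp add: scaleR_diff_right)
      then show ?thesis using that by simp
    qed
    then show "\<forall>\<^sub>F h in at 0 within {-t..}. norm ((1 / norm h) *\<^sub>R (f (t + h) - (f t + h *\<^sub>R D)))
        = norm ((f (t + h) - f t) /\<^sub>R h - D)"
      by (auto simp: eventually_at_filter)
  qed
  finally show ?thesis by (simp add: tendsto_norm_zero_iff)
qed

lemma tendsto_zero_vec_iff:
  fixes f :: "'b \<Rightarrow> 'a::real_normed_vector ^ 'n"
  shows "(f \<longlongrightarrow> 0) F \<longleftrightarrow> (\<forall>i. ((\<lambda>x. norm (f x $ i)) \<longlongrightarrow> 0) F)"
proof
  assume "(f \<longlongrightarrow> 0) F"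
  then show "\<forall>i. ((\<lambda>x. norm (f x $ i)) \<longlongrightarrow> 0) F"
    using tendsto_vec_nth[of f 0 F] by (auto intro!: tendsto_norm_zero)
next
  assume "\<forall>i. ((\<lambda>x. norm (f x $ i)) \<longlongrightarrow> 0) F"
  then show "(f \<longlongrightarrow> 0) F"
    by (intro vec_tendstoI) (simp add: tendsto_norm_zero_iff)
qed

text \<open>Fixes one operator \<open>G\<close> with the properties established above, so that the
  pairing \<open>q\<close> and the field can be named in the following statements.\<close>

locale oja_transfer = schroedinger \<Omega> V for \<Omega> :: "'d::euclidean_space set" and V +
  fixes G :: "('d, real) L2 \<times> ('d, 'd) L2 \<Rightarrow> ('d, real) L2 \<times> ('d, 'd) L2"
  assumes G: "bounded_linear G" "\<And>s. G s \<in> H1_space" "\<And>s. 0 \<le> fst (G s) \<bullet> fst s"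
    and Gop: "\<And>f. f \<in> H01 \<Omega> \<Longrightarrow> Gop \<Omega> V f \<in> H01 \<Omega> \<and> embed (Gop \<Omega> V f) = G (embed f)"
begin

abbreviation q where "q s s' \<equiv> fst (G s) \<bullet> fst s'"

lemma bounded_bilinear_q: "bounded_bilinear q"
  by (rule bounded_bilinear.comp[OF bounded_bilinear_inner
        bounded_linear_compose[OF bounded_linear_fst G(1)] bounded_linear_fst])

definition embeds :: "('n::finite \<Rightarrow> 'd \<Rightarrow> real) \<Rightarrow> (('d, real) L2 \<times> ('d, 'd) L2) ^ 'n" where
  "embeds U = (\<chi> i. embed (U i))"

text \<open>The index order has to match: \<open>tmul\<close> sums over the first index of the Gram
  matrix, so \<open>U $ j\<close> receives the coefficient \<open>(G u_j, u_i)\<close>, as in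
  \<open>oja_cubic\<close>.\<close>

lemma embed_rhs:
  fixes U :: "'n::finite \<Rightarrow> 'd \<Rightarrow> real"
  assumes U: "\<And>i. U i \<in> H01 \<Omega>"
  defines "F \<equiv> \<lambda>i x. GT \<Omega> V U i x - tmul U (gram \<Omega> (GT \<Omega> V U) U) i x"
  shows "F i \<in> H01 \<Omega> \<and> embed (F i) = oja_field G q (embeds U) $ i"
proof -
  define A where "A = gram \<Omega> (GT \<Omega> V U) U"
  have A: "A j i = q (embed (U j)) (embed (U i))" for j
    using U Gop[of "U j"] by (simp add: A_def gram_def GT_def L2inner_embed)
  have sum: "tmul U A i \<in> H01 \<Omega> \<and> embed (tmul U A i) = (\<Sum>j\<in>UNIV. A j i *\<^sub>R embed (U j))"
    using embed_sum[of UNIV "\<lambda>j x. A j i * U j x"] embed_scale[OF U]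
    by (simp add: tmul_def mult.commute)
  have "F i = (\<lambda>x. Gop \<Omega> V (U i) x - tmul U A i x)"
    by (simp add: F_def A_def GT_def)
  then show ?thesis
    using embed_diff[of "Gop \<Omega> V (U i)" "tmul U A i"] Gop[OF U] sum
    by (simp add: oja_field_def oja_cubic_def embeds_def A)
qed

lemma quotient_iff:
  fixes U :: "real \<Rightarrow> 'n::finite \<Rightarrow> 'd \<Rightarrow> real"
  assumes U: "\<And>t i. t \<ge> 0 \<Longrightarrow> U t i \<in> H01 \<Omega>" and D: "\<And>i. D i \<in> H01 \<Omega>" and "t \<ge> 0"
  shows "(\<forall>i. ((\<lambda>h. Hnorm \<Omega> V (\<lambda>x. (U (t + h) i x - U t i x) / h - D i x)) \<longlongrightarrow> 0) (at 0 within {-t..}))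
    \<longleftrightarrow> ((\<lambda>t. embeds (U t)) has_vector_derivative embeds D) (at t within {0..})"
proof -
  have q: "(\<lambda>x. (U (t + h) i x - U t i x) / h - D i x) \<in> H01 \<Omega> \<and>
      embed (\<lambda>x. (U (t + h) i x - U t i x) / h - D i x)
        = ((embeds (U (t + h)) - embeds (U t)) /\<^sub>R h - embeds D) $ i" if "h \<ge> - t" for h i
  proof -
    have a: "U (t + h) i \<in> H01 \<Omega>" "U t i \<in> H01 \<Omega>" using U that \<open>t \<ge> 0\<close> by auto
    note d = embed_diff[OF a]
    note e = embed_scale[OF conjunct1[OF d], of "inverse h"]
    from embed_diff[OF conjunct1[OF e] D[of i]] d e show ?thesis
      by (simp add: embeds_def divide_inverse mult.commute)
  qed
  have ev: "\<forall>\<^sub>F h in at 0 within {-t..}. h \<ge> - t"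
    by (simp add: eventually_at_filter)
  have "((\<lambda>h. Hnorm \<Omega> V (\<lambda>x. (U (t + h) i x - U t i x) / h - D i x)) \<longlongrightarrow> 0) (at 0 within {-t..})
    \<longleftrightarrow> ((\<lambda>h. norm (((embeds (U (t + h)) - embeds (U t)) /\<^sub>R h - embeds D) $ i)) \<longlongrightarrow> 0) (at 0 within {-t..})" for i
  proof -
    have "((\<lambda>h. Hnorm \<Omega> V (\<lambda>x. (U (t + h) i x - U t i x) / h - D i x)) \<longlongrightarrow> 0) (at 0 within {-t..})
        \<longleftrightarrow> ((\<lambda>h. norm (embed (\<lambda>x. (U (t + h) i x - U t i x) / h - D i x))) \<longlongrightarrow> 0) (at 0 within {-t..})"
      by (rule Hnorm_tendsto_0_iff) (use ev in eventually_elim, use q in blast)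
    also have "\<dots> \<longleftrightarrow> ((\<lambda>h. norm (((embeds (U (t + h)) - embeds (U t)) /\<^sub>R h - embeds D) $ i)) \<longlongrightarrow> 0) (at 0 within {-t..})"
      by (rule tendsto_cong) (use ev in eventually_elim, simp only: q)
    finally show ?thesis .
  qed
  then show ?thesis
    unfolding has_vector_derivative_iff_quotient tendsto_zero_vec_iff by simp
qed

text \<open>In one direction the derivative demanded by \<open>is_solution\<close> agrees with the
  right-hand side up to norm zero and can be replaced by it. In the other, the right-hand side
  itself serves as derivative; its continuity in time comes from that of the field along the
  differentiable curve.\<close>

lemma is_solution_iff:
  fixes U :: "real \<Rightarrow> 'n::finite \<Rightarrow> 'd \<Rightarrow> real"
  assumes U0: "\<And>i. U0 i \<in> H01 \<Omega>"
  shows "is_solution \<Omega> V U0 U \<longleftrightarrow> (\<forall>t\<ge>0. \<forall>i. U t i \<in> H01 \<Omega>) \<and> embeds (U 0) = embeds U0 \<and>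
    (\<forall>t\<ge>0. ((\<lambda>t. embeds (U t)) has_vector_derivative oja_field G q (embeds (U t))) (at t within {0..}))"
proof (cases "\<forall>t\<ge>0. \<forall>i. U t i \<in> H01 \<Omega>")
  case False
  then show ?thesis by (auto simp: is_solution_def)
next
  case True
  then have U: "U t i \<in> H01 \<Omega>" if "t \<ge> 0" for t i using that by blast
  define F where "F t i = (\<lambda>x. GT \<Omega> V (U t) i x - tmul (U t) (gram \<Omega> (GT \<Omega> V (U t)) (U t)) i x)" for t i
  have F: "F t i \<in> H01 \<Omega>" "embeds (F t) = oja_field G q (embeds (U t))" if "t \<ge> 0" for t i
    using embed_rhs[of "U t", OF U[OF that]] by (simp_all add: F_def embeds_def vec_eq_iff)
  have init: "(\<forall>i. Hnorm \<Omega> V (\<lambda>x. U 0 i x - U0 i x) = 0) \<longleftrightarrow> embeds (U 0) = embeds U0"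
    using U[of 0] U0 by (simp add: Hnorm_diff_eq_0_iff embeds_def vec_eq_iff)
  show ?thesis
  proof
    assume "is_solution \<Omega> V U0 U"
    then obtain U' where "\<forall>t\<ge>0. \<forall>i. U' t i \<in> H01 \<Omega>"
      and "\<forall>t\<ge>0. \<forall>i. ((\<lambda>h. Hnorm \<Omega> V (\<lambda>x. (U (t + h) i x - U t i x) / h - U' t i x)) \<longlongrightarrow> 0) (at 0 within {-t..})"
      and "\<forall>t\<ge>0. \<forall>i. Hnorm \<Omega> V (\<lambda>x. U' t i x - F t i x) = 0"
      and init0: "\<forall>i. Hnorm \<Omega> V (\<lambda>x. U 0 i x - U0 i x) = 0"
      unfolding is_solution_def F_def by (elim conjE exE)
    then have U': "\<And>t i. t \<ge> 0 \<Longrightarrow> U' t i \<in> H01 \<Omega>"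
      and deriv: "\<And>t. t \<ge> 0 \<Longrightarrow> \<forall>i. ((\<lambda>h. Hnorm \<Omega> V (\<lambda>x. (U (t + h) i x - U t i x) / h - U' t i x)) \<longlongrightarrow> 0) (at 0 within {-t..})"
      and eq: "\<And>t i. t \<ge> 0 \<Longrightarrow> Hnorm \<Omega> V (\<lambda>x. U' t i x - F t i x) = 0"
      by simp_all
    have "embeds (U' t) = oja_field G q (embeds (U t))" if "t \<ge> 0" for t
      using eq[OF that] U'[OF that] F[OF that] unfolding F(2)[OF that, symmetric]
      by (simp add: embeds_def vec_eq_iff Hnorm_diff_eq_0_iff)
    then show "(\<forall>t\<ge>0. \<forall>i. U t i \<in> H01 \<Omega>) \<and> embeds (U 0) = embeds U0 \<and>
      (\<forall>t\<ge>0. ((\<lambda>t. embeds (U t)) has_vector_derivative oja_field G q (embeds (U t))) (at t within {0..}))"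
      using True init init0 deriv quotient_iff[of U, OF U U'] by auto
  next
    assume *: "(\<forall>t\<ge>0. \<forall>i. U t i \<in> H01 \<Omega>) \<and> embeds (U 0) = embeds U0 \<and>
      (\<forall>t\<ge>0. ((\<lambda>t. embeds (U t)) has_vector_derivative oja_field G q (embeds (U t))) (at t within {0..}))"
    have "continuous_on {0..} (\<lambda>t. embeds (U t))"
      using * by (intro continuous_on_vector_derivative) auto
    then have cont: "continuous_on {0..} (\<lambda>t. oja_field G q (embeds (U t)))"
      by (rule continuous_on_oja_field[OF G(1) bounded_bilinear_q])
    have lim: "((\<lambda>s. Hnorm \<Omega> V (\<lambda>x. F s i x - F t i x)) \<longlongrightarrow> 0) (at t within {0..})" if t: "t \<ge> 0" for t i
    proof -
      have ev: "\<forall>\<^sub>F s in at t within {0..}. s \<ge> 0" by (simp add: eventually_at_filter)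
      have "((\<lambda>s. oja_field G q (embeds (U s)) - oja_field G q (embeds (U t))) \<longlongrightarrow> 0) (at t within {0..})"
        using cont t by (intro LIM_zero) (simp add: continuous_on_def)
      then have lim: "((\<lambda>s. norm ((oja_field G q (embeds (U s)) - oja_field G q (embeds (U t))) $ i)) \<longlongrightarrow> 0) (at t within {0..})"
        by (simp add: tendsto_zero_vec_iff)
      have "((\<lambda>s. norm (embed (\<lambda>x. F s i x - F t i x))) \<longlongrightarrow> 0) (at t within {0..})"
      proof (rule Lim_transform_eventually[OF lim])
        show "\<forall>\<^sub>F s in at t within {0..}. norm ((oja_field G q (embeds (U s)) - oja_field G q (embeds (U t))) $ i)
            = norm (embed (\<lambda>x. F s i x - F t i x))"
          using ev
        proof eventually_elim
          case (elim s)
          then show ?case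
            using embed_diff[OF F(1)[OF elim] F(1)[OF t], of i i]
            unfolding F(2)[OF elim, symmetric] F(2)[OF t, symmetric] by (simp add: embeds_def)
        qed
      qed
      moreover have "\<forall>\<^sub>F s in at t within {0..}. (\<lambda>x. F s i x - F t i x) \<in> H01 \<Omega>"
        using ev by eventually_elim (use t embed_diff F(1) in blast)
      ultimately show ?thesis
        using Hnorm_tendsto_0_iff[of "\<lambda>s x. F s i x - F t i x" "at t within {0..}"] by simp
    qed
    show "is_solution \<Omega> V U0 U"
      unfolding is_solution_def
    proof (intro conjI exI[of _ F])
      show "\<forall>t\<ge>0. \<forall>i. ((\<lambda>h. Hnorm \<Omega> V (\<lambda>x. (U (t + h) i x - U t i x) / h - F t i x)) \<longlongrightarrow> 0) (at 0 within {-t..})"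
        using quotient_iff[of U, OF U F(1)] * F(2) by auto
      show "\<forall>t\<ge>0. \<forall>i. Hnorm \<Omega> V (\<lambda>x. F t i x -
          (GT \<Omega> V (U t) i x - tmul (U t) (gram \<Omega> (GT \<Omega> V (U t)) (U t)) i x)) = 0"
      proof (intro allI impI)
        fix t :: real and i assume t: "t \<ge> 0"
        show "Hnorm \<Omega> V (\<lambda>x. F t i x -
            (GT \<Omega> V (U t) i x - tmul (U t) (gram \<Omega> (GT \<Omega> V (U t)) (U t)) i x)) = 0"
          using Hnorm_diff_eq_0_iff[OF F(1)[OF t] F(1)[OF t], of i i] by (simp add: F_def)
      qed
    qed (use True F(1) lim init * in blast)+
  qed
qed

end

theorem theorem3p6:
  fixes \<Omega> :: "'d::euclidean_space set" and V :: "'d \<Rightarrow> real"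
    and U0 :: "'n::finite \<Rightarrow> 'd \<Rightarrow> real"
  assumes "bdomain \<Omega>" and "admissible_potential \<Omega> V"
    and "U0 \<in> quasi_stiefel \<Omega>"
  shows "(\<exists>U. is_solution \<Omega> V U0 U) \<and>
         (\<forall>U W. is_solution \<Omega> V U0 U \<longrightarrow> is_solution \<Omega> V U0 W \<longrightarrow>
            (\<forall>t\<ge>0. \<forall>i. Hnorm \<Omega> V (\<lambda>x. U t i x - W t i x) = 0))"
proof -
  interpret schroedinger \<Omega> V
    using assms by unfold_locales (auto simp: bdomain_def)
  obtain G where "bounded_linear G" "\<And>s. G s \<in> H1_space" "\<And>s. 0 \<le> fst (G s) \<bullet> fst s"
    "\<And>f. f \<in> H01 \<Omega> \<Longrightarrow> Gop \<Omega> V f \<in> H01 \<Omega> \<and> embed (Gop \<Omega> V f) = G (embed f)"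
    by (rule Green_operator) blast
  then have "oja_transfer_axioms \<Omega> V G" by (rule oja_transfer_axioms.intro)
  with schroedinger_axioms interpret oja_transfer \<Omega> V G by (rule oja_transfer.intro)
  have U0: "U0 i \<in> H01 \<Omega>" for i using assms(3) by (simp add: quasi_stiefel_def)
  note sol = is_solution_iff[of U0, OF U0]
  show ?thesis
  proof (intro conjI allI impI)
    obtain X :: "real \<Rightarrow> (('d, real) L2 \<times> ('d, 'd) L2) ^ 'n"
      where X: "X 0 = embeds U0" "\<And>t i. t \<ge> 0 \<Longrightarrow> X t $ i \<in> H1_space"
      "\<And>t. t \<ge> 0 \<Longrightarrow> (X has_vector_derivative oja_field G q (X t)) (at t within {0..})"
      using oja_flow_exists[OF G(1) bounded_bilinear_q G(3) closed_H1_space subspace_H1_space G(2), of "embeds U0"]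
        embed_in_H1_space[OF U0] by (auto simp: embeds_def)
    \<comment> \<open>Representatives are chosen separately for each time. No regularity in
      \<open>t\<close> at fixed points \<open>x\<close> is needed, as every condition on
      \<open>U\<close> is expressed through \<open>Hnorm\<close>; negative times are left
      arbitrary.\<close>
    define U where "U t i = (SOME u. u \<in> H01 \<Omega> \<and> embed u = X t $ i)" for t i
    have U: "U t i \<in> H01 \<Omega>" "embed (U t i) = X t $ i" if "t \<ge> 0" for t i
      using someI_ex[OF embed_surj[OF X(2)[OF that], unfolded Bex_def]] unfolding U_def by blast+
    have UX: "embeds (U t) = X t" if "t \<ge> 0" for t
      using U[OF that] by (simp add: embeds_def vec_eq_iff)
    \<comment> \<open>The two curves agree for nonnegative times only, which suffices for a
      derivative taken within \<open>{0..}\<close>.\<close>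
    have "((\<lambda>t. embeds (U t)) has_vector_derivative oja_field G q (embeds (U t))) (at t within {0..})"
      if "t \<ge> 0" for t
      using X(3)[OF that] that
      by (auto simp: UX intro: has_vector_derivative_transform[where f = X])
    then show "\<exists>U. is_solution \<Omega> V U0 U"
      unfolding sol using U UX X(1) by (intro exI[of _ U]) auto
  next
    fix U W t i assume U: "is_solution \<Omega> V U0 U" and W: "is_solution \<Omega> V U0 W" and t: "(t::real) \<ge> 0"
    have "embeds (U t) = embeds (W t)"
    proof (rule oja_flow_unique[OF G(1) bounded_bilinear_q, of "\<lambda>t. embeds (U t)" "\<lambda>t. embeds (W t)"])
      show "embeds (U 0) = embeds (W 0)"
        using U W unfolding sol by simp
      show "((\<lambda>t. embeds (U t)) has_vector_derivative oja_field G q (embeds (U r))) (at r within {0..})"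
        "((\<lambda>t. embeds (W t)) has_vector_derivative oja_field G q (embeds (W r))) (at r within {0..})"
        if "r \<ge> 0" for r
        using U W that unfolding sol by blast+
    qed (rule t)
    then show "Hnorm \<Omega> V (\<lambda>x. U t i x - W t i x) = 0"
      using U W t unfolding sol by (simp add: Hnorm_diff_eq_0_iff embeds_def vec_eq_iff)
  qed
qed

end
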